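(* (i) Let $\boldsymbol\lambda=(\lambda_1,\lambda_2)$ and $\boldsymbol\mu=(\mu_1,\mu_2)$ have positive entries. The pair of multiplication operators $(M_{z_1},M_{z_2})$ on the reproducing kernel Hilbert space $\boldsymbol A^{(\boldsymbol\lambda,\boldsymbol\mu)}(\mathbb D^2)$ with reproducing kernel $K^{(\boldsymbol\lambda,\boldsymbol\mu)}$ on $\mathbb D^2$ is homogeneous under the action of the group $\mathrm{Aut}(\mathbb D^2)$ if and only if $\lambda_1=\lambda_2$ and $\mu_1=\mu_2$. (ii) Let $\boldsymbol\alpha=(\alpha_1,\alpha_2)$ and $\boldsymbol\beta=(\beta_1,\beta_2)$ have positive entries. The pair of multiplication operators $(M_{z_1},M_{z_2})$ on the reproducing kernel Hilbert space $\boldsymbol H^{(\boldsymbol\alpha,\boldsymbol\beta)}(\mathbb D^2)$ with reproducing kernel $L^{(\boldsymbol\alpha,\boldsymbol\beta)}$ on $\mathbb D^2$ is homogeneous under the action of the group $\mathrm{Aut}(\mathbb D^2)$ if and only if $\alpha_1=\alpha_2$ and $\beta_1=1$.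
   Context: $\mathbb D$ is the open unit disc; $\mathrm{Aut}(\mathbb D^2)$ is the group of biholomorphic automorphisms of $\mathbb D^2$. A commuting pair $\boldsymbol T$ of bounded operators on a complex separable Hilbert space is homogeneous with respect to $\mathrm{Aut}(\mathbb D^2)$ if its joint spectrum lies in $\overline{\mathbb D}^2$ and $g(\boldsymbol T)$ is (simultaneously) unitarily equivalent to $\boldsymbol T$ for all $g\in\mathrm{Aut}(\mathbb D^2)$. $M_{z_i}$ denotes multiplication by the $i$-th coordinate function. The kernels are $$K^{(\boldsymbol\lambda,\boldsymbol\mu)}(\boldsymbol z,\boldsymbol w)=D\begin{pmatrix}1&z_1&z_2\\ \bar w_1&\frac1{\lambda_1}+\mu_1^2+z_1\bar w_1&\bar w_1z_2\\ \bar w_2&z_1\bar w_2&\frac1{\lambda_2}+\mu_2^2+z_2\bar w_2\end{pmatrix}D\prod_{j=1}^2(1-z_j\bar w_j)^{-\lambda_j-2},$$ with $D=\mathrm{diag}((1-z_1\bar w_1)(1-z_2\bar w_2),\,1-z_2\bar w_2,\,1-z_1\bar w_1)$, and $$L^{(\boldsymbol\alpha,\boldsymbol\beta)}(\boldsymbol z,\boldsymbol w)=D_2\begin{pmatrix}1&0&z_1\\0&\beta_1^2&\beta_1^2z_2\\ \bar w_1&\beta_1^2\bar w_2&z_1\bar w_1+\beta_1^2z_2\bar w_2+\frac1{\alpha_1}+\frac{\beta_1^2}{\alpha_2}+\beta_2^2\end{pmatrix}D_2\prod_{j=1}^2(1-z_j\bar w_j)^{-\alpha_j-2},$$ with $D_2=\mathrm{diag}(1-z_1\bar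 w_1,\,1-z_2\bar w_2,\,1)$. $\boldsymbol A^{(\boldsymbol\lambda,\boldsymbol\mu)}(\mathbb D^2)$ and $\boldsymbol H^{(\boldsymbol\alpha,\boldsymbol\beta)}(\mathbb D^2)$ are the corresponding reproducing kernel Hilbert spaces of $\mathbb C^3$-valued holomorphic functions on $\mathbb D^2$. *)

theory Defs
  imports "HOL-Analysis.Analysis" "HOL-Library.Function_Algebras"
begin

section \<open>Complex Hilbert spaces carried by a set\<close>

text \<open>Addition is that of the ambient type; for functions it is the pointwise one of
  \<^theory>\<open>HOL-Library.Function_Algebras\<close>. The inner product is linear in its first argument.\<close>

record 'a hspace =
  carr :: "'a set"
  scl :: "complex \<Rightarrow> 'a \<Rightarrow> 'a"
  ip :: "'a \<Rightarrow> 'a \<Rightarrow> complex"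

definition hnorm :: "'a::ab_group_add hspace \<Rightarrow> 'a \<Rightarrow> real" where
  "hnorm H x = sqrt (Re (ip H x x))"

definition complex_hilbert_space :: "'a::ab_group_add hspace \<Rightarrow> bool" where
  "complex_hilbert_space H \<longleftrightarrow>
     vector_space (scl H) \<and> module.subspace (scl H) (carr H) \<and>
     (\<forall>x\<in>carr H. \<forall>y\<in>carr H. \<forall>z\<in>carr H. ip H (x + y) z = ip H x z + ip H y z) \<and>
     (\<forall>c. \<forall>x\<in>carr H. \<forall>y\<in>carr H. ip H (scl H c x) y = c * ip H x y) \<and>
     (\<forall>x\<in>carr H. \<forall>y\<in>carr H. ip H y x = cnj (ip H x y)) \<and>
     (\<forall>x\<in>carr H. 0 \<le> Re (ip H x x)) \<and>
     (\<forall>x\<in>carr H. ip H x x = 0 \<longrightarrow> x = 0) \<and>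
     (\<forall>s::nat \<Rightarrow> 'a. range s \<subseteq> carr H \<and>
        (\<forall>e>0. \<exists>N. \<forall>m\<ge>N. \<forall>n\<ge>N. hnorm H (s m - s n) < e) \<longrightarrow>
        (\<exists>x\<in>carr H. (\<lambda>n. hnorm H (s n - x)) \<longlonglongrightarrow> 0))"

definition separable_hspace :: "'a::ab_group_add hspace \<Rightarrow> bool" where
  "separable_hspace H \<longleftrightarrow>
     (\<exists>D. countable D \<and> D \<subseteq> carr H \<and> (\<forall>x\<in>carr H. \<forall>e>0. \<exists>d\<in>D. hnorm H (x - d) < e))"

text \<open>An operator is a function on the ambient type; only its values on the carrier matter.\<close>

definition linear_in :: "'a::ab_group_add hspace \<Rightarrow> ('a \<Rightarrow> 'a) \<Rightarrow> bool" where
  "linear_in H T \<longleftrightarrow>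
     T ` carr H \<subseteq> carr H \<and>
     (\<forall>x\<in>carr H. \<forall>y\<in>carr H. T (x + y) = T x + T y) \<and>
     (\<forall>c. \<forall>x\<in>carr H. T (scl H c x) = scl H c (T x))"

definition bounded_operator :: "'a::ab_group_add hspace \<Rightarrow> ('a \<Rightarrow> 'a) \<Rightarrow> bool" where
  "bounded_operator H T \<longleftrightarrow>
     linear_in H T \<and> (\<exists>C. \<forall>x\<in>carr H. hnorm H (T x) \<le> C * hnorm H x)"

definition unitary_operator :: "'a::ab_group_add hspace \<Rightarrow> ('a \<Rightarrow> 'a) \<Rightarrow> bool" where
  "unitary_operator H U \<longleftrightarrow>
     linear_in H U \<and> bij_betw U (carr H) (carr H) \<and>
     (\<forall>x\<in>carr H. \<forall>y\<in>carr H. ip H (U x) (U y) = ip H x y)"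

definition unitarily_equivalent ::
    "'a::ab_group_add hspace \<Rightarrow> ('a \<Rightarrow> 'a) \<times> ('a \<Rightarrow> 'a) \<Rightarrow> ('a \<Rightarrow> 'a) \<times> ('a \<Rightarrow> 'a) \<Rightarrow> bool" where
  "unitarily_equivalent H S T \<longleftrightarrow>
     (\<exists>U. unitary_operator H U \<and>
        (\<forall>x\<in>carr H. U (fst S x) = fst T (U x) \<and> U (snd S x) = snd T (U x)))"

text \<open>Exactness of the Koszul complex
  \<open>0 \<rightarrow> H \<rightarrow> H \<oplus> H \<rightarrow> H \<rightarrow> 0\<close>, whose maps are \<open>u \<mapsto> (S\<^sub>1 u, S\<^sub>2 u)\<close> and
  \<open>(x, y) \<mapsto> S\<^sub>1 y - S\<^sub>2 x\<close>, and Taylor's joint spectrum.\<close>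

definition koszul_exact :: "'a::ab_group_add hspace \<Rightarrow> ('a \<Rightarrow> 'a) \<times> ('a \<Rightarrow> 'a) \<Rightarrow> bool" where
  "koszul_exact H S \<longleftrightarrow>
     (\<forall>u\<in>carr H. fst S u = 0 \<and> snd S u = 0 \<longrightarrow> u = 0) \<and>
     (\<forall>x\<in>carr H. \<forall>y\<in>carr H. fst S y - snd S x = 0 \<longrightarrow>
        (\<exists>u\<in>carr H. x = fst S u \<and> y = snd S u)) \<and>
     (\<forall>h\<in>carr H. \<exists>x\<in>carr H. \<exists>y\<in>carr H. fst S y - snd S x = h)"

definition joint_spectrum ::
    "'a::ab_group_add hspace \<Rightarrow> ('a \<Rightarrow> 'a) \<times> ('a \<Rightarrow> 'a) \<Rightarrow> (complex \<times> complex) set" where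
  "joint_spectrum H T =
     {(a, b). \<not> koszul_exact H (\<lambda>x. fst T x - scl H a x, \<lambda>x. snd T x - scl H b x)}"

section \<open>The bidisc, its automorphisms, and homogeneous pairs\<close>

definition bidisc :: "(complex \<times> complex) set" where
  "bidisc = ball 0 1 \<times> ball 0 1"

definition closed_bidisc :: "(complex \<times> complex) set" where
  "closed_bidisc = cball 0 1 \<times> cball 0 1"

text \<open>Complex differentiability in two variables: the Frechet derivative is complex linear.\<close>

definition holomorphic2_on :: "(complex \<times> complex \<Rightarrow> complex) \<Rightarrow> (complex \<times> complex) set \<Rightarrow> bool" where
  "holomorphic2_on f S \<longleftrightarrow>
     (\<forall>z\<in>S. \<exists>a b. (f has_derivative (\<lambda>h. a * fst h + b * snd h)) (at z))"

definition aut_bidisc :: "(complex \<times> complex \<Rightarrow> complex \<times> complex) set" where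
  "aut_bidisc = {g. bij_betw g bidisc bidisc \<and>
     holomorphic2_on (fst \<circ> g) bidisc \<and> holomorphic2_on (snd \<circ> g) bidisc \<and>
     holomorphic2_on (fst \<circ> inv_into bidisc g) bidisc \<and>
     holomorphic2_on (snd \<circ> inv_into bidisc g) bidisc}"

text \<open>\<open>A = f(T)\<close> for a commuting pair \<open>T\<close> with joint spectrum in the closed bidisc and \<open>f\<close> on the
  bidisc that extends holomorphically to a neighbourhood of the closed bidisc. Such an \<open>f\<close> has a
  power series converging absolutely on a polydisc of radius \<open>r > 1\<close>, and the holomorphic
  functional calculus substitutes \<open>T\<close> into it, with convergence in operator norm. The values of
  \<open>f\<close> on the bidisc determine the coefficients, hence \<open>A\<close> on the carrier.\<close>

definition functional_calculus ::
    "'a::ab_group_add hspace \<Rightarrow> ('a \<Rightarrow> 'a) \<times> ('a \<Rightarrow> 'a) \<Rightarrow> (complex \<times> complex \<Rightarrow> complex)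
      \<Rightarrow> ('a \<Rightarrow> 'a) \<Rightarrow> bool" where
  "functional_calculus H T f A \<longleftrightarrow> bounded_operator H A \<and>
     (\<exists>(c :: nat \<times> nat \<Rightarrow> complex) (r :: real). r > 1 \<and>
        (\<lambda>(m, n). norm (c (m, n)) * r ^ (m + n)) summable_on UNIV \<and>
        (\<forall>z\<in>bidisc. ((\<lambda>(m, n). c (m, n) * fst z ^ m * snd z ^ n) has_sum f z) UNIV) \<and>
        (\<forall>e>0. \<forall>\<^sub>F F in finite_subsets_at_top UNIV. \<forall>x\<in>carr H.
           hnorm H (A x - (\<Sum>(m, n)\<in>F. scl H (c (m, n)) ((fst T ^^ m) ((snd T ^^ n) x))))
             \<le> e * hnorm H x))"

definition homogeneous_pair :: "'a::ab_group_add hspace \<Rightarrow> ('a \<Rightarrow> 'a) \<times> ('a \<Rightarrow> 'a) \<Rightarrow> bool" where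
  "homogeneous_pair H T \<longleftrightarrow>
     complex_hilbert_space H \<and> separable_hspace H \<and>
     bounded_operator H (fst T) \<and> bounded_operator H (snd T) \<and>
     (\<forall>x\<in>carr H. fst T (snd T x) = snd T (fst T x)) \<and>
     joint_spectrum H T \<subseteq> closed_bidisc \<and>
     (\<forall>g\<in>aut_bidisc. \<exists>A B.
        functional_calculus H T (fst \<circ> g) A \<and> functional_calculus H T (snd \<circ> g) B \<and>
        unitarily_equivalent H (A, B) T)"

section \<open>Reproducing kernel Hilbert spaces on the bidisc\<close>

definition cdot :: "complex^'n \<Rightarrow> complex^'n \<Rightarrow> complex" where
  "cdot u v = (\<Sum>i\<in>UNIV. u $ i * cnj (v $ i))"

text \<open>\<open>H\<close> is the space of \<open>\<complex>\<^sup>n\<close>-valued holomorphic functions on the bidisc with reproducing kernel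
  \<open>K\<close>. Functions on the bidisc are represented by functions on the whole type that vanish
  elsewhere, so that equality in the type is equality on the bidisc.\<close>

definition holomorphic_rkhs ::
    "(complex \<times> complex \<Rightarrow> complex \<times> complex \<Rightarrow> complex^'n^'n)
      \<Rightarrow> (complex \<times> complex \<Rightarrow> complex^'n) hspace \<Rightarrow> bool" where
  "holomorphic_rkhs K H \<longleftrightarrow>
     complex_hilbert_space H \<and>
     scl H = (\<lambda>c f z. c *s f z) \<and>
     (\<forall>f\<in>carr H. (\<forall>z. z \<notin> bidisc \<longrightarrow> f z = 0) \<and> (\<forall>i. holomorphic2_on (\<lambda>z. f z $ i) bidisc)) \<and>
     (\<forall>w\<in>bidisc. \<forall>v.
        let k = (\<lambda>z. if z \<in> bidisc then K z w *v v else 0)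
        in k \<in> carr H \<and> (\<forall>f\<in>carr H. ip H f k = cdot (f w) v))"

definition mult_op ::
    "(complex \<times> complex \<Rightarrow> complex) \<Rightarrow> (complex \<times> complex \<Rightarrow> complex^'n)
      \<Rightarrow> (complex \<times> complex \<Rightarrow> complex^'n)" where
  "mult_op p f = (\<lambda>z. p z *s f z)"

definition coord_mult_pair ::
    "((complex \<times> complex \<Rightarrow> complex^'n) \<Rightarrow> (complex \<times> complex \<Rightarrow> complex^'n)) \<times>
     ((complex \<times> complex \<Rightarrow> complex^'n) \<Rightarrow> (complex \<times> complex \<Rightarrow> complex^'n))" where
  "coord_mult_pair = (mult_op fst, mult_op snd)"

definition diag3 :: "complex \<Rightarrow> complex \<Rightarrow> complex \<Rightarrow> complex^3^3" where
  "diag3 a b c = vector [vector [a, 0, 0], vector [0, b, 0], vector [0, 0, c]]"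

text \<open>The powers are principal branches: \<open>1 - z\<^sub>j \<bar>w\<^sub>j\<close> has positive real part on the bidisc.\<close>

definition kernel_factor ::
    "real \<Rightarrow> real \<Rightarrow> complex \<times> complex \<Rightarrow> complex \<times> complex \<Rightarrow> complex" where
  "kernel_factor s t z w =
     (1 - fst z * cnj (fst w)) powr of_real (- s - 2) *
     (1 - snd z * cnj (snd w)) powr of_real (- t - 2)"

definition kernel_K ::
    "real \<Rightarrow> real \<Rightarrow> real \<Rightarrow> real \<Rightarrow> complex \<times> complex \<Rightarrow> complex \<times> complex \<Rightarrow> complex^3^3" where
  "kernel_K lam1 lam2 mu1 mu2 z w =
     (let z1 = fst z; z2 = snd z; v1 = cnj (fst w); v2 = cnj (snd w);
          D = diag3 ((1 - z1 * v1) * (1 - z2 * v2)) (1 - z2 * v2) (1 - z1 * v1);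
          M = vector
            [vector [1, z1, z2],
             vector [v1, of_real (1 / lam1 + mu1\<^sup>2) + z1 * v1, v1 * z2],
             vector [v2, z1 * v2, of_real (1 / lam2 + mu2\<^sup>2) + z2 * v2]]
      in mat (kernel_factor lam1 lam2 z w) ** (D ** M ** D))"

definition kernel_L ::
    "real \<Rightarrow> real \<Rightarrow> real \<Rightarrow> real \<Rightarrow> complex \<times> complex \<Rightarrow> complex \<times> complex \<Rightarrow> complex^3^3" where
  "kernel_L al1 al2 be1 be2 z w =
     (let z1 = fst z; z2 = snd z; v1 = cnj (fst w); v2 = cnj (snd w);
          D = diag3 (1 - z1 * v1) (1 - z2 * v2) 1;
          b = of_real (be1\<^sup>2);
          M = vector
            [vector [1, 0, z1],
             vector [0, b, b * z2],
             vector [v1, b * v2,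
               z1 * v1 + b * z2 * v2 + of_real (1 / al1 + be1\<^sup>2 / al2 + be2\<^sup>2)]]
      in mat (kernel_factor al1 al2 z w) ** (D ** M ** D))"

end

theory Submission
  imports Defs "HOL-Complex_Analysis.Conformal_Mappings"
begin

text \<open>Why the theorem holds. Let \<open>S\<^sub>1, S\<^sub>2\<close> be powers of \<open>1 / (1 - z\<^sub>j \<bar>w\<^sub>j)\<close>. Applying the jet operator
\<open>f \<mapsto> (f, \<partial>\<^sub>1 f / \<lambda>\<^sub>1, \<partial>\<^sub>2 f / \<lambda>\<^sub>2)\<close> in \<open>z\<close> and its conjugate in \<open>w\<close> to the scalar kernel \<open>S\<^sub>1 S\<^sub>2\<close> with
exponents \<open>\<lambda>\<^sub>1, \<lambda>\<^sub>2\<close> gives the part of \<open>K\<close> without \<open>\<mu>\<close>; the remainder of \<open>K\<close> is \<open>\<mu>\<^sub>1\<^sup>2\<close> and \<open>\<mu>\<^sub>2\<^sup>2\<close> times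
scalar kernels, with one exponent raised by two, in the last two diagonal places. In the same way \<open>L\<close> is the jet in
\<open>z\<^sub>1\<close> of one scalar kernel, plus \<open>\<beta>\<^sub>1\<^sup>2\<close> times the jet in \<open>z\<^sub>2\<close> of another, plus \<open>\<beta>\<^sub>2\<^sup>2\<close> times a third
(\<open>kernel_K_jets\<close>, \<open>kernel_L_jets\<close>). Boundedness, covariance and the invariants of the kernels all come from this form.

Expanding the scalar kernels in monomials shows that multiplication by \<open>z\<^sub>j\<^sup>m\<close> is bounded with a norm that grows at
most linearly in \<open>m\<close> (\<open>jet_sum_growth\<close>): it moves a jet of a monomial to a multiple of a shifted jet, and the
error is absorbed by the scalar kernel with the raised exponent. Linear growth makes every power series with radius
of convergence above one in a coordinate operate on the space, in norm. This yields the joint spectrum, the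
functional calculus for automorphisms, and the multipliers \<open>(1 - z\<^sub>j \<bar>w\<^sub>j)\<^sup>-\<^sup>s\<close>.

If the parameters are as stated, homogeneity follows from the change of variables rule for jets. The scalar
kernels are covariant under Moebius maps with a nowhere vanishing factor, so the jet kernels are covariant with a
lower triangular matrix factor \<open>J\<close> (\<open>jet_mob\<close>, \<open>kernel_K_covariant\<close>, \<open>kernel_L_covariant\<close>); the equalities
of parameters make them covariant under the coordinate swap as well. By Schwarz' lemma these maps generate
the automorphism group of the bidisc (\<open>aut_bidisc_bimob\<close>), and \<open>f \<mapsto> J (f \<circ> g\<^sup>-\<^sup>1)\<close> is a unitary that intertwines
\<open>g(M\<^bsub>z\<^sub>1\<^esub>, M\<^bsub>z\<^sub>2\<^esub>)\<close> with \<open>(M\<^bsub>z\<^sub>1\<^esub>, M\<^bsub>z\<^sub>2\<^esub>)\<close>.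

Conversely, homogeneity applied to the swap \<open>\<sigma>\<close> alone gives a unitary \<open>U\<close> exchanging the two coordinate operators.
Constants generate the whole space under the coordinate operators, so \<open>(U f)(w) = J(w) f(\<sigma> w)\<close>, where the columns of
\<open>J\<close> are the images of the constants, and the kernel satisfies \<open>K(z, w) = J(z) K(\<sigma> z, \<sigma> w) J(w)\<^sup>*\<close>
(\<open>homogeneous_imp_swap_covariant\<close>). Hence \<open>K(z, 0)\<^sup>-\<^sup>1 K(z, z) K(0, z)\<^sup>-\<^sup>1 K(0, 0)\<close> has the same determinant and trace
at \<open>z\<close> and at \<open>\<sigma> z\<close>. At \<open>z = (1/2, 0)\<close> the determinants force equal exponents, and the traces then force
\<open>\<mu>\<^sub>1 = \<mu>\<^sub>2\<close>, respectively \<open>\<beta>\<^sub>1 = 1\<close>.\<close>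

section \<open>Hilbert spaces carried by a set\<close>

locale hilbert =
  fixes H :: "'a::ab_group_add hspace"
  assumes hs: "complex_hilbert_space H"
begin

sublocale vs: vector_space "scl H"
  using hs unfolding complex_hilbert_space_def by simp

lemma carr_subspace: "vs.subspace (carr H)"
  using hs unfolding complex_hilbert_space_def by simp

lemma carr_0 [simp]: "0 \<in> carr H"
  and carr_add [simp]: "x \<in> carr H \<Longrightarrow> y \<in> carr H \<Longrightarrow> x + y \<in> carr H"
  and carr_scl [simp]: "x \<in> carr H \<Longrightarrow> scl H c x \<in> carr H"
  and carr_diff [simp]: "x \<in> carr H \<Longrightarrow> y \<in> carr H \<Longrightarrow> x - y \<in> carr H"
  and carr_sum: "(\<And>i. i \<in> I \<Longrightarrow> u i \<in> carr H) \<Longrightarrow> sum u I \<in> carr H"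
  using carr_subspace
  by (simp_all add: vs.subspace_0 vs.subspace_add vs.subspace_scale vs.subspace_diff vs.subspace_sum)

lemmas hilbert_axioms = hs[unfolded complex_hilbert_space_def, THEN conjunct2, THEN conjunct2]

lemmas ip_add_left [simp] = hilbert_axioms[THEN conjunct1, rule_format]
lemmas ip_scl_left [simp] = hilbert_axioms[THEN conjunct2, THEN conjunct1, rule_format]
lemmas ip_cnj = hilbert_axioms[THEN conjunct2, THEN conjunct2, THEN conjunct1, rule_format]
lemmas ip_self_ge0 =
  hilbert_axioms[THEN conjunct2, THEN conjunct2, THEN conjunct2, THEN conjunct1, rule_format]
lemmas ip_self_eq0 =
  hilbert_axioms[THEN conjunct2, THEN conjunct2, THEN conjunct2, THEN conjunct2, THEN conjunct1,
    rule_format]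

lemma ip_add_right [simp]:
  assumes "x \<in> carr H" "y \<in> carr H" "z \<in> carr H"
  shows "ip H z (x + y) = ip H z x + ip H z y"
  using assms ip_cnj[of "x + y" z] ip_cnj[of x z] ip_cnj[of y z] by simp

lemma ip_scl_right [simp]:
  assumes "x \<in> carr H" "y \<in> carr H"
  shows "ip H x (scl H c y) = cnj c * ip H x y"
  using assms ip_cnj[of "scl H c y" x] ip_cnj[of y x] by simp

lemma ip_diff_left [simp]:
  assumes "x \<in> carr H" "y \<in> carr H" "z \<in> carr H"
  shows "ip H (x - y) z = ip H x z - ip H y z"
  using ip_add_left[of "x - y" y z] assms by (simp add: algebra_simps)

lemma ip_diff_right [simp]:
  assumes "x \<in> carr H" "y \<in> carr H" "z \<in> carr H"
  shows "ip H z (x - y) = ip H z x - ip H z y"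
  using ip_add_right[of "x - y" y z] assms by (simp add: algebra_simps)

lemma ip_0_left [simp]: "x \<in> carr H \<Longrightarrow> ip H 0 x = 0"
  using ip_add_left[of 0 0 x] by simp

lemma ip_0_right [simp]: "x \<in> carr H \<Longrightarrow> ip H x 0 = 0"
  using ip_add_right[of 0 0 x] by simp

lemma hnorm_ge0 [simp]: "x \<in> carr H \<Longrightarrow> 0 \<le> hnorm H x"
  by (simp add: hnorm_def ip_self_ge0)

lemma hnorm_sq: "x \<in> carr H \<Longrightarrow> (hnorm H x)\<^sup>2 = Re (ip H x x)"
  by (simp add: hnorm_def ip_self_ge0)

lemma ip_self: "x \<in> carr H \<Longrightarrow> ip H x x = of_real ((hnorm H x)\<^sup>2)"
  using ip_cnj[of x x] by (simp add: hnorm_sq complex_eq_iff)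

lemma hnorm_eq0: "x \<in> carr H \<Longrightarrow> hnorm H x = 0 \<Longrightarrow> x = 0"
  using ip_self ip_self_eq0 by fastforce

lemma hnorm_0 [simp]: "hnorm H 0 = 0"
  by (simp add: hnorm_def)

lemma hnorm_scl [simp]: "x \<in> carr H \<Longrightarrow> hnorm H (scl H c x) = cmod c * hnorm H x"
proof -
  assume x: "x \<in> carr H"
  have "(hnorm H (scl H c x))\<^sup>2 = (cmod c * hnorm H x)\<^sup>2"
  proof -
    have "ip H (scl H c x) (scl H c x) = (c * cnj c) * of_real ((hnorm H x)\<^sup>2)"
      using x by (simp add: ip_self[OF x, symmetric] del: of_real_power)
    also have "\<dots> = of_real ((cmod c * hnorm H x)\<^sup>2)"
      by (simp only: complex_norm_square[symmetric] power_mult_distrib of_real_mult of_real_power)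
    finally show ?thesis using x by (simp add: hnorm_sq)
  qed
  then show ?thesis using x by (simp add: power2_eq_iff_nonneg)
qed

lemma hnorm_add_sq:
  assumes "x \<in> carr H" "y \<in> carr H"
  shows "(hnorm H (x + y))\<^sup>2 = (hnorm H x)\<^sup>2 + 2 * Re (ip H x y) + (hnorm H y)\<^sup>2"
  using assms ip_cnj[of x y] by (simp add: hnorm_sq)

lemma hnorm_diff_sq:
  assumes "x \<in> carr H" "y \<in> carr H"
  shows "(hnorm H (x - y))\<^sup>2 = (hnorm H x)\<^sup>2 - 2 * Re (ip H x y) + (hnorm H y)\<^sup>2"
  using assms ip_cnj[of x y] by (simp add: hnorm_sq)

lemma hnorm_minus_commute:
  assumes "x \<in> carr H" "y \<in> carr H"
  shows "hnorm H (x - y) = hnorm H (y - x)"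
proof -
  have "(hnorm H (x - y))\<^sup>2 = (hnorm H (y - x))\<^sup>2"
    using assms ip_cnj[of x y] by (simp add: hnorm_diff_sq)
  then show ?thesis using assms by (simp add: power2_eq_iff_nonneg)
qed

lemma Cauchy_Schwarz_ip:
  assumes x: "x \<in> carr H" and y: "y \<in> carr H"
  shows "cmod (ip H x y) \<le> hnorm H x * hnorm H y"
proof (cases "hnorm H y = 0")
  case True
  then have "y = 0" using y hnorm_eq0 by blast
  then show ?thesis using x by simp
next
  case False
  define n where "n = (hnorm H y)\<^sup>2"
  have n: "n > 0" using False y by (simp add: n_def)
  define c where "c = ip H x y / of_real n"
  have "0 \<le> (hnorm H (x - scl H c y))\<^sup>2" by simp
  also have "\<dots> = (hnorm H x)\<^sup>2 - 2 * Re (cnj c * ip H x y) + (cmod c)\<^sup>2 * n"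
    using x y by (simp add: hnorm_diff_sq n_def power_mult_distrib)
  also have "cnj c * ip H x y = of_real ((cmod (ip H x y))\<^sup>2 / n)"
  proof -
    have "cnj c * ip H x y = (ip H x y * cnj (ip H x y)) / of_real n"
      by (simp add: c_def)
    also have "\<dots> = of_real ((cmod (ip H x y))\<^sup>2 / n)"
      by (simp only: complex_norm_square[symmetric] of_real_divide of_real_power)
    finally show ?thesis .
  qed
  also have "(cmod c)\<^sup>2 * n = (cmod (ip H x y))\<^sup>2 / n"
    using n by (simp add: c_def norm_divide power_divide power2_eq_square)
  finally have "(cmod (ip H x y))\<^sup>2 / n \<le> (hnorm H x)\<^sup>2" by simp
  then have "(cmod (ip H x y))\<^sup>2 \<le> (hnorm H x * hnorm H y)\<^sup>2"
    using n by (simp add: field_simps n_def power_mult_distrib)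
  then show ?thesis by (rule power2_le_imp_le) (use x y in simp)
qed

lemma hnorm_triangle:
  assumes x: "x \<in> carr H" and y: "y \<in> carr H"
  shows "hnorm H (x + y) \<le> hnorm H x + hnorm H y"
proof -
  have "Re (ip H x y) \<le> hnorm H x * hnorm H y"
    using Cauchy_Schwarz_ip[OF x y] complex_Re_le_cmod order_trans by blast
  then have "(hnorm H (x + y))\<^sup>2 \<le> (hnorm H x + hnorm H y)\<^sup>2"
    using x y by (simp add: hnorm_add_sq power2_sum)
  then show ?thesis by (rule power2_le_imp_le) (use x y in simp)
qed

lemma hnorm_triangle_diff:
  assumes "x \<in> carr H" "y \<in> carr H" "z \<in> carr H"
  shows "hnorm H (x - z) \<le> hnorm H (x - y) + hnorm H (y - z)"
  using hnorm_triangle[of "x - y" "y - z"] assms by simp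

lemma hnorm_triangle_minus:
  assumes "x \<in> carr H" "y \<in> carr H"
  shows "hnorm H x \<le> hnorm H (x - y) + hnorm H y"
  using hnorm_triangle[of "x - y" y] assms by simp

lemma hnorm_sum_le:
  assumes "\<And>i. i \<in> I \<Longrightarrow> u i \<in> carr H"
  shows "hnorm H (sum u I) \<le> (\<Sum>i\<in>I. hnorm H (u i))"
  using assms
proof (induction I rule: infinite_finite_induct)
  case (insert i I)
  then show ?case
    using hnorm_triangle[of "u i" "sum u I"] carr_sum[of I u] by fastforce
qed auto

lemma ip_tendsto:
  assumes s: "\<And>n. s n \<in> carr H" and x: "x \<in> carr H" and y: "y \<in> carr H"
    and lim: "(\<lambda>n. hnorm H (s n - x)) \<longlonglongrightarrow> 0"
  shows "(\<lambda>n. ip H (s n) y) \<longlonglongrightarrow> ip H x y"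
proof -
  have "(\<lambda>n. hnorm H (s n - x) * hnorm H y) \<longlonglongrightarrow> 0"
    using tendsto_mult_left_zero[OF lim] by simp
  then have "(\<lambda>n. ip H (s n) y - ip H x y) \<longlonglongrightarrow> 0"
  proof (rule Lim_null_comparison[rotated])
    show "\<forall>\<^sub>F n in sequentially. norm (ip H (s n) y - ip H x y) \<le> hnorm H (s n - x) * hnorm H y"
      using Cauchy_Schwarz_ip[of "s _ - x" y] s x y by simp
  qed
  then show ?thesis by (simp add: LIM_zero_iff)
qed

lemma hnorm_tendsto:
  assumes s: "\<And>n. s n \<in> carr H" and x: "x \<in> carr H"
    and lim: "(\<lambda>n. hnorm H (s n - x)) \<longlonglongrightarrow> 0"
  shows "(\<lambda>n. hnorm H (s n)) \<longlonglongrightarrow> hnorm H x"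
proof -
  have "(\<lambda>n. hnorm H (s n) - hnorm H x) \<longlonglongrightarrow> 0"
  proof (rule Lim_null_comparison[OF _ lim])
    have "norm (hnorm H (s n) - hnorm H x) \<le> hnorm H (s n - x)" for n
      using hnorm_triangle_minus[of "s n" x] hnorm_triangle_minus[of x "s n"]
        hnorm_minus_commute[of "s n" x] s x by (simp add: abs_le_iff)
    then show "\<forall>\<^sub>F n in sequentially. norm (hnorm H (s n) - hnorm H x) \<le> hnorm H (s n - x)"
      by simp
  qed
  then show ?thesis by (simp add: LIM_zero_iff)
qed

lemma complete:
  assumes "\<And>n. s n \<in> carr H" "\<And>e. e > 0 \<Longrightarrow> \<exists>N. \<forall>m\<ge>N. \<forall>n\<ge>N. hnorm H (s m - s n) < e"
  shows "\<exists>x\<in>carr H. (\<lambda>n. hnorm H (s n - x)) \<longlonglongrightarrow> 0"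
proof (rule hilbert_axioms[THEN conjunct2, THEN conjunct2, THEN conjunct2, THEN conjunct2,
      THEN conjunct2, THEN spec, THEN mp], rule conjI)
  show "range s \<subseteq> carr H" using assms(1) by blast
qed (use assms(2) in blast)

lemma parallelogram:
  assumes "x \<in> carr H" "y \<in> carr H"
  shows "(hnorm H (x - y))\<^sup>2 + (hnorm H (x + y))\<^sup>2 = 2 * (hnorm H x)\<^sup>2 + 2 * (hnorm H y)\<^sup>2"
  using assms by (simp add: hnorm_add_sq hnorm_diff_sq)

text \<open>Riesz' representation theorem together with orthogonal projection. The functional is given by a graph \<open>G\<close>, a
linear relation, so that it can be prescribed on formal combinations of vectors: the bound \<open>\<bar>l\<bar> \<le> C \<parallel>k\<parallel>\<close> is
what makes \<open>l\<close> depend on \<open>k\<close> only. The representing vector is a limit of vectors in the domain, obtained by minimising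
\<open>\<parallel>k\<parallel>\<^sup>2 - 2 Re l\<close>, whose minimising sequences are Cauchy by the parallelogram law.\<close>

lemma riesz:
  assumes Gc: "\<And>k l. (k, l) \<in> G \<Longrightarrow> k \<in> carr H"
    and G0: "(0, 0) \<in> G"
    and Gadd: "\<And>k l k' l'. (k, l) \<in> G \<Longrightarrow> (k', l') \<in> G \<Longrightarrow> (k + k', l + l') \<in> G"
    and Gscl: "\<And>k l c. (k, l) \<in> G \<Longrightarrow> (scl H c k, c * l) \<in> G"
    and bd: "\<And>k l. (k, l) \<in> G \<Longrightarrow> cmod l \<le> C * hnorm H k"
  obtains g s where "g \<in> carr H" "\<And>k l. (k, l) \<in> G \<Longrightarrow> ip H k g = l"
    "hnorm H g \<le> C \<or> hnorm H g = 0" "\<And>n. s n \<in> fst ` G" "(\<lambda>n. hnorm H (s n - g)) \<longlonglongrightarrow> 0"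
proof -
  \<comment> \<open>For \<open>l = \<langle>k, g\<rangle>\<close> this is \<open>\<parallel>k - g\<parallel>\<^sup>2 - \<parallel>g\<parallel>\<^sup>2\<close>.\<close>
  define J where "J = (\<lambda>(k, l). (hnorm H k)\<^sup>2 - 2 * Re l)"
  define m where "m = Inf (J ` G)"
  have Jlow: "- C\<^sup>2 \<le> J p" if "p \<in> G" for p
  proof -
    obtain k l where p: "p = (k, l)" by fastforce
    have "Re l \<le> C * hnorm H k" using bd that p complex_Re_le_cmod order_trans by blast
    moreover have "0 \<le> (hnorm H k - C)\<^sup>2" by simp
    ultimately show ?thesis by (simp add: J_def p power2_diff algebra_simps)
  qed
  have bdd: "bdd_below (J ` G)" using Jlow by (intro bdd_belowI) auto
  have mle: "m \<le> J p" if "p \<in> G" for p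
    unfolding m_def using bdd that by (simp add: cINF_lower)
  have "\<exists>p\<in>G. J p < m + 1 / real (Suc n)" for n
  proof (rule ccontr)
    assume "\<not> ?thesis"
    then have "m + 1 / real (Suc n) \<le> m"
      unfolding m_def using G0 by (intro cINF_greatest) (auto simp: not_less m_def)
    then show False by simp
  qed
  then obtain q where q: "\<And>n. q n \<in> G" "\<And>n. J (q n) < m + 1 / real (Suc n)" by metis
  define k l where "k = (\<lambda>n. fst (q n))" and "l = (\<lambda>n. snd (q n))"
  have kl: "(k n, l n) \<in> G" for n using q(1) by (simp add: k_def l_def)
  have kc: "k n \<in> carr H" for n using kl Gc by blast
  have Jkl: "(hnorm H (k n))\<^sup>2 - 2 * Re (l n) < m + 1 / real (Suc n)" for n
    using q(2)[of n] by (simp add: J_def k_def l_def split: prod.splits)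
  have cauchy: "(hnorm H (k i - k j))\<^sup>2 \<le> 2 / real (Suc i) + 2 / real (Suc j)" for i j
  proof -
    have "(scl H (1/2) (k i + k j), 1/2 * (l i + l j)) \<in> G" by (intro Gscl Gadd kl)
    moreover have "hnorm H (scl H (1/2) (k i + k j)) = hnorm H (k i + k j) / 2"
      using hnorm_scl[of "k i + k j" "1/2"] kc by (simp del: vs.scale_right_distrib)
    then have "(hnorm H (scl H (1/2) (k i + k j)))\<^sup>2 = (hnorm H (k i + k j))\<^sup>2 / 4"
      by (simp only: power_divide) simp
    ultimately have "m \<le> (hnorm H (k i + k j))\<^sup>2 / 4 - Re (l i) - Re (l j)"
      using mle[of "(scl H (1/2) (k i + k j), 1/2 * (l i + l j))"]
      by (simp add: J_def power_divide add_divide_distrib del: vs.scale_right_distrib)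
    then show ?thesis using Jkl[of i] Jkl[of j] parallelogram[OF kc kc, of i j] by simp
  qed
  have "\<exists>g\<in>carr H. (\<lambda>n. hnorm H (k n - g)) \<longlonglongrightarrow> 0"
  proof (rule complete[OF kc])
    fix e :: real assume e: "e > 0"
    obtain N where N: "4 / e\<^sup>2 < real N" using reals_Archimedean2 by blast
    have "hnorm H (k i - k j) < e" if "i \<ge> N" "j \<ge> N" for i j
    proof -
      have N0: "0 < real N" using N e by (smt (verit) divide_nonneg_nonneg zero_le_power2)
      have "1 / real (Suc i) \<le> 1 / real N" "1 / real (Suc j) \<le> 1 / real N"
        using that N0 by (auto intro!: divide_left_mono)
      then have "(hnorm H (k i - k j))\<^sup>2 \<le> 4 / real N" using cauchy[of i j] by simp
      also have "\<dots> < e\<^sup>2" using N N0 e by (simp add: field_simps)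
      finally show ?thesis by (rule power2_less_imp_less) (use e in simp)
    qed
    then show "\<exists>N. \<forall>m\<ge>N. \<forall>n\<ge>N. hnorm H (k m - k n) < e" by blast
  qed
  then obtain g where g: "g \<in> carr H" and lim: "(\<lambda>n. hnorm H (k n - g)) \<longlonglongrightarrow> 0" by blast
  have Re_eq: "Re (ip H x g) = Re y" if xy: "(x, y) \<in> G" for x y
  proof -
    have x: "x \<in> carr H" using Gc xy by blast
    define d where "d = Re (ip H x g) - Re y"
    \<comment> \<open>Moving the minimising sequence by \<open>t x\<close> cannot decrease the limit of \<open>J\<close>; this is the first variation.\<close>
    have nonneg: "0 \<le> 2 * t * d + t\<^sup>2 * (hnorm H x)\<^sup>2" for t :: real
    proof -
      have le: "- (1 / real (Suc n)) \<le> 2 * t * (Re (ip H (k n) x) - Re y) + t\<^sup>2 * (hnorm H x)\<^sup>2" for n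
      proof -
        have "(k n + scl H (of_real t) x, l n + of_real t * y) \<in> G" by (intro Gadd Gscl kl xy)
        from mle[OF this] show ?thesis
          using Jkl[of n] kc x
          by (simp add: J_def hnorm_add_sq power_mult_distrib algebra_simps)
      qed
      have "(\<lambda>n. - (1 / real (Suc n))) \<longlonglongrightarrow> - 0"
        by (intro tendsto_minus LIMSEQ_Suc lim_1_over_n)
      moreover have "(\<lambda>n. 2 * t * (Re (ip H (k n) x) - Re y) + t\<^sup>2 * (hnorm H x)\<^sup>2) \<longlonglongrightarrow>
          2 * t * (Re (ip H g x) - Re y) + t\<^sup>2 * (hnorm H x)\<^sup>2"
        by (intro tendsto_intros ip_tendsto lim kc g x)
      ultimately have "- 0 \<le> 2 * t * (Re (ip H g x) - Re y) + t\<^sup>2 * (hnorm H x)\<^sup>2"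
        by (rule LIMSEQ_le) (use le in blast)
      then show ?thesis using ip_cnj[OF g x] by (simp add: d_def)
    qed
    show ?thesis
    proof (cases "hnorm H x = 0")
      case True
      then show ?thesis using nonneg[of 1] nonneg[of "-1"] by (simp add: d_def)
    next
      case False
      define n where "n = (hnorm H x)\<^sup>2"
      have "n > 0" using False x by (simp add: n_def)
      then have "0 \<le> - (d\<^sup>2 / n)" using nonneg[of "- d / n"] unfolding n_def[symmetric]
        by (simp add: power2_eq_square field_simps)
      then have "d = 0" using \<open>n > 0\<close> by (simp add: field_simps)
      then show ?thesis by (simp add: d_def)
    qed
  qed
  have eq: "ip H x g = y" if xy: "(x, y) \<in> G" for x y
  proof (rule complex_eqI)
    show "Re (ip H x g) = Re y" by (rule Re_eq[OF xy])
    show "Im (ip H x g) = Im y" using Re_eq[OF Gscl[OF xy, of "\<i>"]] g Gc[OF xy] by simp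
  qed
  have "(hnorm H g)\<^sup>2 \<le> C * hnorm H g"
  proof -
    have "(\<lambda>n. cmod (ip H (k n) g)) \<longlonglongrightarrow> cmod (ip H g g)"
      by (intro tendsto_intros ip_tendsto lim kc g)
    moreover have "(\<lambda>n. C * hnorm H (k n)) \<longlonglongrightarrow> C * hnorm H g"
      by (intro tendsto_intros hnorm_tendsto lim kc g)
    ultimately have "cmod (ip H g g) \<le> C * hnorm H g"
      by (rule LIMSEQ_le) (use bd[OF kl] eq[OF kl] in simp)
    then show ?thesis using g by (simp add: ip_self norm_power)
  qed
  then have "hnorm H g \<le> C \<or> hnorm H g = 0"
    using g by (metis hnorm_ge0 mult_right_le_imp_le order_le_less power2_eq_square)
  moreover have "k n \<in> fst ` G" for n using kl by force
  ultimately show thesis using that g eq lim by blast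
qed

end

section \<open>Vectors and adjoint matrices\<close>

definition adjm :: "complex^'n^'m \<Rightarrow> complex^'m^'n" where
  "adjm A = (\<chi> i j. cnj (A $ j $ i))"

lemma cdot_0 [simp]: "cdot 0 v = 0" "cdot u 0 = 0"
  by (simp_all add: cdot_def)

lemma cdot_scale_left: "cdot (c *s u) v = c * cdot u v"
  and cdot_add_right: "cdot u (v + v') = cdot u v + cdot u v'"
  and cdot_scale_right: "cdot u (c *s v) = cnj c * cdot u v"
  and cdot_cnj: "cnj (cdot u v) = cdot v u"
  by (simp_all add: cdot_def algebra_simps sum.distrib sum_distrib_left)

lemma cdot_axis: "cdot u (axis i 1) = u $ i"
proof -
  have "cdot u (axis i 1) = (\<Sum>j\<in>UNIV. if j = i then u $ i else 0)"
    unfolding cdot_def by (rule sum.cong) (auto simp: axis_def)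
  then show ?thesis by simp
qed

lemma cdot_eqI: "(\<And>v. cdot u v = cdot u' v) \<Longrightarrow> u = u'"
  by (metis cdot_axis vec_eq_iff)

text \<open>This identity makes \<open>adjm\<close> the Hilbert space adjoint for the pairing used in the reproducing property.\<close>

lemma cdot_adjm: "cdot (A *v u) v = cdot u (adjm A *v v)"
proof -
  have "cdot (A *v u) v = (\<Sum>i\<in>UNIV. \<Sum>j\<in>UNIV. A $ i $ j * u $ j * cnj (v $ i))"
    by (simp add: cdot_def matrix_vector_mult_def sum_distrib_right)
  also have "\<dots> = (\<Sum>j\<in>UNIV. \<Sum>i\<in>UNIV. A $ i $ j * u $ j * cnj (v $ i))"
    by (rule sum.swap)
  also have "\<dots> = cdot u (adjm A *v v)"
    by (simp add: cdot_def matrix_vector_mult_def adjm_def sum_distrib_left mult_ac)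
  finally show ?thesis .
qed

lemma adjm_mult: "adjm (A ** B) = adjm B ** adjm A"
  by (simp add: adjm_def matrix_matrix_mult_def vec_eq_iff mult.commute)

lemma adjm_mat [simp]: "adjm (mat c) = mat (cnj c)"
  by (simp add: adjm_def mat_def vec_eq_iff)

lemma mat_mult_vec: "mat c *v u = c *s (u :: complex^'n)"
proof -
  have "(mat c *v u) $ i = c * u $ i" for i
  proof -
    have "(mat c *v u) $ i = (\<Sum>j\<in>UNIV. (if i = j then c else 0) * u $ j)"
      by (simp add: matrix_vector_mult_def mat_def)
    also have "\<dots> = (\<Sum>j\<in>UNIV. if j = i then c * u $ i else 0)"
      by (rule sum.cong) auto
    finally show ?thesis by simp
  qed
  then show ?thesis by (simp add: vec_eq_iff)
qed

lemma bidisc_open: "open bidisc"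
  unfolding bidisc_def by (intro open_Times) auto

lemma in_bidisc: "z \<in> bidisc \<longleftrightarrow> cmod (fst z) < 1 \<and> cmod (snd z) < 1"
  by (cases z) (simp add: bidisc_def)

section \<open>Reproducing kernel Hilbert spaces\<close>

locale rkhs =
  fixes K :: "complex \<times> complex \<Rightarrow> complex \<times> complex \<Rightarrow> complex^'n^'n"
    and H :: "(complex \<times> complex \<Rightarrow> complex^'n) hspace"
  assumes hol: "holomorphic_rkhs K H"

sublocale rkhs \<subseteq> hilbert H
  using hol by (unfold_locales) (simp add: holomorphic_rkhs_def)

context rkhs
begin

text \<open>The kernel functions, extended by zero as all elements of the space are.\<close>

definition kfun :: "complex \<times> complex \<Rightarrow> complex^'n \<Rightarrow> complex \<times> complex \<Rightarrow> complex^'n" where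
  "kfun w v = (\<lambda>z. if z \<in> bidisc then K z w *v v else 0)"

lemma scl_eq: "scl H c f = (\<lambda>z. c *s f z)"
  using hol by (simp add: holomorphic_rkhs_def)

lemma off_bidisc: "f \<in> carr H \<Longrightarrow> z \<notin> bidisc \<Longrightarrow> f z = 0"
  using hol unfolding holomorphic_rkhs_def by blast

lemma carr_holomorphic: "f \<in> carr H \<Longrightarrow> holomorphic2_on (\<lambda>z. f z $ i) bidisc"
  using hol by (simp add: holomorphic_rkhs_def)

lemma kfun_carr [simp]: "w \<in> bidisc \<Longrightarrow> kfun w v \<in> carr H"
  using hol unfolding kfun_def by (simp add: holomorphic_rkhs_def Let_def)

lemma ip_kfun: "f \<in> carr H \<Longrightarrow> w \<in> bidisc \<Longrightarrow> ip H f (kfun w v) = cdot (f w) v"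
  using hol unfolding kfun_def by (simp add: holomorphic_rkhs_def Let_def)

lemma kfun_ip: "f \<in> carr H \<Longrightarrow> w \<in> bidisc \<Longrightarrow> ip H (kfun w v) f = cdot v (f w)"
  using ip_cnj[of f "kfun w v"] by (simp add: ip_kfun cdot_cnj)

lemma kfun_kfun: "w \<in> bidisc \<Longrightarrow> w' \<in> bidisc \<Longrightarrow> ip H (kfun w v) (kfun w' v') = cdot (K w' w *v v) v'"
  by (simp add: ip_kfun) (simp add: kfun_def)

lemma kfun_diff: "kfun w (v - v') = kfun w v - kfun w v'"
  by (auto simp: kfun_def matrix_vector_mult_diff_distrib)

lemma kfun_scl: "kfun w (c *s v) = scl H c (kfun w v)"
  by (auto simp: kfun_def scl_eq vec_eq_iff matrix_vector_mult_def sum_distrib_left mult_ac)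

lemma carr_eqI:
  assumes "f \<in> carr H" "g \<in> carr H" "\<And>w. w \<in> bidisc \<Longrightarrow> f w = g w"
  shows "f = g"
proof
  show "f z = g z" for z
    by (cases "z \<in> bidisc") (simp_all add: assms off_bidisc)
qed

text \<open>Combinations are indexed by lists rather than by their value, because bounds on operators given on kernel
functions are statements about the coefficients.\<close>

definition comb :: "((complex \<times> complex) \<times> (complex^'n)) list \<Rightarrow> complex \<times> complex \<Rightarrow> complex^'n" where
  "comb xs = (\<Sum>(w, v)\<leftarrow>xs. kfun w v)"

lemma comb_simps [simp]: "comb [] = 0" "comb (p # xs) = kfun (fst p) (snd p) + comb xs"
  by (simp_all add: comb_def split_def)

lemma comb_append: "comb (xs @ ys) = comb xs + comb ys"
  by (simp add: comb_def)

lemma comb_carr: "fst ` set xs \<subseteq> bidisc \<Longrightarrow> comb xs \<in> carr H"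
  by (induction xs) auto

lemma comb_scl: "comb (map (\<lambda>(w, v). (w, c *s v)) xs) = scl H c (comb xs)"
proof
  fix z
  have "comb (map (\<lambda>(w, v). (w, c *s v)) xs) z = c *s comb xs z"
    by (induction xs) (simp_all add: split_def kfun_scl scl_eq vector_add_ldistrib)
  then show "comb (map (\<lambda>(w, v). (w, c *s v)) xs) z = scl H c (comb xs) z" by (simp add: scl_eq)
qed

lemma ip_comb_comb:
  assumes "fst ` set xs \<subseteq> bidisc" "fst ` set ys \<subseteq> bidisc"
  shows "ip H (comb xs) (comb ys) =
    (\<Sum>(w, v)\<leftarrow>xs. \<Sum>(w', v')\<leftarrow>ys. cdot (K w' w *v v) v')"
proof -
  have *: "ip H (kfun w v) (comb ys) = (\<Sum>(w', v')\<leftarrow>ys. cdot (K w' w *v v) v')" if "w \<in> bidisc" for w v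
    using assms(2) by (induction ys) (use that in \<open>auto simp: kfun_kfun comb_carr\<close>)
  show ?thesis using assms(1)
    by (induction xs) (use assms(2) * in \<open>auto simp: comb_carr\<close>)
qed

text \<open>A functional on lists of coefficients that is bounded by the norm of the combination is well defined on the
combinations and hence represented by an element of the space. Density of kernel functions and the existence of
adjoints are both instances.\<close>

lemma comb_riesz:
  fixes ell :: "((complex \<times> complex) \<times> (complex^'n)) list \<Rightarrow> complex"
  assumes D: "D \<subseteq> bidisc"
    and app: "\<And>xs ys. fst ` set xs \<subseteq> D \<Longrightarrow> fst ` set ys \<subseteq> D \<Longrightarrow> ell (xs @ ys) = ell xs + ell ys"
    and scale: "\<And>c xs. fst ` set xs \<subseteq> D \<Longrightarrow> ell (map (\<lambda>(w, v). (w, c *s v)) xs) = c * ell xs"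
    and bd: "\<And>xs. fst ` set xs \<subseteq> D \<Longrightarrow> cmod (ell xs) \<le> C * hnorm H (comb xs)"
  obtains g xs where "g \<in> carr H" "\<And>xs. fst ` set xs \<subseteq> D \<Longrightarrow> ip H (comb xs) g = ell xs"
    "hnorm H g \<le> C \<or> hnorm H g = 0"
    "\<And>n::nat. fst ` set (xs n) \<subseteq> D" "(\<lambda>n. hnorm H (comb (xs n) - g)) \<longlonglongrightarrow> 0"
proof -
  define G where "G = {(comb xs, ell xs) |xs. fst ` set xs \<subseteq> D}"
  have GI: "fst ` set xs \<subseteq> D \<Longrightarrow> (comb xs, ell xs) \<in> G" for xs by (auto simp: G_def)
  have GE: "\<exists>xs. fst ` set xs \<subseteq> D \<and> k = comb xs \<and> l = ell xs" if "(k, l) \<in> G" for k l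
    using that by (auto simp: G_def)
  obtain g s where g: "g \<in> carr H" "\<And>k l. (k, l) \<in> G \<Longrightarrow> ip H k g = l" "hnorm H g \<le> C \<or> hnorm H g = 0"
    and s: "\<And>n::nat. s n \<in> fst ` G" "(\<lambda>n. hnorm H (s n - g)) \<longlonglongrightarrow> 0"
  proof (rule riesz[of G C])
    show "k \<in> carr H" if "(k, l) \<in> G" for k l using GE[OF that] D comb_carr by blast
    show "(0, 0) \<in> G" using GI[of "[]"] app[of "[]" "[]"] by simp
    show "(k + k', l + l') \<in> G" if mem: "(k, l) \<in> G" "(k', l') \<in> G" for k l k' l'
    proof -
      obtain xs ys where "fst ` set xs \<subseteq> D" "fst ` set ys \<subseteq> D"
        and kl: "k = comb xs" "k' = comb ys" "l = ell xs" "l' = ell ys"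
        using GE[OF mem(1)] GE[OF mem(2)] by blast
      then show ?thesis using GI[of "xs @ ys"] app[of xs ys] by (simp add: comb_append image_Un)
    qed
    show "(scl H c k, c * l) \<in> G" if mem: "(k, l) \<in> G" for c k l
    proof -
      obtain xs where "fst ` set xs \<subseteq> D" and kl: "k = comb xs" "l = ell xs" using GE[OF mem] by blast
      then show ?thesis using GI[of "map (\<lambda>(w, v). (w, c *s v)) xs"] scale[of xs c]
        by (simp add: image_image split_def comb_scl[unfolded split_def])
    qed
    show "cmod l \<le> C * hnorm H k" if "(k, l) \<in> G" for k l using GE[OF that] bd by blast
  qed (use that in blast)
  have "\<exists>xs. fst ` set xs \<subseteq> D \<and> s n = comb xs" for n
    using s(1)[of n] by (auto simp: G_def) blast
  then obtain xs where "\<And>n. fst ` set (xs n) \<subseteq> D \<and> s n = comb (xs n)" by metis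
  then show thesis using that[of g xs] g GI s(2) by simp
qed

text \<open>The functional \<open>k \<mapsto> \<langle>k, f\<rangle>\<close> on combinations with points in \<open>D\<close> is represented by a limit \<open>g\<close> of such
combinations; \<open>g\<close> and \<open>f\<close> agree on \<open>D\<close>, so \<open>D\<close> being a set of uniqueness gives \<open>g = f\<close>.\<close>

lemma comb_dense:
  assumes D: "D \<subseteq> bidisc" and uniq: "\<And>f. f \<in> carr H \<Longrightarrow> (\<And>w. w \<in> D \<Longrightarrow> f w = 0) \<Longrightarrow> f = 0"
    and f: "f \<in> carr H"
  obtains xs where "\<And>n. fst ` set (xs n) \<subseteq> D" "(\<lambda>n. hnorm H (comb (xs n) - f)) \<longlonglongrightarrow> 0"
proof -
  have cc: "comb xs \<in> carr H" if "fst ` set xs \<subseteq> D" for xs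
    by (rule comb_carr) (use that D in blast)
  obtain g xs where g: "g \<in> carr H" "\<And>xs. fst ` set xs \<subseteq> D \<Longrightarrow> ip H (comb xs) g = ip H (comb xs) f"
    and xs: "\<And>n::nat. fst ` set (xs n) \<subseteq> D" "(\<lambda>n. hnorm H (comb (xs n) - g)) \<longlonglongrightarrow> 0"
  proof (rule comb_riesz[of D "\<lambda>xs. ip H (comb xs) f" "hnorm H f"])
    show "cmod (ip H (comb xs) f) \<le> hnorm H f * hnorm H (comb xs)" if "fst ` set xs \<subseteq> D" for xs
      using Cauchy_Schwarz_ip[OF cc[OF that] f] by (simp add: mult.commute)
  qed (use D cc f comb_append comb_scl that in auto)
  have "g w = f w" if "w \<in> D" for w
  proof (rule cdot_eqI)
    fix v
    have "ip H (kfun w v) g = ip H (kfun w v) f" using g(2)[of "[(w, v)]"] that by simp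
    then have "cdot v (g w) = cdot v (f w)" using that D g f by (auto simp: kfun_ip)
    then show "cdot (g w) v = cdot (f w) v" by (metis cdot_cnj)
  qed
  then have "g - f = 0" using uniq[of "g - f"] g f by simp
  then have "g = f" by simp
  then show thesis using that[of xs] xs by simp
qed

lemma comb_dense_bidisc:
  assumes f: "f \<in> carr H"
  obtains xs where "\<And>n. fst ` set (xs n) \<subseteq> bidisc" "(\<lambda>n. hnorm H (comb (xs n) - f)) \<longlonglongrightarrow> 0"
proof (rule comb_dense[of bidisc f])
  show "g = 0" if "g \<in> carr H" "\<And>w. w \<in> bidisc \<Longrightarrow> g w = 0" for g
    using carr_eqI[of g 0] that by simp
qed (use f that in auto)

lemma tendsto_at:
  assumes "\<And>n. s n \<in> carr H" "x \<in> carr H" "(\<lambda>n. hnorm H (s n - x)) \<longlonglongrightarrow> 0" "w \<in> bidisc"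
  shows "(\<lambda>n. s n w $ i) \<longlonglongrightarrow> x w $ i"
  using ip_tendsto[of s x "kfun w (axis i 1)"] assms by (simp add: ip_kfun cdot_axis)

lemma closed_subspace_full:
  assumes V: "V \<subseteq> carr H" and V0: "0 \<in> V" and Vk: "\<And>w v. w \<in> bidisc \<Longrightarrow> kfun w v \<in> V"
    and Vadd: "\<And>x y. x \<in> V \<Longrightarrow> y \<in> V \<Longrightarrow> x + y \<in> V"
    and Vlim: "\<And>s x. (\<And>n::nat. s n \<in> V) \<Longrightarrow> x \<in> carr H \<Longrightarrow>
      (\<lambda>n. hnorm H (s n - x)) \<longlonglongrightarrow> 0 \<Longrightarrow> x \<in> V"
  shows "V = carr H"
proof -
  have comb: "comb xs \<in> V" if "fst ` set xs \<subseteq> bidisc" for xs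
    using that by (induction xs) (auto intro: V0 Vadd Vk)
  have "f \<in> V" if f: "f \<in> carr H" for f
  proof -
    obtain xs where "\<And>n. fst ` set (xs n) \<subseteq> bidisc" "(\<lambda>n. hnorm H (comb (xs n) - f)) \<longlonglongrightarrow> 0"
      using comb_dense_bidisc[OF f] by blast
    then show ?thesis using Vlim[of "\<lambda>n. comb (xs n)" f] comb f by blast
  qed
  then show ?thesis using V by blast
qed

subsection \<open>Weighted composition operators\<close>

definition wcomp :: "(complex \<times> complex \<Rightarrow> complex^'n^'n) \<Rightarrow> (complex \<times> complex \<Rightarrow> complex \<times> complex)
    \<Rightarrow> (complex \<times> complex \<Rightarrow> complex^'n) \<Rightarrow> complex \<times> complex \<Rightarrow> complex^'n" where
  "wcomp J \<gamma> f = (\<lambda>z. if z \<in> bidisc then J z *v f (\<gamma> z) else 0)"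

text \<open>The adjoint of \<open>wcomp J \<gamma>\<close> sends the kernel function at \<open>w\<close> with vector \<open>v\<close> to the one at \<open>\<gamma> w\<close> with vector
\<open>J(w)\<^sup>* v\<close>; here that map is applied to coefficients.\<close>

definition wcomp_adj :: "(complex \<times> complex \<Rightarrow> complex^'n^'n) \<Rightarrow> (complex \<times> complex \<Rightarrow> complex \<times> complex)
    \<Rightarrow> ((complex \<times> complex) \<times> (complex^'n)) list \<Rightarrow> ((complex \<times> complex) \<times> (complex^'n)) list" where
  "wcomp_adj J \<gamma> = map (\<lambda>(w, v). (\<gamma> w, adjm (J w) *v v))"

text \<open>A bound for the adjoint on finite combinations suffices: for \<open>f\<close> in the space,
\<open>k \<mapsto> \<langle>(wcomp J \<gamma>)\<^sup>* k, f\<rangle>\<close> is then a bounded functional, and the element representing it is \<open>wcomp J \<gamma> f\<close>.\<close>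

lemma wcomp_bounded:
  assumes \<gamma>: "\<And>w. w \<in> bidisc \<Longrightarrow> \<gamma> w \<in> bidisc" and C: "C \<ge> 0"
    and bd: "\<And>xs. fst ` set xs \<subseteq> bidisc \<Longrightarrow> hnorm H (comb (wcomp_adj J \<gamma> xs)) \<le> C * hnorm H (comb xs)"
    and f: "f \<in> carr H"
  shows "wcomp J \<gamma> f \<in> carr H" "hnorm H (wcomp J \<gamma> f) \<le> C * hnorm H f"
proof -
  have ac: "comb (wcomp_adj J \<gamma> xs) \<in> carr H" if "fst ` set xs \<subseteq> bidisc" for xs
    by (rule comb_carr) (use \<gamma> that in \<open>auto simp: wcomp_adj_def\<close>)
  have ad: "wcomp_adj J \<gamma> (xs @ ys) = wcomp_adj J \<gamma> xs @ wcomp_adj J \<gamma> ys" for xs ys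
    by (simp add: wcomp_adj_def)
  have as: "wcomp_adj J \<gamma> (map (\<lambda>(w, v). (w, c *s v)) xs) = map (\<lambda>(w, v). (w, c *s v)) (wcomp_adj J \<gamma> xs)" for c xs
    by (auto simp: wcomp_adj_def vec_eq_iff matrix_vector_mult_def sum_distrib_left mult_ac)
  obtain g where g: "g \<in> carr H"
      "\<And>xs. fst ` set xs \<subseteq> bidisc \<Longrightarrow> ip H (comb xs) g = ip H (comb (wcomp_adj J \<gamma> xs)) f"
    and gn: "hnorm H g \<le> C * hnorm H f \<or> hnorm H g = 0"
  proof (rule comb_riesz[of bidisc "\<lambda>xs. ip H (comb (wcomp_adj J \<gamma> xs)) f" "C * hnorm H f"])
    show "cmod (ip H (comb (wcomp_adj J \<gamma> xs)) f) \<le> C * hnorm H f * hnorm H (comb xs)"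
      if xs: "fst ` set xs \<subseteq> bidisc" for xs
    proof -
      have "cmod (ip H (comb (wcomp_adj J \<gamma> xs)) f) \<le> hnorm H (comb (wcomp_adj J \<gamma> xs)) * hnorm H f"
        by (rule Cauchy_Schwarz_ip[OF ac[OF xs] f])
      also have "\<dots> \<le> (C * hnorm H (comb xs)) * hnorm H f"
        using bd[OF xs] f by (intro mult_right_mono) auto
      finally show ?thesis by (simp add: mult_ac)
    qed
  qed (use ac f that in \<open>auto simp: ad as comb_append comb_scl\<close>)
  have "wcomp J \<gamma> f w = g w" for w
  proof (cases "w \<in> bidisc")
    case True
    show ?thesis
    proof (rule cdot_eqI)
      fix v
      have "ip H (comb [(w, v)]) g = ip H (comb (wcomp_adj J \<gamma> [(w, v)])) f"
        using True by (intro g(2)) simp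
      then have "cdot v (g w) = cdot (adjm (J w) *v v) (f (\<gamma> w))"
        using True g(1) f \<gamma> by (simp add: kfun_ip wcomp_adj_def)
      then have "cdot (g w) v = cdot (f (\<gamma> w)) (adjm (J w) *v v)" by (metis cdot_cnj)
      then show "cdot (wcomp J \<gamma> f w) v = cdot (g w) v" using True by (simp add: wcomp_def cdot_adjm)
    qed
  next
    case False
    then show ?thesis using g(1) off_bidisc by (simp add: wcomp_def)
  qed
  then have eq: "wcomp J \<gamma> f = g" by blast
  show "wcomp J \<gamma> f \<in> carr H" using eq g by simp
  show "hnorm H (wcomp J \<gamma> f) \<le> C * hnorm H f" using eq gn C f by auto
qed

text \<open>The covariance identity says that the adjoint preserves inner products of kernel functions.\<close>

lemma wcomp_contraction:
  assumes \<gamma>: "\<And>w. w \<in> bidisc \<Longrightarrow> \<gamma> w \<in> bidisc"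
    and cov: "\<And>z w. z \<in> bidisc \<Longrightarrow> w \<in> bidisc \<Longrightarrow> J z ** K (\<gamma> z) (\<gamma> w) ** adjm (J w) = K z w"
    and f: "f \<in> carr H"
  shows "wcomp J \<gamma> f \<in> carr H" "hnorm H (wcomp J \<gamma> f) \<le> hnorm H f"
proof -
  have eq: "hnorm H (comb (wcomp_adj J \<gamma> xs)) = hnorm H (comb xs)" if xs: "fst ` set xs \<subseteq> bidisc" for xs
  proof -
    have ac: "fst ` set (wcomp_adj J \<gamma> xs) \<subseteq> bidisc"
      using \<gamma> xs by (auto simp: wcomp_adj_def)
    have *: "cdot (K (\<gamma> w') (\<gamma> w) *v (adjm (J w) *v v)) (adjm (J w') *v v') = cdot (K w' w *v v) v'"
      if "w \<in> bidisc" "w' \<in> bidisc" for w w' v v'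
      using that cov[of w' w, symmetric]
      by (simp add: cdot_adjm[symmetric] matrix_vector_mul_assoc matrix_mul_assoc)
    have "ip H (comb (wcomp_adj J \<gamma> xs)) (comb (wcomp_adj J \<gamma> xs)) = ip H (comb xs) (comb xs)"
      unfolding ip_comb_comb[OF ac ac] ip_comb_comb[OF xs xs]
      by (simp add: wcomp_adj_def o_def split_def)
        (intro arg_cong[of _ _ sum_list] map_cong refl *; use xs in blast)
    then show ?thesis by (simp add: hnorm_def)
  qed
  then have eq': "hnorm H (comb (wcomp_adj J \<gamma> xs)) \<le> 1 * hnorm H (comb xs)"
    if "fst ` set xs \<subseteq> bidisc" for xs using that by simp
  show "wcomp J \<gamma> f \<in> carr H" using wcomp_bounded(1)[OF \<gamma> _ eq' f] by simp
  show "hnorm H (wcomp J \<gamma> f) \<le> hnorm H f" using wcomp_bounded(2)[OF \<gamma> _ eq' f] by simp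
qed

text \<open>The inverse transformation satisfies a covariance identity of the same form, so both it and \<open>wcomp J \<gamma>\<close> are
contractions, and two mutually inverse contractions are isometries. Polarisation turns preservation of the norm into
preservation of the inner product.\<close>

lemma wcomp_unitary:
  assumes \<gamma>: "\<And>w. w \<in> bidisc \<Longrightarrow> \<gamma> w \<in> bidisc" and \<delta>: "\<And>w. w \<in> bidisc \<Longrightarrow> \<delta> w \<in> bidisc"
    and \<gamma>\<delta>: "\<And>w. w \<in> bidisc \<Longrightarrow> \<gamma> (\<delta> w) = w" and \<delta>\<gamma>: "\<And>w. w \<in> bidisc \<Longrightarrow> \<delta> (\<gamma> w) = w"
    and cov: "\<And>z w. z \<in> bidisc \<Longrightarrow> w \<in> bidisc \<Longrightarrow> J z ** K (\<gamma> z) (\<gamma> w) ** adjm (J w) = K z w"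
    and inv: "\<And>z. z \<in> bidisc \<Longrightarrow> invertible (J z)"
  shows "unitary_operator H (wcomp J \<gamma>)"
proof -
  have "\<forall>z. \<exists>B. z \<in> bidisc \<longrightarrow> J z ** B = mat 1 \<and> B ** J z = mat 1"
    using inv unfolding invertible_def by blast
  then obtain J' where J': "\<And>z. z \<in> bidisc \<Longrightarrow> J z ** J' z = mat 1"
      "\<And>z. z \<in> bidisc \<Longrightarrow> J' z ** J z = mat 1" by metis
  define I where "I = (\<lambda>z. J' (\<delta> z))"
  have cov': "I z ** K (\<delta> z) (\<delta> w) ** adjm (I w) = K z w" if "z \<in> bidisc" "w \<in> bidisc" for z w
  proof -
    have "I z ** K (\<delta> z) (\<delta> w) ** adjm (I w) =
        I z ** (J (\<delta> z) ** K z w ** adjm (J (\<delta> w))) ** adjm (I w)"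
      using that cov[of "\<delta> z" "\<delta> w"] \<delta> \<gamma>\<delta> by simp
    also have "\<dots> = (I z ** J (\<delta> z)) ** K z w ** adjm (I w ** J (\<delta> w))"
      by (simp add: adjm_mult matrix_mul_assoc)
    also have "\<dots> = K z w"
      unfolding I_def using J'(2)[OF \<delta>[OF that(1)]] J'(2)[OF \<delta>[OF that(2)]] by simp
    finally show ?thesis .
  qed
  have W: "wcomp J \<gamma> x \<in> carr H" "hnorm H (wcomp J \<gamma> x) \<le> hnorm H x" if "x \<in> carr H" for x
    using wcomp_contraction[of \<gamma> J x] \<gamma> cov that by blast+
  have W': "wcomp I \<delta> x \<in> carr H" "hnorm H (wcomp I \<delta> x) \<le> hnorm H x" if "x \<in> carr H" for x
    using wcomp_contraction[of \<delta> I x] \<delta> cov' that by blast+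
  have inv1: "wcomp I \<delta> (wcomp J \<gamma> f) = f" if f: "f \<in> carr H" for f
  proof (rule carr_eqI)
    show "wcomp I \<delta> (wcomp J \<gamma> f) \<in> carr H" using W'(1) W(1) f by blast
    show "f \<in> carr H" by fact
    show "wcomp I \<delta> (wcomp J \<gamma> f) w = f w" if "w \<in> bidisc" for w
      using that \<delta> \<gamma>\<delta> J'(2) by (simp add: wcomp_def I_def matrix_vector_mul_assoc)
  qed
  have inv2: "wcomp J \<gamma> (wcomp I \<delta> f) = f" if f: "f \<in> carr H" for f
  proof (rule carr_eqI)
    show "wcomp J \<gamma> (wcomp I \<delta> f) \<in> carr H" using W'(1) W(1) f by blast
    show "f \<in> carr H" by fact
    show "wcomp J \<gamma> (wcomp I \<delta> f) w = f w" if "w \<in> bidisc" for w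
      using that \<gamma> \<delta>\<gamma> J'(1) by (simp add: wcomp_def I_def matrix_vector_mul_assoc)
  qed
  have lin_add: "wcomp J \<gamma> (x + y) = wcomp J \<gamma> x + wcomp J \<gamma> y" for x y
    by (auto simp: wcomp_def matrix_vector_right_distrib)
  have lin_scl: "wcomp J \<gamma> (scl H c x) = scl H c (wcomp J \<gamma> x)" for c x
    by (auto simp: wcomp_def scl_eq vec_eq_iff matrix_vector_mult_def sum_distrib_left mult_ac)
  have iso: "hnorm H (wcomp J \<gamma> x) = hnorm H x" if "x \<in> carr H" for x
    using W(2)[OF that] W'(2)[OF W(1)[OF that]] inv1[OF that] by simp
  have re: "Re (ip H (wcomp J \<gamma> x) (wcomp J \<gamma> y)) = Re (ip H x y)" if x: "x \<in> carr H" and y: "y \<in> carr H" for x y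
    using hnorm_add_sq[OF x y] hnorm_add_sq[OF W(1)[OF x] W(1)[OF y]]
      iso[OF x] iso[OF y] iso[OF carr_add[OF x y]] by (simp add: lin_add)
  have "ip H (wcomp J \<gamma> x) (wcomp J \<gamma> y) = ip H x y" if x: "x \<in> carr H" and y: "y \<in> carr H" for x y
    using re[OF x y] re[OF carr_scl[OF x, of "\<i>"] y] x y W(1)
    by (simp add: lin_scl complex_eq_iff)
  then show ?thesis
    unfolding unitary_operator_def linear_in_def
    using lin_add lin_scl W(1) W'(1) inv1 inv2
    by (auto intro!: bij_betwI[of _ _ _ "wcomp I \<delta>"])
qed

subsection \<open>Multiplication operators\<close>

lemma mult_op_alt: "f \<in> carr H \<Longrightarrow> mult_op h f = wcomp (\<lambda>z. mat (h z)) (\<lambda>z. z) f"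
  by (auto simp: mult_op_def wcomp_def mat_mult_vec off_bidisc)

text \<open>Multiplication by \<open>h\<close> is bounded if \<open>(4 B\<^sup>2 - h(z) \<bar>h(w)) K(z, w)\<close> is positive semidefinite. When
\<open>K\<close> is a sum of rank one kernels \<open>\<phi>\<^sub>\<kappa>(z) \<phi>\<^sub>\<kappa>(w)\<^sup>*\<close>, this follows from a bounded action of \<open>h\<close> on the index set:
each \<open>h \<phi>\<^sub>\<kappa>\<close> is a combination of two features, and no feature is used twice in either role. The
sums are limits over finite boxes, which may grow by a fixed amount \<open>m\<close> under the action.\<close>

lemma feature_bound:
  fixes \<phi> :: "'k \<Rightarrow> complex \<times> complex \<Rightarrow> complex^'n" and box :: "nat \<Rightarrow> 'k set"
  assumes fin: "\<And>N. finite (box N)"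
    and lim: "\<And>z w i j. z \<in> bidisc \<Longrightarrow> w \<in> bidisc \<Longrightarrow>
      (\<lambda>N. \<Sum>\<kappa>\<in>box N. \<phi> \<kappa> z $ i * cnj (\<phi> \<kappa> w $ j)) \<longlonglongrightarrow> K z w $ i $ j"
    and shift: "\<And>N \<kappa> z. \<kappa> \<in> box N \<Longrightarrow> z \<in> bidisc \<Longrightarrow> h z *s \<phi> \<kappa> z = x \<kappa> *s \<phi> (p \<kappa>) z + y \<kappa> *s \<phi> (q \<kappa>) z"
    and B: "B \<ge> 0" and x: "\<And>N \<kappa>. \<kappa> \<in> box N \<Longrightarrow> cmod (x \<kappa>) \<le> B"
    and y: "\<And>N \<kappa>. \<kappa> \<in> box N \<Longrightarrow> cmod (y \<kappa>) \<le> B"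
    and p: "\<And>N. inj_on p (box N)" "\<And>N. p ` box N \<subseteq> box (N + m)"
    and q: "\<And>N. inj_on q (box N)" "\<And>N. q ` box N \<subseteq> box (N + m)"
    and f: "f \<in> carr H"
  shows "mult_op h f \<in> carr H \<and> hnorm H (mult_op h f) \<le> 2 * B * hnorm H f"
proof -
  define ell where "ell = (\<lambda>\<kappa> xs. \<Sum>(w, v)\<leftarrow>xs. cdot v (\<phi> \<kappa> w))"
  have trm: "(\<lambda>N. \<Sum>\<kappa>\<in>box N. cdot v (\<phi> \<kappa> w) * cnj (cdot v' (\<phi> \<kappa> w'))) \<longlonglongrightarrow> cdot (K w' w *v v) v'"
    if "w \<in> bidisc" "w' \<in> bidisc" for w w' v v'
  proof -
    have "(\<lambda>N. \<Sum>i\<in>UNIV. \<Sum>j\<in>UNIV. (\<Sum>\<kappa>\<in>box N. \<phi> \<kappa> w' $ i * cnj (\<phi> \<kappa> w $ j)) * (v $ j * cnj (v' $ i)))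
      \<longlonglongrightarrow> (\<Sum>i\<in>UNIV. \<Sum>j\<in>UNIV. K w' w $ i $ j * (v $ j * cnj (v' $ i)))"
      by (intro tendsto_intros lim that)
    moreover have "(\<Sum>i\<in>UNIV. \<Sum>j\<in>UNIV. K w' w $ i $ j * (v $ j * cnj (v' $ i))) = cdot (K w' w *v v) v'"
      by (simp add: cdot_def matrix_vector_mult_def sum_distrib_right sum_distrib_left mult_ac)
    moreover have "(\<Sum>i\<in>UNIV. \<Sum>j\<in>UNIV. (\<Sum>\<kappa>\<in>box N. \<phi> \<kappa> w' $ i * cnj (\<phi> \<kappa> w $ j)) * (v $ j * cnj (v' $ i)))
       = (\<Sum>\<kappa>\<in>box N. cdot v (\<phi> \<kappa> w) * cnj (cdot v' (\<phi> \<kappa> w')))" (is "?L = ?R") for N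
    proof -
      have "?L = (\<Sum>i\<in>UNIV. \<Sum>j\<in>UNIV. \<Sum>\<kappa>\<in>box N. (v $ j * cnj (\<phi> \<kappa> w $ j)) * (cnj (v' $ i) * \<phi> \<kappa> w' $ i))"
        by (simp add: sum_distrib_left sum_distrib_right mult_ac)
      also have "\<dots> = (\<Sum>i\<in>UNIV. \<Sum>\<kappa>\<in>box N. \<Sum>j\<in>UNIV. (v $ j * cnj (\<phi> \<kappa> w $ j)) * (cnj (v' $ i) * \<phi> \<kappa> w' $ i))"
        by (intro sum.cong refl sum.swap)
      also have "\<dots> = (\<Sum>\<kappa>\<in>box N. \<Sum>i\<in>UNIV. \<Sum>j\<in>UNIV. (v $ j * cnj (\<phi> \<kappa> w $ j)) * (cnj (v' $ i) * \<phi> \<kappa> w' $ i))"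
        by (rule sum.swap)
      also have "\<dots> = ?R"
        by (simp add: cdot_def sum_product mult_ac) (intro sum.cong refl sum.swap)
      finally show ?thesis .
    qed
    ultimately show ?thesis by simp
  qed
  have form: "(\<lambda>N. \<Sum>\<kappa>\<in>box N. ell \<kappa> xs * cnj (ell \<kappa> ys)) \<longlonglongrightarrow> ip H (comb xs) (comb ys)"
    if xs: "fst ` set xs \<subseteq> bidisc" and ys: "fst ` set ys \<subseteq> bidisc" for xs ys
  proof -
    have 1: "(\<lambda>N. \<Sum>\<kappa>\<in>box N. cdot v (\<phi> \<kappa> w) * cnj (ell \<kappa> ys)) \<longlonglongrightarrow> ip H (kfun w v) (comb ys)"
      if w: "w \<in> bidisc" for w v
      using ys
    proof (induction ys)
      case (Cons a ys)
      have "(\<lambda>N. (\<Sum>\<kappa>\<in>box N. cdot v (\<phi> \<kappa> w) * cnj (cdot (snd a) (\<phi> \<kappa> (fst a)))) +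
        (\<Sum>\<kappa>\<in>box N. cdot v (\<phi> \<kappa> w) * cnj (ell \<kappa> ys))) \<longlonglongrightarrow>
        ip H (kfun w v) (kfun (fst a) (snd a)) + ip H (kfun w v) (comb ys)"
        using Cons w by (intro tendsto_add) (auto simp: kfun_kfun intro!: trm)
      then show "(\<lambda>N. \<Sum>\<kappa>\<in>box N. cdot v (\<phi> \<kappa> w) * cnj (ell \<kappa> (a # ys))) \<longlonglongrightarrow>
          ip H (kfun w v) (comb (a # ys))" using Cons w
        by (simp add: ell_def split_def comb_carr ring_distribs sum.distrib)
    qed (use w in \<open>auto simp: ell_def\<close>)
    show ?thesis using xs
    proof (induction xs)
      case (Cons a xs)
      have "(\<lambda>N. (\<Sum>\<kappa>\<in>box N. cdot (snd a) (\<phi> \<kappa> (fst a)) * cnj (ell \<kappa> ys)) +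
        (\<Sum>\<kappa>\<in>box N. ell \<kappa> xs * cnj (ell \<kappa> ys))) \<longlonglongrightarrow>
        ip H (kfun (fst a) (snd a)) (comb ys) + ip H (comb xs) (comb ys)"
        using Cons by (intro tendsto_add 1) auto
      then show "(\<lambda>N. \<Sum>\<kappa>\<in>box N. ell \<kappa> (a # xs) * cnj (ell \<kappa> ys)) \<longlonglongrightarrow>
          ip H (comb (a # xs)) (comb ys)" using Cons ys
        by (simp add: ell_def split_def comb_carr ring_distribs sum.distrib)
    qed (use ys in \<open>auto simp: ell_def comb_carr\<close>)
  qed
  have sq: "(\<lambda>N. \<Sum>\<kappa>\<in>box N. (cmod (ell \<kappa> xs))\<^sup>2) \<longlonglongrightarrow> (hnorm H (comb xs))\<^sup>2"
    if xs: "fst ` set xs \<subseteq> bidisc" for xs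
  proof -
    have "(\<lambda>N. Re (\<Sum>\<kappa>\<in>box N. ell \<kappa> xs * cnj (ell \<kappa> xs))) \<longlonglongrightarrow> Re (ip H (comb xs) (comb xs))"
      by (intro tendsto_intros form xs)
    then show ?thesis using comb_carr[OF xs]
      by (simp add: hnorm_sq complex_norm_square[symmetric] flip: of_real_power)
  qed
  have bd: "hnorm H (comb (wcomp_adj (\<lambda>z. mat (h z)) (\<lambda>z. z) xs)) \<le> 2 * B * hnorm H (comb xs)"
    if xs: "fst ` set xs \<subseteq> bidisc" for xs
  proof -
    let ?ys = "wcomp_adj (\<lambda>z. mat (h z)) (\<lambda>z. z) xs"
    have ys: "fst ` set ?ys \<subseteq> bidisc" using xs by (auto simp: wcomp_adj_def)
    have ell: "ell \<kappa> ?ys = cnj (x \<kappa>) * ell (p \<kappa>) xs + cnj (y \<kappa>) * ell (q \<kappa>) xs"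
      if \<kappa>: "\<kappa> \<in> box N" for \<kappa> N
      using xs
    proof (induction xs)
      case (Cons a xs)
      have "cdot (mat (cnj (h (fst a))) *v snd a) (\<phi> \<kappa> (fst a)) = cdot (snd a) (h (fst a) *s \<phi> \<kappa> (fst a))"
        by (simp add: mat_mult_vec cdot_scale_left cdot_scale_right)
      also have "\<dots> = cnj (x \<kappa>) * cdot (snd a) (\<phi> (p \<kappa>) (fst a))
          + cnj (y \<kappa>) * cdot (snd a) (\<phi> (q \<kappa>) (fst a))"
        using Cons.prems by (subst shift[OF \<kappa>]) (auto simp: cdot_add_right cdot_scale_right)
      finally show ?case using Cons
        by (simp add: ell_def wcomp_adj_def split_def algebra_simps)
    qed (simp add: ell_def wcomp_adj_def)
    have ineq: "(cmod (ell \<kappa> ?ys))\<^sup>2 \<le> 2 * B\<^sup>2 * ((cmod (ell (p \<kappa>) xs))\<^sup>2 + (cmod (ell (q \<kappa>) xs))\<^sup>2)"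
      if \<kappa>: "\<kappa> \<in> box N" for \<kappa> N
    proof -
      have "cmod (ell \<kappa> ?ys) \<le> B * cmod (ell (p \<kappa>) xs) + B * cmod (ell (q \<kappa>) xs)"
        unfolding ell[OF \<kappa>]
        by (rule order_trans[OF norm_triangle_ineq])
          (auto simp: norm_mult intro!: add_mono mult_right_mono x[OF \<kappa>] y[OF \<kappa>])
      then have "(cmod (ell \<kappa> ?ys))\<^sup>2 \<le> (B * cmod (ell (p \<kappa>) xs) + B * cmod (ell (q \<kappa>) xs))\<^sup>2"
        by (intro power_mono) auto
      also have "\<dots> = B\<^sup>2 * (cmod (ell (p \<kappa>) xs) + cmod (ell (q \<kappa>) xs))\<^sup>2"
        by (simp add: power2_eq_square algebra_simps)
      also have "\<dots> \<le> B\<^sup>2 * (2 * ((cmod (ell (p \<kappa>) xs))\<^sup>2 + (cmod (ell (q \<kappa>) xs))\<^sup>2))"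
      proof (rule mult_left_mono)
        show "(cmod (ell (p \<kappa>) xs) + cmod (ell (q \<kappa>) xs))\<^sup>2 \<le> 2 * ((cmod (ell (p \<kappa>) xs))\<^sup>2 + (cmod (ell (q \<kappa>) xs))\<^sup>2)"
          using zero_le_power2[of "cmod (ell (p \<kappa>) xs) - cmod (ell (q \<kappa>) xs)"]
          by (simp add: power2_eq_square algebra_simps)
      qed auto
      finally show ?thesis by (simp add: algebra_simps)
    qed
    have shiftsum: "(\<Sum>\<kappa>\<in>box N. (cmod (ell (r \<kappa>) xs))\<^sup>2) \<le> (\<Sum>\<kappa>\<in>box (N + m). (cmod (ell \<kappa> xs))\<^sup>2)"
      if "inj_on r (box N)" "r ` box N \<subseteq> box (N + m)" for r N
    proof -
      have "(\<Sum>\<kappa>\<in>box N. (cmod (ell (r \<kappa>) xs))\<^sup>2) = (\<Sum>\<kappa>\<in>r ` box N. (cmod (ell \<kappa> xs))\<^sup>2)"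
        using that(1) by (subst sum.reindex) auto
      also have "\<dots> \<le> (\<Sum>\<kappa>\<in>box (N + m). (cmod (ell \<kappa> xs))\<^sup>2)"
        using that(2) fin by (intro sum_mono2) auto
      finally show ?thesis .
    qed
    have "(\<Sum>\<kappa>\<in>box N. (cmod (ell \<kappa> ?ys))\<^sup>2) \<le> 4 * B\<^sup>2 * (\<Sum>\<kappa>\<in>box (N + m). (cmod (ell \<kappa> xs))\<^sup>2)" for N
    proof -
      have "(\<Sum>\<kappa>\<in>box N. (cmod (ell \<kappa> ?ys))\<^sup>2) \<le>
        (\<Sum>\<kappa>\<in>box N. 2 * B\<^sup>2 * ((cmod (ell (p \<kappa>) xs))\<^sup>2 + (cmod (ell (q \<kappa>) xs))\<^sup>2))"
        by (intro sum_mono ineq)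
      also have "\<dots> = 2 * B\<^sup>2 * ((\<Sum>\<kappa>\<in>box N. (cmod (ell (p \<kappa>) xs))\<^sup>2) + (\<Sum>\<kappa>\<in>box N. (cmod (ell (q \<kappa>) xs))\<^sup>2))"
        by (simp add: sum_distrib_left[symmetric] sum.distrib)
      also have "\<dots> \<le> 2 * B\<^sup>2 * ((\<Sum>\<kappa>\<in>box (N + m). (cmod (ell \<kappa> xs))\<^sup>2) + (\<Sum>\<kappa>\<in>box (N + m). (cmod (ell \<kappa> xs))\<^sup>2))"
        by (intro mult_left_mono add_mono shiftsum p q) auto
      finally show ?thesis by simp
    qed
    moreover have "(\<lambda>N. 4 * B\<^sup>2 * (\<Sum>\<kappa>\<in>box (N + m). (cmod (ell \<kappa> xs))\<^sup>2)) \<longlonglongrightarrow> 4 * B\<^sup>2 * (hnorm H (comb xs))\<^sup>2"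
      by (intro tendsto_intros LIMSEQ_ignore_initial_segment sq xs)
    ultimately have "(hnorm H (comb ?ys))\<^sup>2 \<le> 4 * B\<^sup>2 * (hnorm H (comb xs))\<^sup>2"
      using LIMSEQ_le[OF sq[OF ys]] by blast
    then have "(hnorm H (comb ?ys))\<^sup>2 \<le> (2 * B * hnorm H (comb xs))\<^sup>2"
      by (simp add: power_mult_distrib)
    then show ?thesis by (rule power2_le_imp_le) (use B comb_carr[OF xs] in simp)
  qed
  show ?thesis
    using wcomp_bounded[of "\<lambda>z. z" "2 * B" "\<lambda>z. mat (h z)", OF _ _ bd f] B by (auto simp: mult_op_alt f)
qed

end

lemma mult_op_mult: "mult_op g (mult_op h f) = mult_op (\<lambda>z. g z * h z) f"
  by (simp add: mult_op_def)

lemma mult_op_funpow: "(mult_op p ^^ m) f = mult_op (\<lambda>z. p z ^ m) f"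
  by (induction m) (simp_all add: mult_op_def)

lemma sum_tail_le:
  fixes a :: "nat \<Rightarrow> real"
  assumes "summable a" "\<And>n. 0 \<le> a n" "finite S" "S \<subseteq> {N..}"
  shows "sum a S \<le> suminf a - sum a {..<N}"
proof -
  have "sum a S + sum a {..<N} = sum a (S \<union> {..<N})"
    using assms(3,4) by (subst sum.union_disjoint) auto
  also have "\<dots> \<le> suminf a" using assms by (intro sum_le_suminf) auto
  finally show ?thesis by simp
qed

text \<open>By Bernoulli's inequality a geometric weight dominates a linear one. So absolute convergence on a disc of radius
above one suffices when \<open>\<parallel>T\<^sup>n\<parallel>\<close> grows at most linearly.\<close>

lemma summable_linear_weight:
  fixes c :: "nat \<Rightarrow> complex"
  assumes r: "r > 1" and s: "summable (\<lambda>n. cmod (c n) * r ^ n)"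
  shows "summable (\<lambda>n. cmod (c n) * (real n + 1))"
proof (rule summable_comparison_test')
  \<comment> \<open>Chosen such that \<open>k (n + 1) \<le> 1 + n (r - 1) \<le> r\<^sup>n\<close>.\<close>
  define k where "k = min 1 (r - 1)"
  have k: "k > 0" "k \<le> 1" "k \<le> r - 1" using r by (auto simp: k_def)
  show "summable (\<lambda>n. cmod (c n) * r ^ n / k)" using s by (rule summable_divide)
  fix n :: nat
  have "k * (real n + 1) \<le> real n * (r - 1) + 1"
    using mult_right_mono[OF k(3), of "real n"] k(2) by (simp add: algebra_simps)
  also have "\<dots> \<le> r ^ n" using Bernoulli_inequality[of "r - 1" n] r by (simp add: algebra_simps)
  finally have "real n + 1 \<le> r ^ n / k" using k(1) by (simp add: field_simps)
  then have "cmod (c n) * (real n + 1) \<le> cmod (c n) * (r ^ n / k)" by (intro mult_left_mono) auto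
  then show "norm (cmod (c n) * (real n + 1)) \<le> cmod (c n) * r ^ n / k" by simp
qed

section \<open>Moebius transformations\<close>

definition mob :: "complex \<Rightarrow> complex \<Rightarrow> complex \<Rightarrow> complex" where
  "mob c a z = c * (z - a) / (1 - cnj a * z)"

definition bimob :: "bool \<Rightarrow> complex \<Rightarrow> complex \<Rightarrow> complex \<Rightarrow> complex
    \<Rightarrow> complex \<times> complex \<Rightarrow> complex \<times> complex" where
  "bimob s c1 a1 c2 a2 z =
     (if s then (mob c1 a1 (snd z), mob c2 a2 (fst z)) else (mob c1 a1 (fst z), mob c2 a2 (snd z)))"

lemma one_minus_nz: "cmod a < 1 \<Longrightarrow> cmod z < 1 \<Longrightarrow> 1 - a * z \<noteq> 0"
proof
  assume a: "cmod a < 1" "cmod z < 1" and "1 - a * z = 0"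
  then have "cmod a * cmod z = 1" by (simp flip: norm_mult)
  moreover have "cmod a * cmod z \<le> 1 * cmod z" using a by (intro mult_right_mono) auto
  ultimately show False using a by simp
qed

lemma mob_norm_less:
  assumes c: "cmod c = 1" and a: "cmod a < 1" and z: "cmod z < 1"
  shows "cmod (mob c a z) < 1"
proof -
  have "(cmod (z - a))\<^sup>2 + (1 - (cmod a)\<^sup>2) * (1 - (cmod z)\<^sup>2) = (cmod (1 - cnj a * z))\<^sup>2"
    unfolding cmod_power2 by (simp add: power2_eq_square algebra_simps)
  moreover have "(1 - (cmod a)\<^sup>2) * (1 - (cmod z)\<^sup>2) > 0"
    using a z by (intro mult_pos_pos) (auto simp: abs_square_less_1)
  ultimately have "(cmod (z - a))\<^sup>2 < (cmod (1 - cnj a * z))\<^sup>2" by linarith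
  then have "cmod (z - a) < cmod (1 - cnj a * z)" by (rule power2_less_imp_less) auto
  then show ?thesis using c by (simp add: mob_def norm_divide norm_mult divide_less_eq)
qed

text \<open>The inverse of a disc automorphism is again of the form \<open>mob\<close>, with parameters that are needed explicitly when the
covariance of a kernel is applied to an inverse automorphism.\<close>

lemma mob_inverse:
  assumes c: "cmod c = 1" and a: "cmod a < 1" and z: "cmod z < 1"
  shows "mob (cnj c) (- c * a) (mob c a z) = z"
proof -
  have nz: "1 - cnj a * z \<noteq> 0" using one_minus_nz[of "cnj a" z] a z by simp
  have cc: "cnj c * c = 1" using c by (simp add: complex_norm_square[symmetric] mult.commute)
  have na: "1 - a * cnj a \<noteq> 0" using one_minus_nz[of a "cnj a"] a by simp
  define m where "m = mob c a z"
  have m: "m * (1 - cnj a * z) = c * (z - a)" using nz by (simp add: m_def mob_def)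
  have num: "(m + c * a) * (1 - cnj a * z) = c * (z * (1 - a * cnj a))"
  proof -
    have "(m + c * a) * (1 - cnj a * z) = m * (1 - cnj a * z) + c * a * (1 - cnj a * z)"
      by (rule distrib_right)
    also have "\<dots> = c * (z - a) + c * a * (1 - cnj a * z)" by (simp only: m)
    also have "\<dots> = c * (z * (1 - a * cnj a))" by (simp add: algebra_simps)
    finally show ?thesis .
  qed
  have "(1 + cnj c * cnj a * m) * (1 - cnj a * z) = (1 - cnj a * z) + (cnj c * c) * (cnj a * (z - a))"
  proof -
    have "(1 + cnj c * cnj a * m) * (1 - cnj a * z)
        = (1 - cnj a * z) + cnj c * cnj a * (m * (1 - cnj a * z))" by (simp add: algebra_simps)
    also have "\<dots> = (1 - cnj a * z) + cnj c * cnj a * (c * (z - a))" by (simp only: m)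
    finally show ?thesis by (simp add: mult_ac)
  qed
  then have den: "(1 + cnj c * cnj a * m) * (1 - cnj a * z) = 1 - a * cnj a"
    unfolding cc by (simp add: algebra_simps)
  then have dn: "1 + cnj c * cnj a * m \<noteq> 0" using na by auto
  have "cnj c * (m + c * a) * (1 - cnj a * z) = z * ((1 + cnj c * cnj a * m) * (1 - cnj a * z))"
    unfolding den using num cc by (simp add: mult.assoc)
  then have "cnj c * (m + c * a) = z * (1 + cnj c * cnj a * m)"
    using nz by (simp add: mult.assoc[symmetric])
  then show ?thesis using dn unfolding m_def[symmetric] by (simp add: mob_def)
qed

lemma bimob_in:
  assumes "cmod c1 = 1" "cmod a1 < 1" "cmod c2 = 1" "cmod a2 < 1" "z \<in> bidisc"
  shows "bimob s c1 a1 c2 a2 z \<in> bidisc"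
  using assms by (auto simp: bimob_def in_bidisc mob_norm_less)

lemma bimob_inverse:
  assumes c1: "cmod c1 = 1" and a1: "cmod a1 < 1" and c2: "cmod c2 = 1" and a2: "cmod a2 < 1"
  obtains d1 b1 d2 b2 where "cmod d1 = 1" "cmod b1 < 1" "cmod d2 = 1" "cmod b2 < 1"
    "\<And>z. z \<in> bidisc \<Longrightarrow> bimob s c1 a1 c2 a2 (bimob s d1 b1 d2 b2 z) = z"
    "\<And>z. z \<in> bidisc \<Longrightarrow> bimob s d1 b1 d2 b2 (bimob s c1 a1 c2 a2 z) = z"
proof -
  have inv': "mob c a (mob (cnj c) (- c * a) z) = z" if "cmod c = 1" "cmod a < 1" "cmod z < 1" for c a z
  proof -
    have "c * cnj c = 1" using that(1) by (simp add: complex_norm_square[symmetric])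
    moreover have "- cnj c * (- c * a) = (c * cnj c) * a" by (simp add: mult_ac)
    ultimately have eq: "- cnj c * (- c * a) = a" by (simp only: mult_1_left)
    show ?thesis using mob_inverse[of "cnj c" "- c * a" z, unfolded eq] that
      by (simp add: norm_mult)
  qed
  show thesis
  proof (cases s)
    case True
    show ?thesis
      by (rule that[of "cnj c2" "- c2 * a2" "cnj c1" "- c1 * a1"])
        (use True assms in \<open>auto simp: bimob_def norm_mult in_bidisc mob_inverse[simplified] inv'[simplified]\<close>)
  next
    case False
    show ?thesis
      by (rule that[of "cnj c1" "- c1 * a1" "cnj c2" "- c2 * a2"])
        (use False assms in \<open>auto simp: bimob_def norm_mult in_bidisc mob_inverse[simplified] inv'[simplified]\<close>)
  qed
qed

text \<open>The pole \<open>1 / \<bar>a\<close> lies outside the closed disc, so the geometric series converges on a larger disc.\<close>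

lemma mob_power_series:
  assumes a: "cmod a < 1"
  obtains b r where "r > 1" "summable (\<lambda>n. cmod (b n) * r ^ n)"
    "\<And>z. cmod z < 1 \<Longrightarrow> (\<lambda>n. b n * z ^ n) sums mob c a z"
proof -
  define b where "b = (\<lambda>n. c * (if n = 0 then - a else cnj a ^ (n - 1) * (1 - a * cnj a)))"
  obtain r where r: "r > 1" "cmod a * r < 1"
  proof (cases "a = 0")
    case True
    then show ?thesis using that[of 2] by simp
  next
    case False
    then have "1 < 1 / cmod a" using a by (simp add: field_simps)
    then obtain r where "1 < r" "r < 1 / cmod a" using dense by blast
    then show ?thesis using that[of r] False by (simp add: field_simps)
  qed
  have "summable (\<lambda>n. cmod (b (Suc n)) * r ^ Suc n)"
  proof -
    have "(\<lambda>n. cmod (b (Suc n)) * r ^ Suc n) = (\<lambda>n. (cmod c * cmod (1 - a * cnj a) * r) * (cmod a * r) ^ n)"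
      by (simp add: b_def norm_mult norm_power power_mult_distrib mult_ac)
    moreover have "summable (\<lambda>n. (cmod a * r) ^ n)"
      using r by (intro summable_geometric) auto
    ultimately show ?thesis by (simp add: summable_mult)
  qed
  then have s: "summable (\<lambda>n. cmod (b n) * r ^ n)" by (rule summable_Suc_iff[THEN iffD1])
  have "(\<lambda>n. b n * z ^ n) sums mob c a z" if z: "cmod z < 1" for z
  proof -
    have lt: "cmod (cnj a * z) < 1"
      using a z by (metis complex_mod_cnj mult_le_cancel_right1 norm_ge_zero norm_mult not_le
          order_le_less_trans mult.commute mult_left_le less_eq_real_def)
    have nz: "1 - cnj a * z \<noteq> 0" using one_minus_nz[of "cnj a" z] a z by simp
    have "(\<lambda>n. (c * (1 - a * cnj a) * z) * (cnj a * z) ^ n) sums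
        ((c * (1 - a * cnj a) * z) * (1 / (1 - cnj a * z)))"
      by (intro sums_mult geometric_sums lt)
    moreover have "(\<lambda>n. (c * (1 - a * cnj a) * z) * (cnj a * z) ^ n) = (\<lambda>n. b (Suc n) * z ^ Suc n)"
      by (simp add: b_def power_mult_distrib mult_ac)
    ultimately have "(\<lambda>n. b (Suc n) * z ^ Suc n) sums ((c * (1 - a * cnj a) * z) * (1 / (1 - cnj a * z)))"
      by (simp only:)
    from sums_Suc[OF this]
    have "(\<lambda>n. b n * z ^ n) sums ((c * (1 - a * cnj a) * z) * (1 / (1 - cnj a * z)) + b 0 * z ^ 0)" .
    moreover have "(c * (1 - a * cnj a) * z) * (1 / (1 - cnj a * z)) + b 0 * z ^ 0 = mob c a z"
      using nz by (simp add: b_def mob_def field_simps)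
    ultimately show ?thesis by simp
  qed
  then show thesis using that r(1) s by blast
qed

section \<open>Functional calculus and joint spectrum\<close>

lemma (in rkhs) mult_op_linear:
  "mult_op h (x + y) = mult_op h x + mult_op h y" "mult_op h (scl H c x) = scl H c (mult_op h x)"
  by (auto simp: mult_op_def scl_eq vector_add_ldistrib vector_smult_assoc mult.commute)

lemma (in rkhs) sum_apply: "sum f I z = (\<Sum>i\<in>I. f i z)"
  for f :: "'i \<Rightarrow> complex \<times> complex \<Rightarrow> complex^'n"
  by (induction I rule: infinite_finite_induct) auto

text \<open>If one member of a commuting pair is invertible, then \<open>u = R x\<close> solves the middle equation of the Koszul complex
and \<open>R h\<close> the last one, in either order of the pair.\<close>

lemma (in hilbert) koszul_exact_invertible:
  assumes R: "\<And>x. x \<in> carr H \<Longrightarrow> R x \<in> carr H" "\<And>x. x \<in> carr H \<Longrightarrow> s (R x) = x"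
      "\<And>x. x \<in> carr H \<Longrightarrow> R (s x) = x" "\<And>x. t (R x) = R (t x)"
    and t: "\<And>x. x \<in> carr H \<Longrightarrow> t x \<in> carr H"
    and z: "s 0 = 0" "t 0 = 0" "R 0 = 0" "\<And>x. s (0 - x) = 0 - s x"
  shows "koszul_exact H (s, t) \<and> koszul_exact H (t, s)"
proof
  have inj: "u = 0" if "u \<in> carr H" "s u = 0" for u using R(3)[OF that(1)] that(2) z(3) by simp
  show "koszul_exact H (s, t)" unfolding koszul_exact_def fst_conv snd_conv
  proof (intro conjI ballI impI)
    show "\<exists>u\<in>carr H. x = s u \<and> y = t u" if "x \<in> carr H" "y \<in> carr H" "s y - t x = 0" for x y
      using that R(2)[of x] R(3)[of y] R(4)[of x] R(1)[of x] by (intro bexI[of _ "R x"]) auto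
    show "\<exists>x\<in>carr H. \<exists>y\<in>carr H. s y - t x = h" if "h \<in> carr H" for h
      using R(1,2)[OF that] z by (intro bexI[of _ 0] bexI[of _ "R h"]) auto
  qed (use inj in blast)
  show "koszul_exact H (t, s)" unfolding koszul_exact_def fst_conv snd_conv
  proof (intro conjI ballI impI)
    show "\<exists>u\<in>carr H. x = t u \<and> y = s u" if "x \<in> carr H" "y \<in> carr H" "t y - s x = 0" for x y
      using that R(2)[of y] R(3)[of x] R(4)[of y] R(1)[of y] by (intro bexI[of _ "R y"]) auto
    show "\<exists>x\<in>carr H. \<exists>y\<in>carr H. t y - s x = h" if "h \<in> carr H" for h
      using R(1,2)[OF that] z carr_diff[OF carr_0 R(1)[OF that]]
      by (intro bexI[of _ "0 - R h"] bexI[of _ 0]) (auto simp del: diff_0)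
  qed (use inj in blast)
qed

text \<open>Linear growth of the powers of the coordinate multiplications is the only quantitative input to the functional
calculus and to the joint spectrum.\<close>

locale rkhs_growth = rkhs K H
  for K :: "complex \<times> complex \<Rightarrow> complex \<times> complex \<Rightarrow> complex^'n^'n"
    and H :: "(complex \<times> complex \<Rightarrow> complex^'n) hspace" +
  fixes C :: real
  assumes C_nonneg: "C \<ge> 0"
    and growth: "p \<in> {fst, snd} \<Longrightarrow> f \<in> carr H \<Longrightarrow> mult_op (\<lambda>z. p z ^ m) f \<in> carr H"
    "p \<in> {fst, snd} \<Longrightarrow> f \<in> carr H \<Longrightarrow>
      hnorm H (mult_op (\<lambda>z. p z ^ m) f) \<le> C * (real m + 1) * hnorm H f"
begin

lemma mult_coord: "p \<in> {fst, snd} \<Longrightarrow> f \<in> carr H \<Longrightarrow> mult_op p f \<in> carr H"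
  using growth(1)[of p f 1] by simp

text \<open>The partial sums of \<open>\<Sum> c\<^sub>n T\<^sup>n f\<close> are Cauchy in norm because of the growth bound, and evaluation at points
identifies the limit as the product \<open>h f\<close>. The error estimate is stated for every finite index set containing an
initial segment, which is the form in which unordered summation over pairs of exponents uses it.\<close>

lemma power_series_calculus:
  assumes p: "p \<in> {fst, snd}" and sm: "summable (\<lambda>n. cmod (c n) * (real n + 1))"
    and h: "\<And>z. z \<in> bidisc \<Longrightarrow> (\<lambda>n. c n * p z ^ n) sums h z" and f: "f \<in> carr H"
  shows "mult_op h f \<in> carr H"
    and "finite G \<Longrightarrow> {..<N} \<subseteq> G \<Longrightarrow>
      hnorm H (mult_op h f - (\<Sum>n\<in>G. scl H (c n) (mult_op (\<lambda>z. p z ^ n) f)))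
        \<le> C * (suminf (\<lambda>n. cmod (c n) * (real n + 1)) - (\<Sum>n<N. cmod (c n) * (real n + 1))) * hnorm H f"
proof -
  define u where "u = (\<lambda>n. scl H (c n) (mult_op (\<lambda>z. p z ^ n) f))"
  define a where "a = (\<lambda>n. cmod (c n) * (real n + 1))"
  define t where "t = (\<lambda>N. C * (suminf a - sum a {..<N}) * hnorm H f)"
  have a0: "0 \<le> a n" for n by (simp add: a_def)
  have uc: "u n \<in> carr H" for n
    unfolding u_def by (intro carr_scl growth(1) p f)
  have un: "hnorm H (u n) \<le> C * hnorm H f * a n" for n
    using mult_left_mono[OF growth(2)[OF p f, of n], of "cmod (c n)"] growth(1)[OF p f, of n]
    by (simp add: u_def a_def mult_ac)
  have sc: "sum u G \<in> carr H" for G by (rule carr_sum) (rule uc)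
  have tail: "hnorm H (sum u G - sum u G') \<le> t N"
    if fin: "finite G" "finite G'" and sub: "{..<N} \<subseteq> G" "{..<N} \<subseteq> G'" for G G' N
  proof -
    have "sum u G - sum u G' = sum u (G - G') - sum u (G' - G)"
    proof -
      have "sum u G = sum u (G \<inter> G') + sum u (G - G')" by (rule sum.Int_Diff) (rule fin)
      moreover have "sum u G' = sum u (G \<inter> G') + sum u (G' - G)"
        using sum.Int_Diff[OF fin(2), of u G] by (simp only: Int_commute)
      ultimately have "sum u G - sum u G'
        = (sum u (G \<inter> G') + sum u (G - G')) - (sum u (G \<inter> G') + sum u (G' - G))" by (simp only:)
      also have "\<dots> = sum u (G - G') - sum u (G' - G)" by (rule add_diff_cancel_left)
      finally show ?thesis .
    qed
    then have "hnorm H (sum u G - sum u G') \<le> hnorm H (sum u (G - G')) + hnorm H (sum u (G' - G))"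
      using hnorm_triangle_diff[of "sum u (G - G')" 0 "sum u (G' - G)"] sc
        hnorm_minus_commute[of 0 "sum u (G' - G)"] by simp
    also have "\<dots> \<le> (\<Sum>n\<in>G - G'. hnorm H (u n)) + (\<Sum>n\<in>G' - G. hnorm H (u n))"
      by (intro add_mono hnorm_sum_le uc)
    also have "\<dots> \<le> (\<Sum>n\<in>G - G'. C * hnorm H f * a n) + (\<Sum>n\<in>G' - G. C * hnorm H f * a n)"
      by (intro add_mono sum_mono un)
    also have "\<dots> = C * hnorm H f * sum a ((G - G') \<union> (G' - G))"
      using fin by (subst sum.union_disjoint) (auto simp: sum_distrib_left distrib_left)
    also have "\<dots> \<le> C * hnorm H f * (suminf a - sum a {..<N})"
    proof (intro mult_left_mono sum_tail_le)
      show "summable a" using sm by (simp add: a_def)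
      show "(G - G') \<union> (G' - G) \<subseteq> {N..}" using sub by auto (meson lessThan_iff not_le subsetD)+
      show "0 \<le> C * hnorm H f" using C_nonneg f by simp
    qed (use a0 fin in auto)
    finally show ?thesis by (simp add: t_def mult_ac)
  qed
  have t0: "t \<longlonglongrightarrow> 0"
  proof -
    have "(\<lambda>N. C * (suminf a - sum a {..<N}) * hnorm H f) \<longlonglongrightarrow> C * (suminf a - suminf a) * hnorm H f"
      using sm by (intro tendsto_intros summable_LIMSEQ) (simp add: a_def)
    then show ?thesis by (simp add: t_def)
  qed
  define s where "s = (\<lambda>N. sum u {..<N::nat})"
  have "\<exists>x\<in>carr H. (\<lambda>n. hnorm H (s n - x)) \<longlonglongrightarrow> 0"
  proof (rule complete)
    fix e :: real assume "e > 0"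
    then obtain N where N: "t N < e"
      using order_tendstoD(2)[OF t0] eventually_happens by (metis trivial_limit_sequentially)
    have "hnorm H (s m - s n) < e" if "m \<ge> N" "n \<ge> N" for m n
      using tail[of "{..<m}" "{..<n}" N] that N by (simp add: s_def)
    then show "\<exists>N. \<forall>m\<ge>N. \<forall>n\<ge>N. hnorm H (s m - s n) < e" by blast
  qed (simp add: s_def sc)
  then obtain x where x: "x \<in> carr H" and lim: "(\<lambda>n. hnorm H (s n - x)) \<longlonglongrightarrow> 0" by blast
  have "x z = mult_op h f z" for z
  proof (cases "z \<in> bidisc")
    case True
    have "x z $ i = mult_op h f z $ i" for i
    proof (rule LIMSEQ_unique)
      show "(\<lambda>n. s n z $ i) \<longlonglongrightarrow> x z $ i"
        using tendsto_at[OF _ x lim True] by (simp add: s_def sc)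
      have "s n z $ i = (\<Sum>k<n. c k * p z ^ k) * f z $ i" for n
        by (simp add: s_def sum_apply u_def scl_eq mult_op_def sum_distrib_right sum_distrib_left mult_ac)
      moreover have "(\<lambda>n. (\<Sum>k<n. c k * p z ^ k) * f z $ i) \<longlonglongrightarrow> h z * f z $ i"
        using h[OF True] unfolding sums_def by (intro tendsto_intros)
      ultimately show "(\<lambda>n. s n z $ i) \<longlonglongrightarrow> mult_op h f z $ i" by (simp add: mult_op_def)
    qed
    then show ?thesis by (simp add: vec_eq_iff)
  next
    case False
    then show ?thesis using off_bidisc[OF x False] off_bidisc[OF f False] by (simp add: mult_op_def)
  qed
  then have eq: "mult_op h f = x" by auto
  show mc: "mult_op h f \<in> carr H" using eq x by simp
  show "hnorm H (mult_op h f - (\<Sum>n\<in>G. scl H (c n) (mult_op (\<lambda>z. p z ^ n) f)))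
        \<le> C * (suminf (\<lambda>n. cmod (c n) * (real n + 1)) - (\<Sum>n<N. cmod (c n) * (real n + 1))) * hnorm H f"
    if G: "finite G" "{..<N} \<subseteq> G"
  proof -
    have "hnorm H (x - sum u G) \<le> hnorm H (s n - x) + t N" if "n \<ge> N" for n
    proof -
      have sn: "s n \<in> carr H" by (simp add: s_def sc)
      have "hnorm H (s n - sum u G) \<le> t N"
        unfolding s_def using that G by (intro tail) auto
      then show ?thesis
        using hnorm_triangle_diff[OF x sn sc, of G] hnorm_minus_commute[OF x sn] by linarith
    qed
    moreover have "(\<lambda>n. hnorm H (s n - x) + t N) \<longlonglongrightarrow> 0 + t N"
      by (intro tendsto_intros lim)
    ultimately have "hnorm H (x - sum u G) \<le> 0 + t N"
      by (intro LIMSEQ_le_const) auto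
    then show ?thesis unfolding eq[symmetric] by (simp add: u_def t_def a_def)
  qed
qed

lemma mult_op_bounded:
  assumes "\<And>f. f \<in> carr H \<Longrightarrow> mult_op h f \<in> carr H" "\<And>f. f \<in> carr H \<Longrightarrow> hnorm H (mult_op h f) \<le> B * hnorm H f"
  shows "bounded_operator H (mult_op h)"
  unfolding bounded_operator_def linear_in_def using assms mult_op_linear by blast

text \<open>A function of one coordinate has a double power series supported on one axis of \<open>\<nat> \<times> \<nat>\<close>; the embedding \<open>e\<close> of
\<open>\<nat>\<close> as that axis reduces the definition to \<open>power_series_calculus\<close>.\<close>

lemma functional_calculus_coord:
  assumes p: "p \<in> {fst, snd}" and r: "r > 1" and sm: "summable (\<lambda>n. cmod (c n) * r ^ n)"
    and h: "\<And>z. z \<in> bidisc \<Longrightarrow> (\<lambda>n. c n * p z ^ n) sums h z"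
  shows "functional_calculus H coord_mult_pair h (mult_op h)"
proof -
  have sm1: "summable (\<lambda>n. cmod (c n) * (real n + 1))" by (rule summable_linear_weight[OF r sm])
  have pc1: "mult_op h f \<in> carr H" if "f \<in> carr H" for f
    using power_series_calculus(1)[OF p sm1 _ that, of h] h by blast
  have pc2: "hnorm H (mult_op h f - (\<Sum>n\<in>G. scl H (c n) (mult_op (\<lambda>z. p z ^ n) f)))
      \<le> C * (suminf (\<lambda>n. cmod (c n) * (real n + 1)) - (\<Sum>n<N. cmod (c n) * (real n + 1))) * hnorm H f"
    if "f \<in> carr H" "finite G" "{..<N} \<subseteq> G" for f G N
    using power_series_calculus(2)[OF p sm1 _ that, of h] h by blast
  define A where "A = suminf (\<lambda>n. cmod (c n) * (real n + 1))"
  define a where "a = (\<lambda>n. cmod (c n) * (real n + 1))"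
  obtain e :: "nat \<Rightarrow> nat \<times> nat" where e: "inj e"
    and e_pow: "\<And>n z. fst z ^ fst (e n) * snd z ^ snd (e n) = p z ^ n"
    and e_sum: "\<And>n. fst (e n) + snd (e n) = n"
  proof (cases "p = fst")
    case True
    show ?thesis by (rule that[of "\<lambda>n. (n, 0)"]) (auto simp: True inj_on_def)
  next
    case False
    then have "p = snd" using p by simp
    then show ?thesis by (intro that[of "\<lambda>n. (0, n)"]) (auto simp: inj_on_def)
  qed
  define d where "d = (\<lambda>q. if q \<in> range e then c (inv e q) else 0)"
  have d: "d (e n) = c n" for n by (simp add: d_def e)
  have d0: "q \<notin> range e \<Longrightarrow> d q = 0" for q by (simp add: d_def)
  have bo: "bounded_operator H (mult_op h)"
    using pc1 pc2[of _ "{}" 0] by (intro mult_op_bounded) auto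
  have 1: "(\<lambda>(m, n). norm (d (m, n)) * r ^ (m + n)) summable_on UNIV"
  proof -
    have "(\<lambda>n. cmod (c n) * r ^ n) summable_on UNIV"
      using r sm by (intro norm_summable_imp_summable_on) (simp add: norm_mult norm_power)
    then have "((\<lambda>(m, n). norm (d (m, n)) * r ^ (m + n)) \<circ> e) summable_on UNIV"
      using d e_sum by (simp add: o_def split_def)
    then have "(\<lambda>(m, n). norm (d (m, n)) * r ^ (m + n)) summable_on (range e)"
      using summable_on_reindex[OF e] by blast
    then show ?thesis
      by (rule summable_on_cong_neutral[THEN iffD1, rotated 3]) (auto simp: d0)
  qed
  have 2: "((\<lambda>(m, n). d (m, n) * fst z ^ m * snd z ^ n) has_sum h z) UNIV" if z: "z \<in> bidisc" for z
  proof -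
    have pz: "cmod (p z) < 1" using p z by (auto simp: in_bidisc)
    have "summable (\<lambda>n. norm (c n * p z ^ n))"
    proof (rule summable_comparison_test'[OF sm])
      show "norm (norm (c n * p z ^ n)) \<le> cmod (c n) * r ^ n" for n
        using pz r by (auto simp: norm_mult norm_power intro!: mult_left_mono power_mono)
    qed
    then have "((\<lambda>n. c n * p z ^ n) has_sum h z) UNIV"
      using h[OF z] by (rule norm_summable_imp_has_sum)
    then have "(((\<lambda>(m, n). d (m, n) * fst z ^ m * snd z ^ n) \<circ> e) has_sum h z) UNIV"
      using d e_pow by (simp add: o_def split_def mult.assoc)
    then have "((\<lambda>(m, n). d (m, n) * fst z ^ m * snd z ^ n) has_sum h z) (range e)"
      using has_sum_reindex[OF e] by blast
    then show ?thesis
      by (rule has_sum_cong_neutral[THEN iffD1, rotated 3]) (auto simp: d0)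
  qed
  have 3: "\<forall>\<^sub>F F in finite_subsets_at_top UNIV. \<forall>x\<in>carr H.
     hnorm H (mult_op h x - (\<Sum>(m, n)\<in>F. scl H (d (m, n)) ((fst coord_mult_pair ^^ m) ((snd coord_mult_pair ^^ n) x))))
             \<le> \<epsilon> * hnorm H x" if \<epsilon>: "\<epsilon> > 0" for \<epsilon>
  proof -
    have "(\<lambda>N. C * (A - sum a {..<N})) \<longlonglongrightarrow> C * (A - A)"
      unfolding A_def a_def by (intro tendsto_intros summable_LIMSEQ sm1)
    then have "(\<lambda>N. C * (A - sum a {..<N})) \<longlonglongrightarrow> 0" by simp
    then obtain N where N: "C * (A - sum a {..<N}) < \<epsilon>"
      using order_tendstoD(2)[of _ 0 sequentially \<epsilon>] \<epsilon> eventually_happens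
      by (metis (no_types, lifting) trivial_limit_sequentially)
    have "hnorm H (mult_op h x - (\<Sum>(m, n)\<in>F. scl H (d (m, n)) ((fst coord_mult_pair ^^ m) ((snd coord_mult_pair ^^ n) x))))
        \<le> \<epsilon> * hnorm H x" if F: "finite F" "e ` {..<N} \<subseteq> F" and x: "x \<in> carr H" for F x
    proof -
      define G where "G = e -` F"
      have G: "finite G" "{..<N} \<subseteq> G"
        using F e by (auto simp: G_def intro: finite_vimageI)
      have "(\<Sum>(m, n)\<in>F. scl H (d (m, n)) ((fst coord_mult_pair ^^ m) ((snd coord_mult_pair ^^ n) x)))
        = (\<Sum>(m, n)\<in>e ` G. scl H (d (m, n)) ((fst coord_mult_pair ^^ m) ((snd coord_mult_pair ^^ n) x)))"
      proof (rule sum.mono_neutral_right)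
        have "d q = 0" if "q \<in> F - e ` G" for q
          using that by (intro d0) (auto simp: G_def)
        then show "\<forall>q\<in>F - e ` G. (case q of (m, n) \<Rightarrow>
            scl H (d (m, n)) ((fst coord_mult_pair ^^ m) ((snd coord_mult_pair ^^ n) x))) = 0"
          by (auto simp: vs.scale_zero_left)
      qed (use F in \<open>auto simp: G_def\<close>)
      also have "\<dots> = (\<Sum>n\<in>G. scl H (c n) (mult_op (\<lambda>z. p z ^ n) x))"
        using e by (subst sum.reindex)
          (auto simp: inj_on_def split_def d coord_mult_pair_def mult_op_funpow mult_op_mult e_pow)
      finally show ?thesis
        using pc2[OF x G] mult_right_mono[OF less_imp_le[OF N], of "hnorm H x"] x
        by (simp add: A_def a_def)
    qed
    then show ?thesis unfolding eventually_finite_subsets_at_top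
      by (intro exI[of _ "e ` {..<N}"]) auto
  qed
  show ?thesis unfolding functional_calculus_def
    using bo r 1 2 3 by blast
qed

text \<open>Norm convergence implies convergence at every point, and there the approximating polynomials in the coordinates
converge to \<open>h\<close>. So the operator is determined by \<open>h\<close>, whichever power series represents it.\<close>

lemma functional_calculus_unique:
  assumes fc: "functional_calculus H coord_mult_pair h A" and x: "x \<in> carr H"
  shows "A x = mult_op h x"
proof -
  obtain c where hs: "\<And>z. z \<in> bidisc \<Longrightarrow> ((\<lambda>(m, n). c (m, n) * fst z ^ m * snd z ^ n) has_sum h z) UNIV"
    and ap: "\<And>e. e > 0 \<Longrightarrow> \<forall>\<^sub>F F in finite_subsets_at_top UNIV. \<forall>x\<in>carr H.
           hnorm H (A x - (\<Sum>(m, n)\<in>F. scl H (c (m, n))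
             ((fst coord_mult_pair ^^ m) ((snd coord_mult_pair ^^ n) x)))) \<le> e * hnorm H x"
    and bo: "bounded_operator H A"
    using fc unfolding functional_calculus_def by blast
  define S where "S = (\<lambda>F. \<Sum>(m, n)\<in>F. scl H (c (m, n)) ((fst coord_mult_pair ^^ m) ((snd coord_mult_pair ^^ n) x)))"
  have Ax: "A x \<in> carr H" using bo x by (auto simp: bounded_operator_def linear_in_def)
  have Sc: "S F \<in> carr H" for F
    unfolding S_def by (rule carr_sum)
      (auto simp: coord_mult_pair_def mult_op_funpow x intro!: carr_scl growth)
  show ?thesis
  proof (rule ext)
    fix w
    show "A x w = mult_op h x w"
    proof (cases "w \<in> bidisc")
      case w: True
      have "A x w $ i = mult_op h x w $ i" for i
      proof (rule tendsto_unique[of "finite_subsets_at_top UNIV"])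
        define k where "k = kfun w (axis i 1)"
        have k: "k \<in> carr H" using w by (simp add: k_def)
        show "((\<lambda>F. S F w $ i) \<longlongrightarrow> A x w $ i) (finite_subsets_at_top UNIV)"
        proof (rule tendstoI)
          fix \<epsilon> :: real assume \<epsilon>: "\<epsilon> > 0"
          define e where "e = \<epsilon> / (hnorm H x * hnorm H k + 1)"
          have pos: "hnorm H x * hnorm H k + 1 > 0" using x k by (simp add: add_nonneg_pos)
          have e: "e > 0" using \<epsilon> pos by (simp add: e_def)
          have lt: "e * hnorm H x * hnorm H k < \<epsilon>"
          proof -
            have "e * (hnorm H x * hnorm H k) < e * (hnorm H x * hnorm H k + 1)" using e by simp
            also have "\<dots> = \<epsilon>" using pos by (simp add: e_def)
            finally show ?thesis by (simp add: mult.assoc)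
          qed
          show "\<forall>\<^sub>F F in finite_subsets_at_top UNIV. dist (S F w $ i) (A x w $ i) < \<epsilon>"
            using ap[OF e]
          proof eventually_elim
            case (elim F)
            have "dist (S F w $ i) (A x w $ i) = cmod (ip H (A x - S F) k)"
              using Sc Ax w by (simp add: k_def ip_kfun cdot_axis dist_norm norm_minus_commute)
            also have "\<dots> \<le> hnorm H (A x - S F) * hnorm H k"
              by (intro Cauchy_Schwarz_ip carr_diff Ax Sc k)
            also have "\<dots> \<le> e * hnorm H x * hnorm H k"
              using elim x k by (intro mult_right_mono) (auto simp: S_def)
            finally show ?case using lt by simp
          qed
        qed
        have "S F w $ i = (\<Sum>(m, n)\<in>F. c (m, n) * fst w ^ m * snd w ^ n) * x w $ i" for F
          by (simp add: S_def sum_apply split_def coord_mult_pair_def mult_op_funpow mult_op_def scl_eq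
              sum_distrib_right sum_distrib_left mult_ac)
        moreover have "((\<lambda>F. (\<Sum>(m, n)\<in>F. c (m, n) * fst w ^ m * snd w ^ n) * x w $ i) \<longlongrightarrow> h w * x w $ i)
            (finite_subsets_at_top UNIV)"
          using hs[OF w] unfolding has_sum_def by (intro tendsto_intros)
        ultimately show "((\<lambda>F. S F w $ i) \<longlongrightarrow> mult_op h x w $ i) (finite_subsets_at_top UNIV)"
          by (simp add: mult_op_def)
      qed auto
      then show ?thesis by (simp add: vec_eq_iff)
    next
      case False
      then show ?thesis using off_bidisc[OF Ax] off_bidisc[OF x] by (simp add: mult_op_def)
    qed
  qed
qed

text \<open>For \<open>\<bar>b\<bar> > 1\<close> the function \<open>1 / (\<zeta> - b)\<close> has a power series of radius above one.\<close>

lemma resolvent: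
  assumes p: "p \<in> {fst, snd}" and b: "cmod b > 1" and f: "f \<in> carr H"
  shows "mult_op (\<lambda>z. 1 / (p z - b)) f \<in> carr H"
proof -
  define r where "r = (1 + cmod b) / 2"
  have r: "1 < r" "r < cmod b" using b by (auto simp: r_def)
  have bn: "b \<noteq> 0" using b by auto
  define c where "c = (\<lambda>n. - (1 / b) * (1 / b) ^ n)"
  have "summable (\<lambda>n. cmod (c n) * r ^ n)"
  proof -
    have "(\<lambda>n. cmod (c n) * r ^ n) = (\<lambda>n. (1 / cmod b) * (r / cmod b) ^ n)"
      by (simp add: c_def norm_mult norm_power norm_divide power_divide field_simps)
    then show ?thesis using r b by (simp only:) (intro summable_mult summable_geometric, simp add: divide_less_eq)
  qed
  then have sm: "summable (\<lambda>n. cmod (c n) * (real n + 1))" by (rule summable_linear_weight[OF r(1)])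
  show ?thesis
  proof (rule power_series_calculus(1)[OF p sm _ f])
    fix z :: "complex \<times> complex" assume "z \<in> bidisc"
    then have pz: "cmod (p z) < 1" using p by (auto simp: in_bidisc)
    then have "cmod ((1 / b) * p z) < 1" using b by (simp add: norm_divide divide_less_eq)
    from sums_mult[OF geometric_sums[OF this], of "- (1 / b)"]
    have "(\<lambda>n. - (1 / b) * ((1 / b) * p z) ^ n) sums (- (1 / b) * (1 / (1 - (1 / b) * p z)))" .
    moreover have "- (1 / b) * (1 / (1 - (1 / b) * p z)) = 1 / (p z - b)"
    proof -
      have "b \<noteq> p z" using pz b by auto
      then show ?thesis using bn by (simp add: divide_simps)
    qed
    ultimately show "(\<lambda>n. c n * p z ^ n) sums (1 / (p z - b))"
      by (simp add: c_def power_mult_distrib power_divide)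
  qed
qed

text \<open>Outside the closed bidisc one of the two operators \<open>M\<^bsub>z\<^sub>1\<^esub> - a\<close>, \<open>M\<^bsub>z\<^sub>2\<^esub> - b\<close> is invertible.\<close>

lemma spectrum: "joint_spectrum H coord_mult_pair \<subseteq> closed_bidisc"
proof -
  have "koszul_exact H (\<lambda>x. fst coord_mult_pair x - scl H a x, \<lambda>x. snd coord_mult_pair x - scl H b x)"
    if ab: "(a, b) \<notin> closed_bidisc" for a b
  proof -
    define D where "D = (\<lambda>(\<xi> :: complex \<times> complex \<Rightarrow> complex) c (x :: complex \<times> complex \<Rightarrow> complex^'n).
      mult_op (\<lambda>z. \<xi> z - c) x)"
    have eq: "fst coord_mult_pair x - scl H a x = D fst a x" "snd coord_mult_pair x - scl H b x = D snd b x" for x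
      by (auto simp: D_def coord_mult_pair_def scl_eq mult_op_def vector_sub_rdistrib)
    have Dc: "D fst a x \<in> carr H" "D snd b x \<in> carr H" if "x \<in> carr H" for x
      unfolding eq[symmetric] using that mult_coord[of fst x] mult_coord[of snd x]
      by (simp_all add: coord_mult_pair_def)
    have exact: "koszul_exact H (D \<xi> c, D \<eta> c') \<and> koszul_exact H (D \<eta> c', D \<xi> c)"
      if \<xi>: "\<xi> \<in> {fst, snd}" and c: "cmod c > 1" and E: "\<And>x. x \<in> carr H \<Longrightarrow> D \<eta> c' x \<in> carr H" for \<xi> \<eta> c c'
    proof -
      define R where "R = (\<lambda>x :: complex \<times> complex \<Rightarrow> complex^'n. mult_op (\<lambda>z. 1 / (\<xi> z - c)) x)"
      have nz: "\<xi> z \<noteq> c" if "z \<in> bidisc" for z using that c \<xi> by (auto simp: in_bidisc)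
      have inv: "mult_op (\<lambda>z. (\<xi> z - c) * (1 / (\<xi> z - c))) x = x" if "x \<in> carr H" for x
      proof
        show "mult_op (\<lambda>z. (\<xi> z - c) * (1 / (\<xi> z - c))) x z = x z" for z
          using nz[of z] off_bidisc[OF that, of z] by (cases "z \<in> bidisc") (simp_all add: mult_op_def)
      qed
      show ?thesis
      proof (rule koszul_exact_invertible[where R = R])
        show "R x \<in> carr H" if "x \<in> carr H" for x unfolding R_def by (rule resolvent[OF \<xi> c that])
        show "D \<xi> c (R x) = x" "R (D \<xi> c x) = x" if "x \<in> carr H" for x
          using inv[OF that] unfolding D_def R_def mult_op_mult by (simp_all only: mult.commute)
        show "D \<eta> c' (R x) = R (D \<eta> c' x)" for x by (simp add: D_def R_def mult_op_mult mult.commute)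
        show "D \<xi> c (0 - x) = 0 - D \<xi> c x" for x by (auto simp: D_def mult_op_def)
      qed (use E in \<open>auto simp: D_def R_def mult_op_def\<close>)
    qed
    have "cmod a > 1 \<or> cmod b > 1" using ab by (auto simp: closed_bidisc_def not_le)
    then show ?thesis unfolding eq using exact[of fst a snd b] exact[of snd b fst a] Dc by blast
  qed
  then show ?thesis unfolding joint_spectrum_def by auto
qed

end

section \<open>Automorphisms of the bidisc\<close>

text \<open>Holomorphy along one-parameter analytic discs: the form in which Schwarz' lemma is applied, and one that is
immediately stable under composition with Moebius maps of the variables and of the values.\<close>

definition slice_holomorphic :: "(complex \<times> complex \<Rightarrow> complex) \<Rightarrow> bool" where
  "slice_holomorphic f \<longleftrightarrow> (\<forall>S x y. open S \<longrightarrow> x holomorphic_on S \<longrightarrow> y holomorphic_on S \<longrightarrow>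
     (\<forall>\<zeta>\<in>S. (x \<zeta>, y \<zeta>) \<in> bidisc) \<longrightarrow> (\<lambda>\<zeta>. f (x \<zeta>, y \<zeta>)) holomorphic_on S)"

lemma slice_holomorphicD:
  assumes "slice_holomorphic f" "open S" "x holomorphic_on S" "y holomorphic_on S"
    "\<And>\<zeta>. \<zeta> \<in> S \<Longrightarrow> (x \<zeta>, y \<zeta>) \<in> bidisc"
  shows "(\<lambda>\<zeta>. f (x \<zeta>, y \<zeta>)) holomorphic_on S"
  using assms unfolding slice_holomorphic_def by blast

lemma holomorphic2_slice:
  assumes "holomorphic2_on f bidisc"
  shows "slice_holomorphic f"
  unfolding slice_holomorphic_def
proof (intro allI impI)
  fix S :: "complex set" and x y
  assume S: "open S" and x: "x holomorphic_on S" and y: "y holomorphic_on S"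
    and xy: "\<forall>\<zeta>\<in>S. (x \<zeta>, y \<zeta>) \<in> bidisc"
  show "(\<lambda>\<zeta>. f (x \<zeta>, y \<zeta>)) holomorphic_on S"
    unfolding holomorphic_on_def
  proof
    fix \<zeta> assume \<zeta>: "\<zeta> \<in> S"
    obtain a b where f: "(f has_derivative (\<lambda>h. a * fst h + b * snd h)) (at (x \<zeta>, y \<zeta>))"
      using assms xy \<zeta> unfolding holomorphic2_on_def by blast
    obtain x' y' where d: "(x has_field_derivative x') (at \<zeta>)" "(y has_field_derivative y') (at \<zeta>)"
      using x y S \<zeta> by (meson holomorphic_on_open field_differentiable_def holomorphic_on_imp_differentiable_at)
    have "((\<lambda>\<zeta>. (x \<zeta>, y \<zeta>)) has_derivative (\<lambda>h. (x' * h, y' * h))) (at \<zeta>)"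
      using d by (intro has_derivative_Pair) (auto simp: has_field_derivative_def)
    from has_derivative_compose[OF this f]
    have "((\<lambda>\<zeta>. f (x \<zeta>, y \<zeta>)) has_derivative (\<lambda>h. (a * x' + b * y') * h)) (at \<zeta>)"
      by (simp add: algebra_simps)
    then show "(\<lambda>\<zeta>. f (x \<zeta>, y \<zeta>)) field_differentiable at \<zeta> within S"
      by (metis field_differentiable_at_within field_differentiable_def has_field_derivative_def)
  qed
qed

text \<open>Schwarz' lemma on the complex line through \<open>z\<close>, scaled so that the larger coordinate has modulus one.\<close>

lemma Schwarz_bidisc:
  assumes f: "slice_holomorphic f" "f (0, 0) = 0" "\<And>z. z \<in> bidisc \<Longrightarrow> cmod (f z) < 1"
    and z: "z \<in> bidisc"
  shows "cmod (f z) \<le> max (cmod (fst z)) (cmod (snd z))"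
proof -
  define M where "M = max (cmod (fst z)) (cmod (snd z))"
  show ?thesis
  proof (cases "M = 0")
    case True
    then have "cmod (fst z) \<le> 0" "cmod (snd z) \<le> 0"
      unfolding M_def by (metis max.cobounded1, metis max.cobounded2)
    then have "z = (0, 0)" by (cases z) simp
    then show ?thesis using f by simp
  next
    case False
    have M: "0 < M" "M < 1" "cmod (fst z) \<le> M" "cmod (snd z) \<le> M"
      using False z by (auto simp: M_def in_bidisc max_def split: if_splits)
    have "(\<zeta> * (fst z / of_real M), \<zeta> * (snd z / of_real M)) \<in> bidisc" if "cmod \<zeta> < 1" for \<zeta>
    proof -
      have "cmod \<zeta> * (cmod w / M) < 1" if "cmod w \<le> M" for w :: complex
      proof -
        have "cmod \<zeta> * (cmod w / M) \<le> cmod \<zeta> * 1" using that M by (intro mult_left_mono) auto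
        then show ?thesis using \<open>cmod \<zeta> < 1\<close> by simp
      qed
      then show ?thesis using M by (simp add: in_bidisc norm_mult norm_divide)
    qed
    note in_b = this
    have "cmod (f (of_real M * (fst z / of_real M), of_real M * (snd z / of_real M))) \<le> cmod (of_real M)"
    proof (rule Schwarz_Lemma(1)[where f = "\<lambda>\<zeta>. f (\<zeta> * (fst z / of_real M), \<zeta> * (snd z / of_real M))"])
      show "(\<lambda>\<zeta>. f (\<zeta> * (fst z / of_real M), \<zeta> * (snd z / of_real M))) holomorphic_on ball 0 1"
        by (rule slice_holomorphicD[OF f(1)]) (auto intro!: holomorphic_intros in_b[simplified])
    qed (use f M in_b[simplified] in auto)
    then show ?thesis using M by (simp add: M_def[symmetric])
  qed
qed

text \<open>At \<open>(1/2, 0)\<close> one of the two functions, \<open>f\<close>, attains the bound in Schwarz' lemma. As a function of \<open>t\<close>, the value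
\<open>f(1/2, t/2)\<close> is bounded by \<open>1/2\<close> and attains this at \<open>t = 0\<close>, so it is constant by the maximum principle. Hence the
bound is attained on each line \<open>(\<zeta>, t \<zeta>)\<close>, where \<open>f\<close> is therefore a rotation of \<open>\<zeta>\<close>, with the same factor for all
\<open>t\<close>. The lines fill \<open>\<bar>z\<^sub>2\<bar> < \<bar>z\<^sub>1\<bar>\<close>, and analytic continuation in the first variable does the rest.\<close>

lemma rotation_component:
  assumes f1: "slice_holomorphic f1" "f1 (0, 0) = 0" "\<And>z. z \<in> bidisc \<Longrightarrow> cmod (f1 z) < 1"
    and f2: "slice_holomorphic f2" "f2 (0, 0) = 0" "\<And>z. z \<in> bidisc \<Longrightarrow> cmod (f2 z) < 1"
    and lower: "\<And>z. z \<in> bidisc \<Longrightarrow> max (cmod (fst z)) (cmod (snd z)) \<le> max (cmod (f1 z)) (cmod (f2 z))"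
  shows "\<exists>f\<in>{f1, f2}. \<exists>c. cmod c = 1 \<and> (\<forall>z\<in>bidisc. f z = c * fst z)"
proof -
  have half: "(1/2, 0) \<in> bidisc" by (simp add: in_bidisc norm_divide)
  have "1/2 \<le> max (cmod (f1 (1/2, 0))) (cmod (f2 (1/2, 0)))"
    using lower[OF half] by (simp add: norm_divide)
  then obtain f where f: "f \<in> {f1, f2}" and f0: "1/2 \<le> cmod (f (1/2, 0))"
    by (auto simp: le_max_iff_disj)
  have fh: "slice_holomorphic f" "f (0, 0) = 0" "\<And>z. z \<in> bidisc \<Longrightarrow> cmod (f z) < 1"
    using f f1 f2 by auto
  define F where "F = (\<lambda>t. f (1/2, t / 2))"
  have tb: "(1/2, t/2) \<in> bidisc" if "cmod t < 1" for t :: complex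
    using that by (simp add: in_bidisc norm_divide)
  have Fh: "F holomorphic_on ball 0 1"
    unfolding F_def by (rule slice_holomorphicD[OF fh(1)]) (auto intro!: holomorphic_intros tb)
  have Fle: "cmod (F t) \<le> 1/2" if "cmod t < 1" for t
    using Schwarz_bidisc[OF fh tb[OF that]] that by (simp add: F_def norm_divide)
  have "F constant_on ball 0 1"
  proof (rule maximum_modulus_principle[OF Fh])
    show "cmod (F t) \<le> cmod (F 0)" if "t \<in> ball 0 1" for t
      using Fle[of t] f0 that by (simp add: F_def)
  qed auto
  then obtain d where d: "\<And>t. cmod t < 1 \<Longrightarrow> F t = d" unfolding constant_on_def by auto
  define c where "c = 2 * d"
  have d0: "cmod d = 1/2" using Fle[of 0] f0 d[of 0] by (simp add: F_def)
  have c: "cmod c = 1" using d0 by (simp add: c_def norm_mult)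
  have cone: "f (\<zeta>, t * \<zeta>) = c * \<zeta>" if t: "cmod t < 1" and \<zeta>: "cmod \<zeta> < 1" for t \<zeta>
  proof -
    have tz: "(x, t * x) \<in> bidisc" if "cmod x < 1" for x
      using that t mult_strict_mono[of "cmod t" 1 "cmod x" 1] by (simp add: in_bidisc norm_mult)
    have "\<exists>\<alpha>. (\<forall>z. cmod z < 1 \<longrightarrow> f (z, t * z) = \<alpha> * z) \<and> cmod \<alpha> = 1"
    proof (rule Schwarz_Lemma(3)[where f = "\<lambda>\<zeta>. f (\<zeta>, t * \<zeta>)" and \<xi> = 0])
      show "(\<lambda>\<zeta>. f (\<zeta>, t * \<zeta>)) holomorphic_on ball 0 1"
        by (rule slice_holomorphicD[OF fh(1)]) (auto intro!: holomorphic_intros tz)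
      have "cmod (f (1/2, t * (1/2))) = 1/2" using d[OF t] d0 by (simp add: F_def)
      then show "(\<exists>z. cmod z < 1 \<and> z \<noteq> 0 \<and> cmod (f (z, t * z)) = cmod z) \<or>
          cmod (deriv (\<lambda>\<zeta>. f (\<zeta>, t * \<zeta>)) 0) = 1"
        by (intro disjI1 exI[of _ "1/2"]) (simp add: norm_divide)
    qed (use fh tz in auto)
    then obtain \<alpha> where \<alpha>: "\<And>z. cmod z < 1 \<Longrightarrow> f (z, t * z) = \<alpha> * z" by blast
    have "\<alpha> * (1/2) = d" using \<alpha>[of "1/2"] d[OF t] by (simp add: F_def norm_divide)
    then have "\<alpha> = c" by (simp add: c_def)
    then show ?thesis using \<alpha>[OF \<zeta>] by simp
  qed
  have "f z = c * fst z" if z: "z \<in> bidisc" for z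
  proof -
    define w where "w = snd z"
    have w: "cmod w < 1" using z by (simp add: w_def in_bidisc)
    define S where "S = ball 0 1 - cball (0::complex) (cmod w)"
    have "f (x, w) = c * x" if x: "cmod x < 1" for x
    proof (rule analytic_continuation_open[of S "ball 0 1" "\<lambda>x. f (x, w)" "\<lambda>x. c * x"])
      show "open S" unfolding S_def by (intro open_Diff) auto
      have "of_real ((1 + cmod w) / 2) \<in> S" using w by (simp add: S_def norm_divide del: of_real_add)
      then show "S \<noteq> {}" by blast
      show "f (x, w) = c * x" if "x \<in> S" for x
      proof -
        have x: "cmod x < 1" "cmod w < cmod x" using that by (auto simp: S_def)
        then have "x \<noteq> 0" by auto
        then show ?thesis using cone[of "w / x" x] x by (simp add: norm_divide divide_less_eq)
      qed
      show "(\<lambda>x. f (x, w)) holomorphic_on ball 0 1"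
        by (rule slice_holomorphicD[OF fh(1)]) (use w in \<open>auto simp: in_bidisc intro!: holomorphic_intros\<close>)
    qed (use x in \<open>auto simp: S_def intro!: holomorphic_intros\<close>)
    from this[of "fst z"] show ?thesis using z by (simp add: w_def in_bidisc)
  qed
  then show ?thesis using f c by blast
qed

lemma mob_holomorphic:
  assumes a: "cmod a < 1" and x: "x holomorphic_on S" and b: "\<And>\<zeta>. \<zeta> \<in> S \<Longrightarrow> cmod (x \<zeta>) < 1"
  shows "(\<lambda>\<zeta>. mob c a (x \<zeta>)) holomorphic_on S"
  unfolding mob_def using x one_minus_nz[of "cnj a"] a b by (intro holomorphic_intros) auto

lemma slice_holomorphic_swap:
  assumes "slice_holomorphic f"
  shows "slice_holomorphic (\<lambda>z. f (snd z, fst z))"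
  unfolding slice_holomorphic_def
proof (intro allI impI)
  fix S :: "complex set" and x y
  assume "open S" "x holomorphic_on S" "y holomorphic_on S" "\<forall>\<zeta>\<in>S. (x \<zeta>, y \<zeta>) \<in> bidisc"
  then show "(\<lambda>\<zeta>. f (snd (x \<zeta>, y \<zeta>), fst (x \<zeta>, y \<zeta>))) holomorphic_on S"
    using slice_holomorphicD[OF assms, of S y x] by (simp add: in_bidisc)
qed

text \<open>After a Moebius change of variables the automorphism fixes the origin, so by Schwarz' lemma for it and for its
inverse it preserves the larger of the two moduli. Then \<open>rotation_component\<close> finds a component that rotates the first
variable and, applied with the variables exchanged, a component that rotates the second.\<close>

theorem aut_bidisc_bimob:
  assumes g: "g \<in> aut_bidisc"
  obtains s c1 a1 c2 a2 where "cmod c1 = 1" "cmod a1 < 1" "cmod c2 = 1" "cmod a2 < 1"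
    "\<And>z. z \<in> bidisc \<Longrightarrow> g z = bimob s c1 a1 c2 a2 z"
proof -
  define k where "k = inv_into bidisc g"
  have bij: "bij_betw g bidisc bidisc" using g by (simp add: aut_bidisc_def)
  have gs: "slice_holomorphic (fst \<circ> g)" "slice_holomorphic (snd \<circ> g)"
    and ks: "slice_holomorphic (fst \<circ> k)" "slice_holomorphic (snd \<circ> k)"
    using g by (auto simp: aut_bidisc_def k_def intro: holomorphic2_slice)
  have gb: "g z \<in> bidisc" and kb: "k z \<in> bidisc" and gk: "g (k z) = z" and kg: "k (g z) = z"
    if "z \<in> bidisc" for z
    using bij that unfolding k_def
    by (auto simp: bij_betw_def inv_into_into f_inv_into_f inv_into_f_f)
  have z0: "(0, 0) \<in> bidisc" by (simp add: in_bidisc)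
  obtain p1 p2 where p: "k (0, 0) = (p1, p2)" by fastforce
  have p1: "cmod p1 < 1" and p2: "cmod p2 < 1" using kb[OF z0] p by (auto simp: in_bidisc)
  define \<psi> where "\<psi> = (\<lambda>z. (mob 1 (- p1) (fst z), mob 1 (- p2) (snd z)))"
  define \<omega> where "\<omega> = (\<lambda>z. (mob 1 p1 (fst z), mob 1 p2 (snd z)))"
  have \<psi>b: "\<psi> z \<in> bidisc" and \<omega>b: "\<omega> z \<in> bidisc" and \<psi>\<omega>: "\<psi> (\<omega> z) = z" and \<omega>\<psi>: "\<omega> (\<psi> z) = z"
    if "z \<in> bidisc" for z
    using that p1 p2 mob_inverse[of 1 p1] mob_inverse[of 1 p2]
      mob_inverse[of 1 "- p1"] mob_inverse[of 1 "- p2"]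
    by (auto simp: \<psi>_def \<omega>_def in_bidisc mob_norm_less)
  have \<psi>0: "\<psi> (0, 0) = (p1, p2)" by (simp add: \<psi>_def mob_def)
  have s\<psi>: "slice_holomorphic (\<lambda>z. f (\<psi> z))" if "slice_holomorphic f" for f
    unfolding slice_holomorphic_def
  proof (intro allI impI)
    fix S :: "complex set" and x y
    assume S: "open S" "x holomorphic_on S" "y holomorphic_on S" and xy: "\<forall>\<zeta>\<in>S. (x \<zeta>, y \<zeta>) \<in> bidisc"
    have "(\<lambda>\<zeta>. f (mob 1 (- p1) (x \<zeta>), mob 1 (- p2) (y \<zeta>))) holomorphic_on S"
      using S xy p1 p2 \<psi>b
      by (intro slice_holomorphicD[OF that] mob_holomorphic) (auto simp: in_bidisc \<psi>_def)
    then show "(\<lambda>\<zeta>. f (\<psi> (x \<zeta>, y \<zeta>))) holomorphic_on S" by (simp add: \<psi>_def)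
  qed
  have s\<omega>: "slice_holomorphic (\<lambda>z. mob 1 a (f z))"
    if "slice_holomorphic f" "cmod a < 1" "\<And>z. z \<in> bidisc \<Longrightarrow> cmod (f z) < 1" for f a
    unfolding slice_holomorphic_def
    using that by (intro allI impI mob_holomorphic slice_holomorphicD[OF that(1)]) auto
  define f1 f2 where "f1 = (\<lambda>z. fst (g (\<psi> z)))" and "f2 = (\<lambda>z. snd (g (\<psi> z)))"
  have f1: "slice_holomorphic f1" "f1 (0, 0) = 0" "\<And>z. z \<in> bidisc \<Longrightarrow> cmod (f1 z) < 1"
    and f2: "slice_holomorphic f2" "f2 (0, 0) = 0" "\<And>z. z \<in> bidisc \<Longrightarrow> cmod (f2 z) < 1"
    using s\<psi>[OF gs(1)] s\<psi>[OF gs(2)] \<psi>0 gk[OF z0] p gb[OF \<psi>b]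
    by (auto simp: f1_def f2_def o_def in_bidisc)
  have lower: "max (cmod (fst z)) (cmod (snd z)) \<le> max (cmod (f1 z)) (cmod (f2 z))" if z: "z \<in> bidisc" for z
  proof -
    define w where "w = g (\<psi> z)"
    have w: "w \<in> bidisc" using z gb \<psi>b by (simp add: w_def)
    have zw: "z = \<omega> (k w)" using z by (simp add: w_def kg \<psi>b \<omega>\<psi>)
    have kc: "cmod ((fst \<circ> k) x) < 1" "cmod ((snd \<circ> k) x) < 1" if "x \<in> bidisc" for x
      using kb[OF that] by (auto simp: in_bidisc)
    have "cmod (mob 1 p1 ((fst \<circ> k) w)) \<le> max (cmod (fst w)) (cmod (snd w))"
    proof (rule Schwarz_bidisc[where f = "\<lambda>z. mob 1 p1 ((fst \<circ> k) z)"])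
      show "slice_holomorphic (\<lambda>z. mob 1 p1 ((fst \<circ> k) z))" using s\<omega>[of "fst \<circ> k" p1] ks p1 kc by blast
      show "mob 1 p1 ((fst \<circ> k) (0, 0)) = 0" by (simp add: p mob_def)
      show "cmod (mob 1 p1 ((fst \<circ> k) z)) < 1" if "z \<in> bidisc" for z
        by (rule mob_norm_less) (use p1 kc[OF that] in auto)
    qed (rule w)
    moreover have "cmod (mob 1 p2 ((snd \<circ> k) w)) \<le> max (cmod (fst w)) (cmod (snd w))"
    proof (rule Schwarz_bidisc[where f = "\<lambda>z. mob 1 p2 ((snd \<circ> k) z)"])
      show "slice_holomorphic (\<lambda>z. mob 1 p2 ((snd \<circ> k) z))" using s\<omega>[of "snd \<circ> k" p2] ks p2 kc by blast
      show "mob 1 p2 ((snd \<circ> k) (0, 0)) = 0" by (simp add: p mob_def)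
      show "cmod (mob 1 p2 ((snd \<circ> k) z)) < 1" if "z \<in> bidisc" for z
        by (rule mob_norm_less) (use p2 kc[OF that] in auto)
    qed (rule w)
    moreover have "fst z = mob 1 p1 ((fst \<circ> k) w)" "snd z = mob 1 p2 ((snd \<circ> k) w)"
      using arg_cong[OF zw, of fst] arg_cong[OF zw, of snd] by (simp_all only: \<omega>_def fst_conv snd_conv o_def)
    moreover have "fst w = f1 z" "snd w = f2 z" by (simp_all add: w_def f1_def f2_def)
    ultimately show ?thesis by (simp only: max.bounded_iff)
  qed
  obtain f c where f: "f \<in> {f1, f2}" and c: "cmod c = 1" and fc: "\<And>z. z \<in> bidisc \<Longrightarrow> f z = c * fst z"
    using rotation_component[OF f1 f2 lower] by blast
  have "\<exists>f\<in>{\<lambda>z. f1 (snd z, fst z), \<lambda>z. f2 (snd z, fst z)}. \<exists>c. cmod c = 1 \<and> (\<forall>z\<in>bidisc. f z = c * fst z)"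
  proof (rule rotation_component)
    show "max (cmod (fst z)) (cmod (snd z)) \<le> max (cmod (f1 (snd z, fst z))) (cmod (f2 (snd z, fst z)))"
      if "z \<in> bidisc" for z
      using lower[of "(snd z, fst z)"] that by (simp add: in_bidisc max.commute)
  qed (use f1 f2 in \<open>auto intro: slice_holomorphic_swap simp: in_bidisc\<close>)
  then obtain f' c' where f': "f' \<in> {f1, f2}" and c': "cmod c' = 1"
    and fc'': "\<And>z. z \<in> bidisc \<Longrightarrow> f' (snd z, fst z) = c' * fst z" by blast
  have fc': "f' z = c' * snd z" if "z \<in> bidisc" for z
    using fc''[of "(snd z, fst z)"] that by (simp add: in_bidisc)
  have ne: "f \<noteq> f'"
  proof
    assume "f = f'"
    moreover have "(1/2, 0) \<in> bidisc" by (simp add: in_bidisc norm_divide)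
    ultimately show False using fc[of "(1/2, 0)"] fc'[of "(1/2, 0)"] c by auto
  qed
  have gf: "fst (g z) = f1 (\<omega> z)" "snd (g z) = f2 (\<omega> z)" if "z \<in> bidisc" for z
    using \<psi>\<omega>[OF that] by (simp_all add: f1_def f2_def)
  have mobc: "c * mob 1 a w = mob c a w" for c a w by (simp add: mob_def)
  consider "f = f1" "f' = f2" | "f = f2" "f' = f1" using f f' ne by blast
  then show thesis
  proof cases
    case 1
    have "g z = bimob False c p1 c' p2 z" if z: "z \<in> bidisc" for z
      using gf[OF z] fc[OF \<omega>b[OF z]] fc'[OF \<omega>b[OF z]] 1
      by (intro prod_eqI) (auto simp: bimob_def \<omega>_def mobc)
    then show ?thesis using that c c' p1 p2 by blast
  next
    case 2
    have "g z = bimob True c' p2 c p1 z" if z: "z \<in> bidisc" for z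
      using gf[OF z] fc[OF \<omega>b[OF z]] fc'[OF \<omega>b[OF z]] 2
      by (intro prod_eqI) (auto simp: bimob_def \<omega>_def mobc)
    then show ?thesis using that c c' p1 p2 by blast
  qed
qed

lemma swap_aut: "prod.swap \<in> aut_bidisc"
proof -
  have inj: "inj_on prod.swap (bidisc :: (complex \<times> complex) set)" by (metis inj_on_def swap_swap)
  have img: "prod.swap ` bidisc = (bidisc :: (complex \<times> complex) set)"
  proof (intro subset_antisym subsetI)
    show "z \<in> prod.swap ` bidisc" if "z \<in> bidisc" for z :: "complex \<times> complex"
      by (rule image_eqI[of _ _ "prod.swap z"]) (use that in \<open>auto simp: in_bidisc\<close>)
  qed (auto simp: in_bidisc)
  have inv: "inv_into bidisc prod.swap z = prod.swap z" if "z \<in> bidisc" for z :: "complex \<times> complex"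
    using that inj by (intro inv_into_f_eq) (auto simp: in_bidisc)
  have fs: "((\<lambda>z. fst (prod.swap z)) has_derivative (\<lambda>h. 0 * fst h + 1 * snd h)) (at z)"
    "((\<lambda>z. snd (prod.swap z)) has_derivative (\<lambda>h. 1 * fst h + 0 * snd h)) (at z)" for z :: "complex \<times> complex"
    by (auto intro!: derivative_eq_intros)
  have "\<exists>a b. ((\<lambda>z. fst (inv_into bidisc prod.swap z)) has_derivative (\<lambda>h. a * fst h + b * snd h)) (at z)"
    "\<exists>a b. ((\<lambda>z. snd (inv_into bidisc prod.swap z)) has_derivative (\<lambda>h. a * fst h + b * snd h)) (at z)"
    if "z \<in> bidisc" for z :: "complex \<times> complex"
    using has_derivative_transform_within_open[OF fs(1) bidisc_open that, of "\<lambda>z. fst (inv_into bidisc prod.swap z)"]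
      has_derivative_transform_within_open[OF fs(2) bidisc_open that, of "\<lambda>z. snd (inv_into bidisc prod.swap z)"]
      inv by (metis, metis)
  then have "holomorphic2_on (\<lambda>z. fst (inv_into bidisc prod.swap z)) bidisc"
    "holomorphic2_on (\<lambda>z. snd (inv_into bidisc prod.swap z)) bidisc"
    unfolding holomorphic2_on_def by blast+
  moreover have "holomorphic2_on (\<lambda>z. fst (prod.swap z)) bidisc"
    "holomorphic2_on (\<lambda>z. snd (prod.swap z)) bidisc"
    unfolding holomorphic2_on_def using fs by blast+
  ultimately show ?thesis
    unfolding aut_bidisc_def bij_betw_def o_def using inj img by blast
qed

section \<open>Separability\<close>

context rkhs
begin

text \<open>The squared norm of \<open>kfun w (v - u)\<close> is a polynomial in the entries of \<open>u\<close> and their conjugates that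
vanishes at \<open>u = v\<close>.\<close>

lemma kfun_small:
  assumes w: "w \<in> bidisc" and e: "e > 0"
  obtains S where "open S" "v \<in> S" "\<And>u. u \<in> S \<Longrightarrow> hnorm H (kfun w v - kfun w u) < e"
proof -
  define q where "q = (\<lambda>u. hnorm H (kfun w (v - u)))"
  have q: "q = (\<lambda>u. sqrt (Re (\<Sum>i\<in>UNIV. (\<Sum>j\<in>UNIV. K w w $ i $ j * (v $ j - u $ j)) * cnj (v $ i - u $ i))))"
    using w by (simp add: q_def hnorm_def kfun_kfun cdot_def matrix_vector_mult_def)
  have "continuous_on UNIV q" unfolding q by (intro continuous_intros)
  then have "open (q -` {..<e})" by (intro open_vimage) auto
  moreover have "v \<in> q -` {..<e}" using e kfun_diff[of w 0 0] by (simp add: q_def)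
  ultimately show thesis using that[of "q -` {..<e}"] by (simp add: q_def kfun_diff)
qed

text \<open>A countable dense set of points is a set of uniqueness by continuity, so \<open>comb_dense\<close> applies to it; the
coefficients are then moved to a countable dense set of vectors.\<close>

lemma separable: "separable_hspace H"
proof -
  obtain D0 :: "(complex \<times> complex) set" where D0: "countable D0"
    and dD: "\<And>X. open X \<Longrightarrow> X \<noteq> {} \<Longrightarrow> \<exists>d\<in>D0. d \<in> X" using countable_dense_exists by blast
  obtain E :: "(complex^'n) set" where E: "countable E"
    and dE: "\<And>X. open X \<Longrightarrow> X \<noteq> {} \<Longrightarrow> \<exists>d\<in>E. d \<in> X" using countable_dense_exists by blast
  define D where "D = D0 \<inter> bidisc"
  have Db: "D \<subseteq> bidisc" by (simp add: D_def)
  have uniq: "f = 0" if f: "f \<in> carr H" and f0: "\<And>w. w \<in> D \<Longrightarrow> f w = 0" for f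
  proof (rule carr_eqI)
    fix w assume w: "w \<in> bidisc"
    have "f w $ i = 0" for i
    proof (rule ccontr)
      assume ne: "f w $ i \<noteq> 0"
      have "isCont (\<lambda>z. f z $ i) z" if "z \<in> bidisc" for z
        using carr_holomorphic[OF f, of i] that unfolding holomorphic2_on_def
        using has_derivative_continuous by blast
      then have "continuous_on bidisc (\<lambda>z. f z $ i)" by (simp add: continuous_at_imp_continuous_on)
      then have "open ((\<lambda>z. f z $ i) -` (- {0}) \<inter> bidisc)"
        using continuous_on_open_vimage[OF bidisc_open] open_delete by blast
      moreover have "w \<in> (\<lambda>z. f z $ i) -` (- {0}) \<inter> bidisc" using ne w by simp
      ultimately obtain d where "d \<in> D0" "d \<in> (\<lambda>z. f z $ i) -` (- {0}) \<inter> bidisc" using dD by blast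
      then show False using f0[of d] by (auto simp: D_def)
    qed
    then show "f w = 0 w" by (simp add: vec_eq_iff)
  qed (use f in auto)
  have lc: "comb ys \<in> carr H" if "ys \<in> lists (D \<times> E)" for ys
    by (rule comb_carr) (use that Db in \<open>fastforce simp: in_lists_conv_set\<close>)
  have approx: "\<exists>ys\<in>lists (D \<times> E). hnorm H (comb xs - comb ys) < e"
    if "fst ` set xs \<subseteq> D" "e > 0" for xs e
    using that
  proof (induction xs arbitrary: e)
    case Nil
    then show ?case by (intro bexI[of _ "[]"]) (auto simp del: zero_fun_apply)
  next
    case (Cons p xs)
    obtain w v where p: "p = (w, v)" by fastforce
    have w: "w \<in> D" "w \<in> bidisc" using Cons.prems p Db by auto
    have "\<exists>ys\<in>lists (D \<times> E). hnorm H (comb xs - comb ys) < e / 2"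
      by (rule Cons.IH) (use Cons.prems in auto)
    then obtain ys where ys: "ys \<in> lists (D \<times> E)" "hnorm H (comb xs - comb ys) < e / 2" by blast
    obtain S where S: "open S" "v \<in> S" "\<And>u. u \<in> S \<Longrightarrow> hnorm H (kfun w v - kfun w u) < e / 2"
      using kfun_small[OF w(2), of "e / 2" v] Cons.prems by auto
    obtain u where u: "u \<in> E" "u \<in> S" using dE[OF S(1)] S(2) by blast
    have c: "comb xs \<in> carr H" "comb ys \<in> carr H"
      using comb_carr[of xs] Cons.prems lc[OF ys(1)] Db by auto
    have eq: "comb (p # xs) - comb ((w, u) # ys) = (kfun w v - kfun w u) + (comb xs - comb ys)"
      by (simp add: p fun_eq_iff)
    have "hnorm H ((kfun w v - kfun w u) + (comb xs - comb ys))
        \<le> hnorm H (kfun w v - kfun w u) + hnorm H (comb xs - comb ys)"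
      using c w by (intro hnorm_triangle carr_diff kfun_carr) auto
    then have lt: "hnorm H (comb (p # xs) - comb ((w, u) # ys)) < e"
      unfolding eq using S(3)[OF u(2)] ys(2) by linarith
    show "\<exists>ys\<in>lists (D \<times> E). hnorm H (comb (p # xs) - comb ys) < e"
      by (rule bexI, rule lt) (use ys u w in auto)
  qed
  have "countable (comb ` lists (D \<times> E))"
    using D0 E by (auto simp: D_def intro!: countable_lists)
  moreover have "comb ` lists (D \<times> E) \<subseteq> carr H"
    using lc by blast
  moreover have "\<exists>d\<in>comb ` lists (D \<times> E). hnorm H (x - d) < e" if x: "x \<in> carr H" and e: "e > 0" for x e
  proof -
    obtain xs where xs: "\<And>n::nat. fst ` set (xs n) \<subseteq> D" "(\<lambda>n. hnorm H (comb (xs n) - x)) \<longlonglongrightarrow> 0"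
      using comb_dense[OF Db uniq x] by blast
    have "\<forall>\<^sub>F n in sequentially. hnorm H (comb (xs n) - x) < e / 2"
      by (rule order_tendstoD(2)[OF xs(2)]) (use e in simp)
    then obtain n where n: "hnorm H (comb (xs n) - x) < e / 2"
      unfolding eventually_sequentially by blast
    have e2: "0 < e / 2" using e by simp
    obtain ys where ys: "ys \<in> lists (D \<times> E)" "hnorm H (comb (xs n) - comb ys) < e / 2"
      using approx[OF xs(1) e2, of n] by blast
    have c: "comb (xs n) \<in> carr H" "comb ys \<in> carr H"
      using comb_carr[of "xs n"] xs(1)[of n] lc[OF ys(1)] Db by auto
    have "hnorm H (x - comb ys) < e"
      using hnorm_triangle_diff[OF x c] hnorm_minus_commute[OF x c(1)] n ys(2) by linarith
    then show ?thesis using ys by blast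
  qed
  ultimately show ?thesis unfolding separable_hspace_def by blast
qed

end

section \<open>Homogeneity and covariance\<close>

definition const :: "complex^'n \<Rightarrow> complex \<times> complex \<Rightarrow> complex^'n" where
  "const u = (\<lambda>z. if z \<in> bidisc then u else 0)"

lemma mult_axis: "(A *v axis i 1) $ k = (A $ k $ i :: complex)"
proof -
  have "(A *v axis i 1) $ k = (\<Sum>j\<in>UNIV. if j = i then A $ k $ i else 0)"
    unfolding matrix_vector_mult_def vec_lambda_beta by (rule sum.cong) (auto simp: axis_def)
  then show ?thesis by simp
qed

context rkhs_growth
begin

text \<open>For an automorphism \<open>g\<close> the unitary is the weighted composition with \<open>\<gamma> = g\<^sup>-\<^sup>1\<close>, so covariance is used for the
inverse: multiplication by a component of \<open>g\<close> becomes, after composition with \<open>\<gamma>\<close>, multiplication by a coordinate.\<close>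

lemma homogeneous_if_covariant:
  assumes cov: "\<And>s c1 a1 c2 a2. cmod c1 = 1 \<Longrightarrow> cmod a1 < 1 \<Longrightarrow> cmod c2 = 1 \<Longrightarrow> cmod a2 < 1 \<Longrightarrow>
    \<exists>J. (\<forall>z\<in>bidisc. invertible (J z)) \<and> (\<forall>z\<in>bidisc. \<forall>w\<in>bidisc.
      J z ** K (bimob s c1 a1 c2 a2 z) (bimob s c1 a1 c2 a2 w) ** adjm (J w) = K z w)"
  shows "homogeneous_pair H coord_mult_pair"
proof -
  have bo: "bounded_operator H (mult_op p)" if "p \<in> {fst, snd}" for p
  proof (rule mult_op_bounded)
    show "hnorm H (mult_op p f) \<le> (C * 2) * hnorm H f" if f: "f \<in> carr H" for f
      using growth(2)[OF \<open>p \<in> {fst, snd}\<close> f, of 1] by simp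
  qed (rule mult_coord[OF that])
  have "\<exists>A B. functional_calculus H coord_mult_pair (fst \<circ> g) A \<and>
      functional_calculus H coord_mult_pair (snd \<circ> g) B \<and> unitarily_equivalent H (A, B) coord_mult_pair"
    if g: "g \<in> aut_bidisc" for g
  proof -
    obtain s c1 a1 c2 a2 where ca: "cmod c1 = 1" "cmod a1 < 1" "cmod c2 = 1" "cmod a2 < 1"
      and gz: "\<And>z. z \<in> bidisc \<Longrightarrow> g z = bimob s c1 a1 c2 a2 z"
      by (rule aut_bidisc_bimob[OF g]) (rule that)
    obtain d1 b1 d2 b2 where db: "cmod d1 = 1" "cmod b1 < 1" "cmod d2 = 1" "cmod b2 < 1"
      and inv: "\<And>z. z \<in> bidisc \<Longrightarrow> bimob s c1 a1 c2 a2 (bimob s d1 b1 d2 b2 z) = z"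
        "\<And>z. z \<in> bidisc \<Longrightarrow> bimob s d1 b1 d2 b2 (bimob s c1 a1 c2 a2 z) = z"
      by (rule bimob_inverse[OF ca, of s]) (rule that)
    define \<gamma> where "\<gamma> = bimob s d1 b1 d2 b2"
    obtain J where J: "\<And>z. z \<in> bidisc \<Longrightarrow> invertible (J z)"
      "\<And>z w. z \<in> bidisc \<Longrightarrow> w \<in> bidisc \<Longrightarrow> J z ** K (\<gamma> z) (\<gamma> w) ** adjm (J w) = K z w"
      using cov[OF db, of s] unfolding \<gamma>_def by blast
    have \<gamma>b: "\<gamma> z \<in> bidisc" if "z \<in> bidisc" for z using bimob_in[OF db that] by (simp add: \<gamma>_def)
    have U: "unitary_operator H (wcomp J \<gamma>)"
      by (rule wcomp_unitary[of \<gamma> "bimob s c1 a1 c2 a2"])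
        (use J inv \<gamma>b bimob_in[OF ca] in \<open>auto simp: \<gamma>_def\<close>)
    have calc: "functional_calculus H coord_mult_pair h (mult_op h)"
      if "p \<in> {fst, snd}" "cmod a < 1" "\<And>z. z \<in> bidisc \<Longrightarrow> h z = mob c a (p z)" for h p c a
    proof -
      obtain b r where br: "r > 1" "summable (\<lambda>n. cmod (b n) * r ^ n)"
        "\<And>z. cmod z < 1 \<Longrightarrow> (\<lambda>n. b n * z ^ n) sums mob c a z"
        by (rule mob_power_series[OF \<open>cmod a < 1\<close>, of c]) (rule that)
      show ?thesis
      proof (rule functional_calculus_coord[OF that(1) br(1,2)])
        fix z :: "complex \<times> complex" assume z: "z \<in> bidisc"
        then have "cmod (p z) < 1" using that(1) by (auto simp: in_bidisc)
        then show "(\<lambda>n. b n * p z ^ n) sums h z" using br(3) that(3)[OF z] by simp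
      qed
    qed
    have 1: "functional_calculus H coord_mult_pair (fst \<circ> g) (mult_op (fst \<circ> g))"
      by (rule calc[of "if s then snd else fst" a1 _ c1]) (use ca gz in \<open>auto simp: bimob_def\<close>)
    have 2: "functional_calculus H coord_mult_pair (snd \<circ> g) (mult_op (snd \<circ> g))"
      by (rule calc[of "if s then fst else snd" a2 _ c2]) (use ca gz in \<open>auto simp: bimob_def\<close>)
    have g\<gamma>: "g (\<gamma> z) = z" if "z \<in> bidisc" for z
      using gz[OF \<gamma>b[OF that]] inv(1)[OF that] by (simp add: \<gamma>_def)
    have tw: "wcomp J \<gamma> (mult_op (p \<circ> g) x) = mult_op p (wcomp J \<gamma> x)" for p x
      by (rule ext) (auto simp: wcomp_def mult_op_def g\<gamma> vector_scalar_commute)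
    have "unitarily_equivalent H (mult_op (fst \<circ> g), mult_op (snd \<circ> g)) coord_mult_pair"
      unfolding unitarily_equivalent_def
      by (rule exI[of _ "wcomp J \<gamma>"]) (auto simp: U tw coord_mult_pair_def)
    then show ?thesis using 1 2 by blast
  qed
  then show ?thesis
    unfolding homogeneous_pair_def
    using hs separable bo spectrum
    by (auto simp: coord_mult_pair_def mult_op_mult mult.commute)
qed

text \<open>Closed subspaces invariant under both coordinate multiplications, in the form in which the smallest one containing
the constants is shown to be the whole space.\<close>

definition invariant_space :: "(complex \<times> complex \<Rightarrow> complex^'n) set \<Rightarrow> bool" where
  "invariant_space V \<longleftrightarrow> V \<subseteq> carr H \<and> 0 \<in> V \<and> (\<forall>x\<in>V. \<forall>y\<in>V. x + y \<in> V) \<and>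
     (\<forall>c. \<forall>x\<in>V. scl H c x \<in> V) \<and> (\<forall>x\<in>V. mult_op fst x \<in> V) \<and> (\<forall>x\<in>V. mult_op snd x \<in> V) \<and>
     (\<forall>s x. (\<forall>n::nat. s n \<in> V) \<longrightarrow> x \<in> carr H \<longrightarrow> (\<lambda>n. hnorm H (s n - x)) \<longlonglongrightarrow> 0 \<longrightarrow> x \<in> V)"

definition multipliers :: "(complex \<times> complex \<Rightarrow> complex^'n) set \<Rightarrow> (complex \<times> complex \<Rightarrow> complex) set" where
  "multipliers V = {h. \<forall>x\<in>V. mult_op h x \<in> V}"

lemma invariant_sum:
  assumes V: "invariant_space V" and u: "\<And>i. i \<in> I \<Longrightarrow> u i \<in> V"
  shows "sum u I \<in> V"
  using u by (induction I rule: infinite_finite_induct)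
    (use V in \<open>auto simp: invariant_space_def simp del: zero_fun_apply plus_fun_apply\<close>)

lemma multipliers_intros:
  assumes V: "invariant_space V"
  shows "fst \<in> multipliers V" "snd \<in> multipliers V" "(\<lambda>z. c) \<in> multipliers V"
    "g \<in> multipliers V \<Longrightarrow> h \<in> multipliers V \<Longrightarrow> (\<lambda>z. g z + h z) \<in> multipliers V"
    "g \<in> multipliers V \<Longrightarrow> h \<in> multipliers V \<Longrightarrow> (\<lambda>z. g z * h z) \<in> multipliers V"
proof -
  show "(\<lambda>z. c) \<in> multipliers V"
  proof -
    have "mult_op (\<lambda>z. c) x = scl H c x" for x by (simp add: mult_op_def scl_eq)
    then show ?thesis using V by (simp add: multipliers_def invariant_space_def)
  qed
  show "(\<lambda>z. g z + h z) \<in> multipliers V" if "g \<in> multipliers V" "h \<in> multipliers V"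
  proof -
    have "mult_op (\<lambda>z. g z + h z) x = mult_op g x + mult_op h x" for x :: "complex \<times> complex \<Rightarrow> complex^'n"
      by (auto simp: mult_op_def vector_sadd_rdistrib)
    then show ?thesis using V that by (simp add: multipliers_def invariant_space_def)
  qed
  show "(\<lambda>z. g z * h z) \<in> multipliers V" if "g \<in> multipliers V" "h \<in> multipliers V"
    using that by (simp add: multipliers_def mult_op_mult[symmetric])
qed (use V in \<open>auto simp: multipliers_def invariant_space_def\<close>)

lemma multipliers_cong:
  assumes V: "invariant_space V" and h: "h \<in> multipliers V" and eq: "\<And>z. z \<in> bidisc \<Longrightarrow> g z = h z"
  shows "g \<in> multipliers V"
  unfolding multipliers_def
proof (intro CollectI ballI)
  fix x assume x: "x \<in> V"
  then have xc: "x \<in> carr H" using V by (auto simp: invariant_space_def)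
  have "mult_op g x z = mult_op h x z" for z
    using eq off_bidisc[OF xc] by (cases "z \<in> bidisc") (simp_all add: mult_op_def)
  then have "mult_op g x = mult_op h x" by auto
  then show "mult_op g x \<in> V" using h x by (simp add: multipliers_def)
qed

lemma multipliers_power_series:
  assumes V: "invariant_space V" and p: "p \<in> {fst, snd}"
    and sm: "summable (\<lambda>n. cmod (c n) * (real n + 1))"
    and h: "\<And>z. z \<in> bidisc \<Longrightarrow> (\<lambda>n. c n * p z ^ n) sums h z"
  shows "h \<in> multipliers V"
  unfolding multipliers_def
proof (intro CollectI ballI)
  fix x assume x: "x \<in> V"
  have xc: "x \<in> carr H" using V x by (auto simp: invariant_space_def)
  define s where "s = (\<lambda>N. \<Sum>n<N. scl H (c n) (mult_op (\<lambda>z. p z ^ n) x))"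
  have pV: "mult_op (\<lambda>z. p z ^ n) x \<in> V" for n
  proof (induction n)
    case 0
    have "mult_op (\<lambda>z. p z ^ 0) x = x" by (simp add: mult_op_def)
    then show ?case using x by simp
  next
    case (Suc n)
    have "mult_op (\<lambda>z. p z ^ Suc n) x = mult_op p (mult_op (\<lambda>z. p z ^ n) x)"
      by (simp add: mult_op_mult)
    then show ?case using Suc V p by (auto simp: invariant_space_def)
  qed
  have sV: "s N \<in> V" for N
    unfolding s_def by (rule invariant_sum[OF V]) (use V pV in \<open>auto simp: invariant_space_def\<close>)
  have sc: "s N \<in> carr H" for N using sV V by (auto simp: invariant_space_def)
  have hx: "mult_op h x \<in> carr H" using power_series_calculus(1)[OF p sm h xc] by blast
  define A where "A = suminf (\<lambda>n. cmod (c n) * (real n + 1))"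
  have "(\<lambda>N. hnorm H (s N - mult_op h x)) \<longlonglongrightarrow> 0"
  proof (rule Lim_null_comparison)
    have "hnorm H (s N - mult_op h x) \<le> C * (A - (\<Sum>n<N. cmod (c n) * (real n + 1))) * hnorm H x" for N
      using power_series_calculus(2)[OF p sm h xc, of "{..<N}" N] hnorm_minus_commute[OF hx sc]
      by (simp add: s_def A_def)
    then show "\<forall>\<^sub>F N in sequentially. norm (hnorm H (s N - mult_op h x)) \<le>
        C * (A - (\<Sum>n<N. cmod (c n) * (real n + 1))) * hnorm H x"
      using sc hx by simp
    have "(\<lambda>N. C * (A - (\<Sum>n<N. cmod (c n) * (real n + 1))) * hnorm H x) \<longlonglongrightarrow> C * (A - A) * hnorm H x"
      unfolding A_def by (intro tendsto_intros summable_LIMSEQ sm)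
    then show "(\<lambda>N. C * (A - (\<Sum>n<N. cmod (c n) * (real n + 1))) * hnorm H x) \<longlonglongrightarrow> 0" by simp
  qed
  then show "mult_op h x \<in> V" using V sV hx unfolding invariant_space_def by blast
qed

text \<open>Constants generate the kernel functions: each component of a kernel function is a multiplier applied to a constant
basis vector.\<close>

lemma kfun_in_invariant:
  assumes V: "invariant_space V" and c: "\<And>i. const (axis i 1) \<in> V"
    and m: "\<And>i j. (\<lambda>z. K z w $ i $ j) \<in> multipliers V"
  shows "kfun w v \<in> V"
proof -
  have "kfun w v = (\<Sum>i\<in>UNIV. \<Sum>j\<in>UNIV. mult_op (\<lambda>z. K z w $ i $ j * v $ j) (const (axis i 1)))"
  proof
    fix z
    have "kfun w v z $ k = (\<Sum>i\<in>UNIV. \<Sum>j\<in>UNIV. mult_op (\<lambda>z. K z w $ i $ j * v $ j) (const (axis i 1))) z $ k" for k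
    proof (cases "z \<in> bidisc")
      case True
      have "(\<Sum>i\<in>UNIV. \<Sum>j\<in>UNIV. mult_op (\<lambda>z. K z w $ i $ j * v $ j) (const (axis i 1))) z $ k
          = (\<Sum>i\<in>UNIV. if i = k then (\<Sum>j\<in>UNIV. K z w $ k $ j * v $ j) else 0)"
      proof -
        have "(\<Sum>j\<in>UNIV. mult_op (\<lambda>z. K z w $ i $ j * v $ j) (const (axis i 1)) z $ k)
            = (if i = k then (\<Sum>j\<in>UNIV. K z w $ k $ j * v $ j) else 0)" for i
          using True by (cases "i = k") (simp_all add: mult_op_def const_def axis_def)
        then show ?thesis by (simp add: sum_apply)
      qed
      also have "\<dots> = kfun w v z $ k" using True by (simp add: kfun_def matrix_vector_mult_def)
      finally show ?thesis by simp
    next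
      case False
      then show ?thesis by (simp add: kfun_def sum_apply mult_op_def const_def)
    qed
    then show "kfun w v z = (\<Sum>i\<in>UNIV. \<Sum>j\<in>UNIV. mult_op (\<lambda>z. K z w $ i $ j * v $ j) (const (axis i 1))) z"
      by (simp add: vec_eq_iff)
  qed
  also have "\<dots> \<in> V"
  proof (intro invariant_sum[OF V])
    fix i j
    have "(\<lambda>z. K z w $ i $ j * v $ j) \<in> multipliers V"
      by (intro multipliers_intros(3,5)[OF V] m)
    then show "mult_op (\<lambda>z. K z w $ i $ j * v $ j) (const (axis i 1)) \<in> V"
      using c by (simp add: multipliers_def)
  qed
  finally show ?thesis .
qed

text \<open>The functional calculus turns homogeneity under the swap \<open>\<sigma>\<close> into a unitary \<open>U\<close> exchanging the coordinate
multiplications. The functions \<open>x\<close> with \<open>(U x)(w) = J(w) x(\<sigma> w)\<close> form an invariant space, where \<open>J\<close> is chosen such that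
it contains the constants, so this formula holds for all \<open>x\<close>. Consequently the preimage under \<open>U\<close> of the kernel function at
\<open>w\<close> with vector \<open>v\<close> is the one at \<open>\<sigma> w\<close> with vector \<open>J(w)\<^sup>* v\<close>, and applying \<open>U\<close> to it gives the identity.\<close>

lemma homogeneous_imp_swap_covariant:
  assumes hom: "homogeneous_pair H coord_mult_pair"
    and const: "\<And>i. const (axis i 1) \<in> carr H"
    and entries: "\<And>V w i j. invariant_space V \<Longrightarrow> w \<in> bidisc \<Longrightarrow> (\<lambda>z. K z w $ i $ j) \<in> multipliers V"
  obtains J where "\<And>z w. z \<in> bidisc \<Longrightarrow> w \<in> bidisc \<Longrightarrow>
    K z w = J z ** K (prod.swap z) (prod.swap w) ** adjm (J w)"
proof -
  obtain A B U where A: "functional_calculus H coord_mult_pair (fst \<circ> prod.swap) A"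
    and B: "functional_calculus H coord_mult_pair (snd \<circ> prod.swap) B"
    and U: "unitary_operator H U"
    and UA: "\<And>x. x \<in> carr H \<Longrightarrow> U (A x) = mult_op fst (U x)"
    and UB: "\<And>x. x \<in> carr H \<Longrightarrow> U (B x) = mult_op snd (U x)"
    using hom swap_aut unfolding homogeneous_pair_def unitarily_equivalent_def coord_mult_pair_def
    by (metis fst_conv snd_conv)
  have U1: "U (mult_op snd x) = mult_op fst (U x)" and U2: "U (mult_op fst x) = mult_op snd (U x)"
    if x: "x \<in> carr H" for x
    using functional_calculus_unique[OF A x] functional_calculus_unique[OF B x] UA[OF x] UB[OF x]
    by (simp_all add: o_def prod.swap_def)
  have Uc: "U x \<in> carr H" if "x \<in> carr H" for x
    using U that by (auto simp: unitary_operator_def linear_in_def)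
  have Uadd: "U (x + y) = U x + U y" if "x \<in> carr H" "y \<in> carr H" for x y
    using U that by (auto simp: unitary_operator_def linear_in_def)
  have Uscl: "U (scl H c x) = scl H c (U x)" if "x \<in> carr H" for c x
    using U that by (auto simp: unitary_operator_def linear_in_def)
  have Uip: "ip H (U x) (U y) = ip H x y" if "x \<in> carr H" "y \<in> carr H" for x y
    using U that by (auto simp: unitary_operator_def)
  have Usurj: "\<exists>x\<in>carr H. y = U x" if "y \<in> carr H" for y
    using U that unfolding unitary_operator_def bij_betw_def by blast
  have Udiff: "U (x - y) = U x - U y" if "x \<in> carr H" "y \<in> carr H" for x y
    using Uadd[of "x - y" y] that by simp
  have Unorm: "hnorm H (U x) = hnorm H x" if "x \<in> carr H" for x
    using Uip[OF that that] by (simp add: hnorm_def)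
  define J :: "complex \<times> complex \<Rightarrow> complex^'n^'n"
    where "J = (\<lambda>w. \<chi> j i. U (const (axis i 1)) w $ j)"
  define V where "V = {x \<in> carr H. \<forall>w\<in>bidisc. U x w = J w *v x (prod.swap w)}"
  have sw: "prod.swap w \<in> bidisc" if "w \<in> bidisc" for w :: "complex \<times> complex"
    using that by (simp add: in_bidisc)
  have V: "invariant_space V"
    unfolding invariant_space_def
  proof (intro conjI ballI allI impI)
    show "V \<subseteq> carr H" by (auto simp: V_def)
    have "U 0 = 0" using Udiff[of 0 0] by simp
    then show "0 \<in> V" by (simp add: V_def)
    show "x + y \<in> V" if "x \<in> V" "y \<in> V" for x y
      using that by (simp add: V_def Uadd matrix_vector_right_distrib)
    show "scl H c x \<in> V" if "x \<in> V" for c x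
      using that by (simp add: V_def Uscl) (simp add: scl_eq vector_scalar_commute)
    show "mult_op fst x \<in> V" if "x \<in> V" for x
      using that mult_coord[of fst x] by (simp add: V_def U2) (simp add: mult_op_def vector_scalar_commute)
    show "mult_op snd x \<in> V" if "x \<in> V" for x
      using that mult_coord[of snd x] by (simp add: V_def U1) (simp add: mult_op_def vector_scalar_commute)
    show "x \<in> V" if s: "\<forall>n::nat. s n \<in> V" and x: "x \<in> carr H" and lim: "(\<lambda>n. hnorm H (s n - x)) \<longlonglongrightarrow> 0" for s x
    proof -
      have sc: "s n \<in> carr H" for n using s by (auto simp: V_def)
      have "U x w $ i = (J w *v x (prod.swap w)) $ i" if w: "w \<in> bidisc" for w i
      proof (rule LIMSEQ_unique)
        have "(\<lambda>n. hnorm H (U (s n) - U x)) \<longlonglongrightarrow> 0"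
          using lim sc x by (simp add: Udiff[symmetric] Unorm)
        then show "(\<lambda>n. U (s n) w $ i) \<longlonglongrightarrow> U x w $ i"
          using tendsto_at[of "\<lambda>n. U (s n)" "U x" w i] sc x w Uc by blast
        have "(\<lambda>n. (\<Sum>j\<in>UNIV. J w $ i $ j * s n (prod.swap w) $ j)) \<longlonglongrightarrow>
            (\<Sum>j\<in>UNIV. J w $ i $ j * x (prod.swap w) $ j)"
          by (intro tendsto_intros tendsto_at sc x lim sw w)
        moreover have "U (s n) w $ i = (\<Sum>j\<in>UNIV. J w $ i $ j * s n (prod.swap w) $ j)" for n
          using s w by (simp add: V_def matrix_vector_mult_def)
        ultimately show "(\<lambda>n. U (s n) w $ i) \<longlonglongrightarrow> (J w *v x (prod.swap w)) $ i"
          by (simp add: matrix_vector_mult_def)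
      qed
      then show ?thesis using x by (simp add: V_def vec_eq_iff)
    qed
  qed
  have cV: "const (axis i 1) \<in> V" for i
  proof -
    have "U (const (axis i 1)) w = J w *v const (axis i 1) (prod.swap w)" if "w \<in> bidisc" for w
      using sw[OF that]
      by (simp add: const_def J_def vec_eq_iff mult_axis)
    then show ?thesis using const by (simp add: V_def)
  qed
  have kV: "kfun w v \<in> V" if "w \<in> bidisc" for w v
    by (rule kfun_in_invariant[OF V cV entries[OF V that]])
  have "V = carr H"
  proof (rule closed_subspace_full[OF _ _ kV])
    note V' = V[unfolded invariant_space_def]
    show "V \<subseteq> carr H" "0 \<in> V" using V' by blast+
    show "x + y \<in> V" if "x \<in> V" "y \<in> V" for x y using V' that by blast
    show "x \<in> V" if "\<And>n::nat. s n \<in> V" "x \<in> carr H" "(\<lambda>n. hnorm H (s n - x)) \<longlonglongrightarrow> 0" for s x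
      using V' that by blast
  qed
  then have Ux: "U x w = J w *v x (prod.swap w)" if "x \<in> carr H" "w \<in> bidisc" for x w
    using that by (auto simp: V_def)
  have "K z w = J z ** K (prod.swap z) (prod.swap w) ** adjm (J w)" if z: "z \<in> bidisc" and w: "w \<in> bidisc" for z w
  proof (rule matrix_eq[THEN iffD2], rule allI)
    fix v
    define y where "y = kfun (prod.swap w) (adjm (J w) *v v)"
    have y: "y \<in> carr H" using sw[OF w] by (simp add: y_def)
    have "U y - kfun w v = 0"
    proof (rule ip_self_eq0)
      show Uy: "U y - kfun w v \<in> carr H" using Uc[OF y] w by simp
      obtain x where x: "x \<in> carr H" "U y - kfun w v = U x" using Usurj[OF Uy] by blast
      have "ip H (U x) (U y) = ip H (U x) (kfun w v)"
        using x y w sw[OF w] by (simp add: Uip ip_kfun Uc Ux cdot_adjm) (simp add: y_def ip_kfun)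
      then show "ip H (U y - kfun w v) (U y - kfun w v) = 0"
        using x y w Uc by (metis (no_types, lifting) eq_iff_diff_eq_0 ip_diff_right kfun_carr)
    qed
    then have "U y z = kfun w v z" by simp
    then show "K z w *v v = (J z ** K (prod.swap z) (prod.swap w) ** adjm (J w)) *v v"
      using Ux[OF y z] z sw[OF z] by (simp add: y_def kfun_def matrix_vector_mul_assoc matrix_mul_assoc)
  qed
  then show thesis using that by blast
qed

end

section \<open>Power kernels in one variable\<close>

definition pow_ker :: "real \<Rightarrow> complex \<Rightarrow> complex \<Rightarrow> complex" where
  "pow_ker s z w = (1 - z * cnj w) powr of_real (- s)"

text \<open>The coefficient of \<open>t\<^sup>n\<close> in \<open>(1 - t)\<^sup>-\<^sup>s\<close>.\<close>

definition pow_coeff :: "real \<Rightarrow> nat \<Rightarrow> real" where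
  "pow_coeff s n = pochhammer s n / fact n"

lemma zw_less: "cmod z < 1 \<Longrightarrow> cmod w < 1 \<Longrightarrow> cmod (z * cnj w) < 1"
  using mult_strict_mono[of "cmod z" 1 "cmod w" 1] by (simp add: norm_mult)

lemma one_minus_zw_nz: "cmod z < 1 \<Longrightarrow> cmod w < 1 \<Longrightarrow> 1 - z * cnj w \<noteq> 0"
  using zw_less[of z w] by auto

lemma pow_ker_step:
  assumes "cmod z < 1" "cmod w < 1"
  shows "pow_ker s z w = (1 - z * cnj w) * pow_ker (s + 1) z w"
proof -
  have "(1 - z * cnj w) powr of_real (- s) = (1 - z * cnj w) powr (1 + of_real (- (s + 1)))" by simp
  also have "\<dots> = (1 - z * cnj w) powr 1 * (1 - z * cnj w) powr of_real (- (s + 1))"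
    by (rule powr_add)
  finally show ?thesis using one_minus_zw_nz[OF assms] by (simp add: pow_ker_def)
qed

lemma pow_coeff_pos: "s > 0 \<Longrightarrow> pow_coeff s n > 0"
  by (simp add: pow_coeff_def pochhammer_pos)

lemma pow_coeff_0 [simp]: "pow_coeff s 0 = 1"
  by (simp add: pow_coeff_def)

lemma pow_coeff_Suc: "real (Suc n) * pow_coeff s (Suc n) = (s + real n) * pow_coeff s n"
  by (simp add: pow_coeff_def pochhammer_rec' divide_simps)

lemma pow_coeff_shift: "s * pow_coeff (s + 1) n = real (Suc n) * pow_coeff s (Suc n)"
  by (simp add: pow_coeff_def pochhammer_rec divide_simps)

lemma pow_coeff_sums:
  assumes "cmod t < 1"
  shows "(\<lambda>n. of_real (pow_coeff s n) * t ^ n) sums (1 - t) powr of_real (- s)"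
proof -
  have "(\<lambda>n. (of_real (- s) gchoose n) * (- t) ^ n) sums (1 + - t) powr of_real (- s)"
    by (rule gen_binomial_complex) (use assms in simp)
  moreover have "(of_real (- s) gchoose n) * (- t) ^ n = of_real (pow_coeff s n) * t ^ n" for n
  proof -
    have "(complex_of_real (- s) gchoose n) = (-1) ^ n * of_real (pow_coeff s n)"
      by (simp add: gbinomial_pochhammer pow_coeff_def pochhammer_of_real)
    moreover have "(- t) ^ n = (-1) ^ n * t ^ n" by (rule power_minus)
    ultimately show ?thesis by (simp add: mult_ac power_mult_distrib[symmetric])
  qed
  ultimately show ?thesis by simp
qed

lemma pow_ker_sums:
  assumes "cmod z < 1" "cmod w < 1"
  shows "(\<lambda>n. of_real (pow_coeff s n) * (z * cnj w) ^ n) sums pow_ker s z w"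
  unfolding pow_ker_def by (rule pow_coeff_sums) (rule zw_less[OF assms])

text \<open>An orthonormal basis of the space with kernel \<open>pow_ker s\<close>, and, in \<open>dmon\<close>, its image under \<open>f \<mapsto> f' / s\<close>. In
\<open>dmon s 0\<close> the factor \<open>n / s\<close> vanishes, so the truncated exponent \<open>n - 1\<close> does no harm.\<close>

definition emon :: "real \<Rightarrow> nat \<Rightarrow> complex \<Rightarrow> complex" where
  "emon s n z = of_real (sqrt (pow_coeff s n)) * z ^ n"

definition dmon :: "real \<Rightarrow> nat \<Rightarrow> complex \<Rightarrow> complex" where
  "dmon s n z = of_real (sqrt (pow_coeff s n)) * of_real (real n / s) * z ^ (n - 1)"

context
  fixes s :: real and z w :: complex
  assumes s: "s > 0" and z: "cmod z < 1" and w: "cmod w < 1"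
begin

lemma sqrt_pc: "complex_of_real (sqrt (pow_coeff s n)) * complex_of_real (sqrt (pow_coeff s n)) = of_real (pow_coeff s n)"
  using pow_coeff_pos[OF s, of n] by (simp flip: of_real_mult)

lemma lim_ee: "(\<lambda>N. \<Sum>n<N. emon s n z * cnj (emon s n w)) \<longlonglongrightarrow> pow_ker s z w"
proof -
  have "emon s n z * cnj (emon s n w) = of_real (pow_coeff s n) * (z * cnj w) ^ n" for n
    unfolding sqrt_pc[symmetric] by (simp add: emon_def power_mult_distrib mult_ac)
  then show ?thesis using pow_ker_sums[OF z w, of s] by (simp add: sums_def)
qed

lemma pow_coeff_ratio: "pow_coeff s (Suc n) * (real (Suc n) / s) = pow_coeff (s + 1) n"
  using pow_coeff_shift[of s n] s by (simp add: field_simps)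

text \<open>The mixed sums are the derivatives of \<open>pow_ker s\<close> in \<open>z\<close> and \<open>\<bar>w\<close>, divided by \<open>s\<close> for each derivative. They are
obtained from the binomial series with exponents \<open>s + 1\<close> and \<open>s + 2\<close> by comparing coefficients.\<close>

lemma lim_ed: "(\<lambda>N. \<Sum>n<N. emon s n z * cnj (dmon s n w)) \<longlonglongrightarrow> z * pow_ker (s + 1) z w"
proof -
  have t: "emon s (Suc n) z * cnj (dmon s (Suc n) w) = z * (of_real (pow_coeff (s + 1) n) * (z * cnj w) ^ n)" for n
    unfolding pow_coeff_ratio[symmetric] of_real_mult sqrt_pc[symmetric]
    by (simp add: emon_def dmon_def power_mult_distrib mult_ac)
  have "(\<lambda>n. emon s (Suc n) z * cnj (dmon s (Suc n) w)) sums (z * pow_ker (s + 1) z w)"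
    unfolding t by (intro sums_mult pow_ker_sums z w)
  from sums_Suc[OF this] show ?thesis by (simp add: sums_def dmon_def)
qed

lemma lim_de: "(\<lambda>N. \<Sum>n<N. dmon s n z * cnj (emon s n w)) \<longlonglongrightarrow> cnj w * pow_ker (s + 1) z w"
proof -
  have t: "dmon s (Suc n) z * cnj (emon s (Suc n) w) = cnj w * (of_real (pow_coeff (s + 1) n) * (z * cnj w) ^ n)" for n
    unfolding pow_coeff_ratio[symmetric] of_real_mult sqrt_pc[symmetric]
    by (simp add: emon_def dmon_def power_mult_distrib mult_ac)
  have "(\<lambda>n. dmon s (Suc n) z * cnj (emon s (Suc n) w)) sums (cnj w * pow_ker (s + 1) z w)"
    unfolding t by (intro sums_mult pow_ker_sums z w)
  from sums_Suc[OF this] show ?thesis by (simp add: sums_def dmon_def)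
qed

lemma lim_dd: "(\<lambda>N. \<Sum>n<N. dmon s n z * cnj (dmon s n w)) \<longlonglongrightarrow> (of_real (1 / s) + z * cnj w) * pow_ker (s + 2) z w"
proof -
  have c: "pow_coeff s (Suc n) * (real (Suc n) / s)\<^sup>2 = (1 + 1 / s) * pow_coeff (s + 2) n - pow_coeff (s + 1) n" for n
  proof -
    have "(s + 1) * pow_coeff (s + 2) n = real (Suc n) * pow_coeff (s + 1) (Suc n)"
      using pow_coeff_shift[of "s + 1" n] by (simp add: add.commute)
    also have "\<dots> = (s + 1 + real n) * pow_coeff (s + 1) n" by (rule pow_coeff_Suc)
    finally have 1: "(1 + 1 / s) * pow_coeff (s + 2) n = (s + 1 + real n) * pow_coeff (s + 1) n / s"
      using s by (simp add: field_simps)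
    have "pow_coeff s (Suc n) * (real (Suc n) / s)\<^sup>2 = pow_coeff (s + 1) n * (real (Suc n) / s)"
      unfolding pow_coeff_ratio[symmetric] by (simp add: power2_eq_square)
    then show ?thesis unfolding 1 using s by (simp add: field_simps)
  qed
  have t: "dmon s (Suc n) z * cnj (dmon s (Suc n) w) =
      of_real (1 + 1 / s) * (of_real (pow_coeff (s + 2) n) * (z * cnj w) ^ n) - of_real (pow_coeff (s + 1) n) * (z * cnj w) ^ n" for n
  proof -
    have "dmon s (Suc n) z * cnj (dmon s (Suc n) w) = of_real (pow_coeff s (Suc n) * (real (Suc n) / s)\<^sup>2) * (z * cnj w) ^ n"
      unfolding of_real_mult sqrt_pc[symmetric]
      by (simp add: dmon_def power_mult_distrib power2_eq_square mult_ac)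
    then show ?thesis unfolding c by (simp add: algebra_simps)
  qed
  have "(\<lambda>n. dmon s (Suc n) z * cnj (dmon s (Suc n) w)) sums
      (of_real (1 + 1 / s) * pow_ker (s + 2) z w - pow_ker (s + 1) z w)"
    unfolding t by (intro sums_diff sums_mult pow_ker_sums z w)
  moreover have "of_real (1 + 1 / s) * pow_ker (s + 2) z w - pow_ker (s + 1) z w = (of_real (1 / s) + z * cnj w) * pow_ker (s + 2) z w"
    using pow_ker_step[OF z w, of "s + 1"] by (simp add: algebra_simps)
  ultimately have "(\<lambda>n. dmon s (Suc n) z * cnj (dmon s (Suc n) w)) sums ((of_real (1 / s) + z * cnj w) * pow_ker (s + 2) z w)"
    by simp
  from sums_Suc[OF this] show ?thesis by (simp add: sums_def dmon_def)
qed

end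

subsection \<open>Growth of the coefficients\<close>

text \<open>The matrix entries of multiplication by \<open>z\<^sup>m\<close> in these vectors; \<open>dmon_defect\<close> comes from the derivative that
falls on \<open>z\<^sup>m\<close>.\<close>

definition emon_ratio :: "real \<Rightarrow> nat \<Rightarrow> nat \<Rightarrow> real" where
  "emon_ratio s n m = sqrt (pow_coeff s n) / sqrt (pow_coeff s (n + m))"

definition dmon_defect :: "real \<Rightarrow> nat \<Rightarrow> nat \<Rightarrow> real" where
  "dmon_defect s n m = real m / s * sqrt (pow_coeff s n) / sqrt (pow_coeff (s + 2) (n + m - 1))"

text \<open>The sequence \<open>n \<mapsto> n pow_coeff s n\<close> is nondecreasing for every \<open>s > 0\<close>, which bounds the ratio of
coefficients at \<open>n > 0\<close> by \<open>m + 1\<close>; the first coefficient is compared with the second.\<close>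

lemma pow_coeff_growth:
  assumes s: "s > 0"
  shows "pow_coeff s n \<le> (1 + 1 / s) * (real m + 1) * pow_coeff s (n + m)"
proof -
  have mono: "real k * pow_coeff s k \<le> real (k + j) * pow_coeff s (k + j)" for k j
  proof (induction j)
    case (Suc j)
    have "real (k + j) * pow_coeff s (k + j) \<le> (s + real (k + j)) * pow_coeff s (k + j)"
      using s pow_coeff_pos[OF s] by (intro mult_right_mono) (auto intro: less_imp_le)
    then show ?case using Suc pow_coeff_Suc[of "k + j" s] by simp
  qed simp
  have s1: "1 \<le> 1 + 1 / s" using s by simp
  show ?thesis
  proof (cases "n = 0")
    case False
    have "real (n + m) \<le> (real m + 1) * real n" using False
      by (cases n) (simp_all add: algebra_simps)
    then have "real (n + m) * pow_coeff s (n + m) \<le> (real m + 1) * real n * pow_coeff s (n + m)"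
      using pow_coeff_pos[OF s, of "n + m"] by (intro mult_right_mono) auto
    with mono[of n m] have "real n * pow_coeff s n \<le> (real m + 1) * real n * pow_coeff s (n + m)" by (rule order_trans)
    then have "pow_coeff s n \<le> (real m + 1) * pow_coeff s (n + m)" using False
      by (simp add: mult.assoc mult.left_commute[of _ "real n"])
    also have "\<dots> \<le> (1 + 1 / s) * ((real m + 1) * pow_coeff s (n + m))"
      using mult_right_mono[OF s1, of "(real m + 1) * pow_coeff s (n + m)"] pow_coeff_pos[OF s, of "n + m"] by simp
    finally show ?thesis by (simp add: mult_ac)
  next
    case n: True
    show ?thesis
    proof (cases "m = 0")
      case True
      then show ?thesis using n s by simp
    next
      case False
      have "s \<le> real m * pow_coeff s m"
        using mono[of 1 "m - 1"] pow_coeff_Suc[of 0 s] False by simp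
      then have "1 \<le> 1 / s * (real m * pow_coeff s m)" using s by (simp add: field_simps)
      also have "\<dots> \<le> (1 + 1 / s) * ((real m + 1) * pow_coeff s m)"
        using s pow_coeff_pos[OF s, of m] by (intro mult_mono) auto
      finally show ?thesis using n by (simp add: mult_ac)
    qed
  qed
qed

lemma le_square_bound: "(x::real)\<^sup>2 \<le> b\<^sup>2 * c \<Longrightarrow> 0 \<le> b \<Longrightarrow> 1 \<le> c \<Longrightarrow> x \<le> b * c"
proof -
  assume a: "x\<^sup>2 \<le> b\<^sup>2 * c" "0 \<le> b" "1 \<le> c"
  have "b\<^sup>2 * c \<le> b\<^sup>2 * c\<^sup>2" using a(3) by (intro mult_left_mono) (auto simp: power2_eq_square)
  then have "x\<^sup>2 \<le> (b * c)\<^sup>2" using a by (simp add: power_mult_distrib)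
  then show "x \<le> b * c" by (rule power2_le_imp_le) (use a in simp)
qed

lemma emon_ratio_bound:
  assumes s: "s > 0"
  shows "0 \<le> emon_ratio s n m" "emon_ratio s n m \<le> (1 + 1 / s) * (real m + 1)"
proof -
  show "0 \<le> emon_ratio s n m" using pow_coeff_pos[OF s] by (simp add: emon_ratio_def less_imp_le)
  show "emon_ratio s n m \<le> (1 + 1 / s) * (real m + 1)"
  proof (rule le_square_bound)
    have "(emon_ratio s n m)\<^sup>2 = pow_coeff s n / pow_coeff s (n + m)"
      using pow_coeff_pos[OF s, of n] pow_coeff_pos[OF s, of "n + m"] by (simp add: emon_ratio_def power_divide)
    also have "\<dots> \<le> (1 + 1 / s) * (real m + 1)"
      using pow_coeff_growth[OF s, of n m] pow_coeff_pos[OF s, of "n + m"] by (simp add: divide_le_eq)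
    also have "\<dots> \<le> (1 + 1 / s)\<^sup>2 * (real m + 1)"
      using s mult_left_mono[of 1 "1 + 1 / s" "1 + 1 / s"]
      by (intro mult_right_mono) (auto simp: power2_eq_square)
    finally show "(emon_ratio s n m)\<^sup>2 \<le> (1 + 1 / s)\<^sup>2 * (real m + 1)" .
  qed (use s in auto)
qed

lemma dmon_defect_bound:
  assumes s: "s > 0"
  shows "0 \<le> dmon_defect s n m" "dmon_defect s n m \<le> (1 + 1 / s) * (real m + 1)"
proof -
  have s2: "s + 2 > 0" using s by simp
  show "0 \<le> dmon_defect s n m" using pow_coeff_pos[OF s] pow_coeff_pos[OF s2] s by (simp add: dmon_defect_def less_imp_le)
  show "dmon_defect s n m \<le> (1 + 1 / s) * (real m + 1)"
  proof (cases "m = 0")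
    case True
    then show ?thesis using s by (simp add: dmon_defect_def)
  next
    case False
    then obtain k where k: "n + m = Suc k" by (metis add_eq_0_iff_both_eq_0 not0_implies_Suc)
    define N where "N = real (Suc k)"
    have mN: "real m \<le> N" using k by (simp add: N_def)
    have N: "N > 0" by (simp add: N_def)
    have "(s + 1) * pow_coeff (s + 2) k = N * pow_coeff (s + 1) (Suc k)"
      using pow_coeff_shift[of "s + 1" k] by (simp add: N_def add.commute)
    also have "\<dots> = (s + 1 + real k) * pow_coeff (s + 1) k" using pow_coeff_Suc[of k "s + 1"] by (simp add: N_def)
    finally have "s * (s + 1) * pow_coeff (s + 2) k = (s + 1 + real k) * (s * pow_coeff (s + 1) k)" by simp
    then have 1: "s * (s + 1) * pow_coeff (s + 2) k = (s + N) * (N * pow_coeff s (Suc k))"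
      unfolding pow_coeff_shift by (simp add: N_def add.assoc)
    define P where "P = pow_coeff s (Suc k)"
    define Q where "Q = pow_coeff (s + 2) k"
    have P: "P > 0" and Q: "Q > 0" using pow_coeff_pos[OF s] pow_coeff_pos[OF s2] by (auto simp: P_def Q_def)
    have g: "pow_coeff s n \<le> (1 + 1 / s) * (real m + 1) * P"
      using pow_coeff_growth[OF s, of n m] k by (simp add: P_def)
    have PQ: "(real m)\<^sup>2 * P \<le> s * (s + 1) * Q"
    proof -
      have "(real m)\<^sup>2 \<le> N\<^sup>2" using mN by (intro power_mono) auto
      also have "\<dots> \<le> (s + N) * N" using s N by (simp add: power2_eq_square)
      finally have "(real m)\<^sup>2 * P \<le> (s + N) * N * P" using P by (intro mult_right_mono) auto
      also have "\<dots> = s * (s + 1) * Q" using 1 by (simp add: P_def Q_def mult_ac)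
      finally show ?thesis .
    qed
    show ?thesis
    proof (rule le_square_bound)
      have "(dmon_defect s n m)\<^sup>2 = (real m)\<^sup>2 * pow_coeff s n / (s\<^sup>2 * Q)"
        using pow_coeff_pos[OF s, of n] Q k by (simp add: dmon_defect_def power_divide power_mult_distrib Q_def)
      also have "\<dots> \<le> (real m)\<^sup>2 * ((1 + 1 / s) * (real m + 1) * P) / (s\<^sup>2 * Q)"
        using g Q s by (intro divide_right_mono mult_left_mono) auto
      also have "\<dots> = ((1 + 1 / s) * (real m + 1) / (s\<^sup>2 * Q)) * ((real m)\<^sup>2 * P)" by (simp add: mult_ac)
      also have "\<dots> \<le> ((1 + 1 / s) * (real m + 1) / (s\<^sup>2 * Q)) * (s * (s + 1) * Q)"
        using PQ s Q by (intro mult_left_mono) auto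
      also have "\<dots> = (1 + 1 / s)\<^sup>2 * (real m + 1)"
        using s Q by (simp add: power2_eq_square divide_simps)
      finally show "(dmon_defect s n m)\<^sup>2 \<le> (1 + 1 / s)\<^sup>2 * (real m + 1)" .
    qed (use s in auto)
  qed
qed

lemma emon_shift:
  assumes s: "s > 0"
  shows "z ^ m * emon s n z = of_real (emon_ratio s n m) * emon s (n + m) z"
  using pow_coeff_pos[OF s, of "n + m"] by (simp add: emon_def emon_ratio_def power_add)

text \<open>Multiplication by \<open>z\<^sup>m\<close> does not commute with differentiation. The commutator applied to a monomial is again a
monomial, expressed here in the basis of the space with exponent \<open>s + 2\<close>, where its coefficient grows at most
linearly in \<open>m\<close> (\<open>dmon_defect_bound\<close>).\<close>

lemma dmon_shift:
  assumes s: "s > 0" and m: "m > 0"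
  shows "z ^ m * dmon s n z = of_real (emon_ratio s n m) * dmon s (n + m) z - of_real (dmon_defect s n m) * emon (s + 2) (n + m - 1) z"
proof -
  have s2: "s + 2 > 0" using s by simp
  have "of_real (emon_ratio s n m) * dmon s (n + m) z = of_real (sqrt (pow_coeff s n)) * of_real (real (n + m) / s) * z ^ (n + m - 1)"
    using pow_coeff_pos[OF s, of "n + m"] by (simp add: dmon_def emon_ratio_def)
  moreover have "of_real (dmon_defect s n m) * emon (s + 2) (n + m - 1) z
      = of_real (sqrt (pow_coeff s n)) * of_real (real m / s) * z ^ (n + m - 1)"
    using pow_coeff_pos[OF s2, of "n + m - 1"] by (simp add: emon_def dmon_defect_def)
  moreover have "z ^ m * dmon s n z = of_real (sqrt (pow_coeff s n)) * of_real (real n / s) * z ^ (n + m - 1)"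
  proof (cases n)
    case (Suc k)
    then show ?thesis by (simp add: dmon_def power_add mult_ac)
  qed (simp add: dmon_def)
  ultimately show ?thesis by (simp add: add_divide_distrib algebra_simps)
qed

section \<open>Sums of jet kernels\<close>

definition jet :: "bool \<Rightarrow> real \<Rightarrow> nat \<Rightarrow> complex \<Rightarrow> complex" where
  "jet b s n z = (if b then dmon s n z else emon s n z)"

text \<open>The kernel \<open>pow_ker s\<close> after applying \<open>\<partial>\<^sub>z / s\<close> if the first flag is set and \<open>\<partial>\<^bsub>\<bar>w\<^esub> / s\<close> if the second one is.\<close>

definition jetk :: "bool \<Rightarrow> bool \<Rightarrow> real \<Rightarrow> complex \<Rightarrow> complex \<Rightarrow> complex" where
  "jetk b b' s z w =
     (if b then if b' then (of_real (1 / s) + z * cnj w) * pow_ker (s + 2) z w else cnj w * pow_ker (s + 1) z w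
      else if b' then z * pow_ker (s + 1) z w else pow_ker s z w)"

lemma lim_jet:
  assumes "s > 0" "cmod z < 1" "cmod w < 1"
  shows "(\<lambda>N. \<Sum>n<N. jet b s n z * cnj (jet b' s n w)) \<longlonglongrightarrow> jetk b b' s z w"
  using lim_ee[OF assms] lim_ed[OF assms] lim_de[OF assms] lim_dd[OF assms]
  by (cases b; cases b') (simp_all add: jet_def jetk_def)

text \<open>A sum of three tensor products of one-variable jet kernels. In the \<open>k\<close>-th summand the entry \<open>(i, j)\<close> is weighted by
\<open>c k i\<close> and \<open>c k j\<close>; the flags \<open>p k i\<close> and \<open>q k i\<close> tell whether component \<open>i\<close> carries a derivative in the first and in
the second variable, whose exponents are \<open>s k\<close> and \<open>t k\<close>. The variables are parameters so that their roles can be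
exchanged.\<close>

definition jet_sum :: "(complex \<times> complex \<Rightarrow> complex) \<Rightarrow> (complex \<times> complex \<Rightarrow> complex) \<Rightarrow> (nat \<Rightarrow> 'n \<Rightarrow> real) \<Rightarrow> (nat \<Rightarrow> 'n \<Rightarrow> bool) \<Rightarrow> (nat \<Rightarrow> real) \<Rightarrow> (nat \<Rightarrow> 'n \<Rightarrow> bool)
    \<Rightarrow> (nat \<Rightarrow> real) \<Rightarrow> complex \<times> complex \<Rightarrow> complex \<times> complex \<Rightarrow> 'n \<Rightarrow> 'n \<Rightarrow> complex" where
  "jet_sum \<xi> \<eta> c p s q t z w i j = (\<Sum>k<3. of_real (c k i) * of_real (c k j) *
     (jetk (p k i) (p k j) (s k) (\<xi> z) (\<xi> w) * jetk (q k i) (q k j) (t k) (\<eta> z) (\<eta> w)))"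

definition jet_vec :: "(complex \<times> complex \<Rightarrow> complex) \<Rightarrow> (complex \<times> complex \<Rightarrow> complex) \<Rightarrow> (nat \<Rightarrow> 'n \<Rightarrow> real) \<Rightarrow> (nat \<Rightarrow> 'n \<Rightarrow> bool) \<Rightarrow> (nat \<Rightarrow> real) \<Rightarrow> (nat \<Rightarrow> 'n \<Rightarrow> bool)
    \<Rightarrow> (nat \<Rightarrow> real) \<Rightarrow> nat \<times> nat \<times> nat \<Rightarrow> complex \<times> complex \<Rightarrow> complex^'n" where
  "jet_vec \<xi> \<eta> c p s q t = (\<lambda>(k, a, b) z.
     \<chi> i. of_real (c k i) * (jet (p k i) (s k) a (\<xi> z) * jet (q k i) (t k) b (\<eta> z)))"

lemma jet_vec_lim:
  assumes \<xi>: "\<xi> \<in> {fst, snd}" and \<eta>: "\<eta> \<in> {fst, snd}"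
    and st: "\<And>k. s k > 0" "\<And>k. t k > 0" and z: "z \<in> bidisc" and w: "w \<in> bidisc"
  shows "(\<lambda>N. \<Sum>\<kappa>\<in>{..<3} \<times> {..<N} \<times> {..<N}. jet_vec \<xi> \<eta> c p s q t \<kappa> z $ i * cnj (jet_vec \<xi> \<eta> c p s q t \<kappa> w $ j))
    \<longlonglongrightarrow> jet_sum \<xi> \<eta> c p s q t z w i j"
proof -
  have zw: "cmod (\<xi> z) < 1" "cmod (\<eta> z) < 1" "cmod (\<xi> w) < 1" "cmod (\<eta> w) < 1"
    using z w \<xi> \<eta> by (auto simp: in_bidisc)
  have eq: "(\<Sum>\<kappa>\<in>{..<3} \<times> {..<N} \<times> {..<N}. jet_vec \<xi> \<eta> c p s q t \<kappa> z $ i * cnj (jet_vec \<xi> \<eta> c p s q t \<kappa> w $ j))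
    = (\<Sum>k<3. of_real (c k i) * of_real (c k j) *
       ((\<Sum>a<N. jet (p k i) (s k) a (\<xi> z) * cnj (jet (p k j) (s k) a (\<xi> w))) *
        (\<Sum>b<N. jet (q k i) (t k) b (\<eta> z) * cnj (jet (q k j) (t k) b (\<eta> w)))))" for N
    unfolding sum.cartesian_product' jet_vec_def
    unfolding sum_product unfolding sum_distrib_left
    by (intro sum.cong refl) (simp add: mult_ac)
  show ?thesis unfolding eq jet_sum_def
    by (intro tendsto_intros lim_jet st zw)
qed

text \<open>The features are the jets of products of monomials. By \<open>dmon_shift\<close>, multiplication by a power of the first variable maps
a feature of summand \<open>k\<close> to a multiple of a shifted one plus an error in the components carrying a derivative in this
variable. The error is a feature of the summand \<open>\<pi> k\<close>, which must have the first exponent raised by two and the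
same data otherwise; \<open>\<rho> k\<close> is the ratio of the weights. The exponent \<open>m = 0\<close> is treated apart because the shift of the
error by \<open>m - 1\<close> is then not injective.\<close>

lemma (in rkhs) jet_sum_growth:
  assumes \<xi>: "\<xi> \<in> {fst, snd}" and \<eta>: "\<eta> \<in> {fst, snd}"
    and K: "\<And>z w i j. z \<in> bidisc \<Longrightarrow> w \<in> bidisc \<Longrightarrow> K z w $ i $ j = jet_sum \<xi> \<eta> c p s q t z w i j"
    and st: "\<And>k. s k > 0" "\<And>k. t k > 0"
    and \<pi>: "bij_betw \<pi> {..<3} {..<3::nat}"
    and jets: "\<And>k i. k < 3 \<Longrightarrow> p k i \<Longrightarrow> \<rho> k * c (\<pi> k) i = c k i \<and> \<not> p (\<pi> k) i \<and>
      s (\<pi> k) = s k + 2 \<and> t (\<pi> k) = t k \<and> q (\<pi> k) i = q k i"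
    and nojets: "\<And>k i. k < 3 \<Longrightarrow> \<not> p k i \<Longrightarrow> \<rho> k * c (\<pi> k) i = 0"
  shows "\<exists>C\<ge>0. \<forall>m f. f \<in> carr H \<longrightarrow> mult_op (\<lambda>z. \<xi> z ^ m) f \<in> carr H \<and>
    hnorm H (mult_op (\<lambda>z. \<xi> z ^ m) f) \<le> C * (real m + 1) * hnorm H f"
proof -
  define D where "D = (\<Sum>k<3. (1 + 1 / s k) * (1 + \<bar>\<rho> k\<bar>))"
  have Dk: "(1 + 1 / s k) * (1 + \<bar>\<rho> k\<bar>) \<le> D" if "k < 3" for k
    unfolding D_def using st(1) that
    by (intro member_le_sum) (auto intro!: mult_nonneg_nonneg add_nonneg_nonneg simp: less_imp_le)
  have Dk1: "1 + 1 / s k \<le> D" "(1 + 1 / s k) * \<bar>\<rho> k\<bar> \<le> D" if "k < 3" for k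
    using Dk[OF that] st(1)[of k] by (auto simp: distrib_left intro: order_trans[rotated])
  have D1: "1 \<le> D" using Dk1(1)[of 0] st(1)[of 0] by (smt (verit) divide_pos_pos numeral_3_eq_3 zero_less_Suc)
  have main: "mult_op (\<lambda>z. \<xi> z ^ m) f \<in> carr H \<and>
      hnorm H (mult_op (\<lambda>z. \<xi> z ^ m) f) \<le> 2 * D * (real m + 1) * hnorm H f" if f: "f \<in> carr H" for m f
  proof (cases "m = 0")
    case True
    have "hnorm H f \<le> 2 * D * hnorm H f"
      using mult_right_mono[of 1 "2 * D" "hnorm H f"] D1 f by simp
    then show ?thesis using f True by (simp add: mult_op_def)
  next
    case m: False
    define B where "B = D * (real m + 1)"
    define P where "P = (\<lambda>(k, a, b). (k, a + m, b) :: nat \<times> nat \<times> nat)"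
    define Q where "Q = (\<lambda>(k, a, b). (\<pi> k, a + m - 1, b) :: nat \<times> nat \<times> nat)"
    define x where "x = (\<lambda>(k, a, b :: nat). complex_of_real (emon_ratio (s k) a m))"
    define y where "y = (\<lambda>(k, a, b :: nat). complex_of_real (- (\<rho> k * dmon_defect (s k) a m)))"
    define box where "box = (\<lambda>N::nat. {..<3::nat} \<times> {..<N} \<times> {..<N})"
    have "mult_op (\<lambda>z. \<xi> z ^ m) f \<in> carr H \<and> hnorm H (mult_op (\<lambda>z. \<xi> z ^ m) f) \<le> 2 * B * hnorm H f"
    proof (rule feature_bound[where \<phi> = "jet_vec \<xi> \<eta> c p s q t" and box = box and p = P and q = Q
          and x = x and y = y and m = m and B = B and h = "\<lambda>z. \<xi> z ^ m", rotated -1, OF f])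
      show "finite (box N)" for N by (simp add: box_def)
      show "(\<lambda>N. \<Sum>\<kappa>\<in>box N. jet_vec \<xi> \<eta> c p s q t \<kappa> z $ i * cnj (jet_vec \<xi> \<eta> c p s q t \<kappa> w $ j)) \<longlonglongrightarrow> K z w $ i $ j"
        if "z \<in> bidisc" "w \<in> bidisc" for z w i j
        unfolding box_def K[OF that] by (rule jet_vec_lim[OF \<xi> \<eta> st that])
      show "\<xi> z ^ m *s jet_vec \<xi> \<eta> c p s q t \<kappa> z =
          x \<kappa> *s jet_vec \<xi> \<eta> c p s q t (P \<kappa>) z + y \<kappa> *s jet_vec \<xi> \<eta> c p s q t (Q \<kappa>) z"
        if \<kappa>: "\<kappa> \<in> box N" for N \<kappa> z
      proof -
        obtain k a b where k: "\<kappa> = (k, a, b)" by (metis prod_cases3)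
        have k3: "k < 3" using \<kappa> k by (simp add: box_def)
        have "\<xi> z ^ m * (of_real (c k i) * (jet (p k i) (s k) a (\<xi> z) * jet (q k i) (t k) b (\<eta> z)))
           = of_real (emon_ratio (s k) a m) * (of_real (c k i) * (jet (p k i) (s k) (a + m) (\<xi> z) * jet (q k i) (t k) b (\<eta> z)))
           + of_real (- (\<rho> k * dmon_defect (s k) a m)) * (of_real (c (\<pi> k) i) *
               (jet (p (\<pi> k) i) (s (\<pi> k)) (a + m - 1) (\<xi> z) * jet (q (\<pi> k) i) (t (\<pi> k)) b (\<eta> z)))" for i
        proof (cases "p k i")
          case True
          note j = jets[OF k3 True]
          have "complex_of_real (c k i) = of_real (\<rho> k) * of_real (c (\<pi> k) i)"
            using j by (simp flip: of_real_mult)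
          moreover have "\<xi> z ^ m * (of_real (c k i) * (jet (p k i) (s k) a (\<xi> z) * jet (q k i) (t k) b (\<eta> z)))
            = of_real (c k i) * jet (q k i) (t k) b (\<eta> z) * (\<xi> z ^ m * dmon (s k) a (\<xi> z))"
            using True by (simp add: jet_def mult_ac)
          ultimately show ?thesis
            using j True dmon_shift[OF st(1) , of m "\<xi> z" k a] m
            by (simp add: jet_def algebra_simps)
        next
          case False
          have "complex_of_real (\<rho> k) * of_real (c (\<pi> k) i) = 0"
            using nojets[OF k3 False] by (simp flip: of_real_mult)
          then have "complex_of_real (\<rho> k) = 0 \<or> complex_of_real (c (\<pi> k) i) = 0" by simp
          moreover have "\<xi> z ^ m * (of_real (c k i) * (jet (p k i) (s k) a (\<xi> z) * jet (q k i) (t k) b (\<eta> z)))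
            = of_real (c k i) * jet (q k i) (t k) b (\<eta> z) * (\<xi> z ^ m * emon (s k) a (\<xi> z))"
            using False by (simp add: jet_def mult_ac)
          ultimately show ?thesis
            using False emon_shift[OF st(1), of "\<xi> z" m k a]
            by (auto simp: jet_def mult_ac)
        qed
        then show ?thesis by (simp add: k vec_eq_iff jet_vec_def P_def Q_def x_def y_def)
      qed
      show "B \<ge> 0" using D1 by (simp add: B_def)
      show "cmod (x \<kappa>) \<le> B" if \<kappa>: "\<kappa> \<in> box N" for N \<kappa>
      proof -
        obtain k a b where k: "\<kappa> = (k, a, b)" by (metis prod_cases3)
        have k3: "k < 3" using \<kappa> k by (simp add: box_def)
        have "cmod (x \<kappa>) \<le> (1 + 1 / s k) * (real m + 1)"
          using emon_ratio_bound[OF st(1), of k a m] by (simp add: k x_def)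
        also have "\<dots> \<le> B" unfolding B_def by (intro mult_right_mono Dk1 k3) auto
        finally show ?thesis .
      qed
      show "cmod (y \<kappa>) \<le> B" if \<kappa>: "\<kappa> \<in> box N" for N \<kappa>
      proof -
        obtain k a b where k: "\<kappa> = (k, a, b)" by (metis prod_cases3)
        have k3: "k < 3" using \<kappa> k by (simp add: box_def)
        have "cmod (y \<kappa>) = \<bar>\<rho> k\<bar> * dmon_defect (s k) a m"
          using dmon_defect_bound[OF st(1), of k a m] by (simp add: k y_def abs_mult norm_mult)
        also have "\<dots> \<le> \<bar>\<rho> k\<bar> * ((1 + 1 / s k) * (real m + 1))"
          using dmon_defect_bound[OF st(1), of k a m] by (intro mult_left_mono) auto
        also have "\<dots> = ((1 + 1 / s k) * \<bar>\<rho> k\<bar>) * (real m + 1)" by (simp add: mult_ac)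
        also have "\<dots> \<le> B" unfolding B_def by (intro mult_right_mono Dk1 k3) auto
        finally show ?thesis .
      qed
      show "inj_on P (box N)" for N by (auto simp: inj_on_def P_def)
      show "P ` box N \<subseteq> box (N + m)" for N by (auto simp: P_def box_def)
      show "inj_on Q (box N)" for N
        using \<pi> m by (auto simp: inj_on_def Q_def box_def bij_betw_def)
      show "Q ` box N \<subseteq> box (N + m)" for N
        using \<pi> m by (auto simp: Q_def box_def bij_betw_def)
    qed
    then show ?thesis by (simp add: B_def mult_ac)
  qed
  have "0 \<le> 2 * D" using D1 by simp
  then show ?thesis using main by blast
qed

lemma bij_betw_table:
  "bij_betw (\<lambda>k::nat. (k + 1) mod 3) {..<3} {..<3}" "bij_betw (\<lambda>k::nat. (k + 2) mod 3) {..<3} {..<3}"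
proof -
  have *: "{..<3} = {0, 1, 2::nat}" by auto
  show "bij_betw (\<lambda>k::nat. (k + 1) mod 3) {..<3} {..<3}" "bij_betw (\<lambda>k::nat. (k + 2) mod 3) {..<3} {..<3}"
    unfolding * bij_betw_def by (auto simp: inj_on_def)
qed

lemma (in rkhs) jet_sum_rkhs_growth:
  assumes K: "\<And>z w i j. z \<in> bidisc \<Longrightarrow> w \<in> bidisc \<Longrightarrow> K z w $ i $ j = jet_sum fst snd c p s q t z w i j"
    and st: "\<And>k. s k > 0" "\<And>k. t k > 0"
    and \<pi>: "bij_betw \<pi> {..<3} {..<3::nat}"
    and jets: "\<And>k i. k < 3 \<Longrightarrow> p k i \<Longrightarrow> \<rho> k * c (\<pi> k) i = c k i \<and> \<not> p (\<pi> k) i \<and>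
      s (\<pi> k) = s k + 2 \<and> t (\<pi> k) = t k \<and> q (\<pi> k) i = q k i"
    and nojets: "\<And>k i. k < 3 \<Longrightarrow> \<not> p k i \<Longrightarrow> \<rho> k * c (\<pi> k) i = 0"
    and \<pi>': "bij_betw \<pi>' {..<3} {..<3::nat}"
    and jets': "\<And>k i. k < 3 \<Longrightarrow> q k i \<Longrightarrow> \<rho>' k * c (\<pi>' k) i = c k i \<and> \<not> q (\<pi>' k) i \<and>
      t (\<pi>' k) = t k + 2 \<and> s (\<pi>' k) = s k \<and> p (\<pi>' k) i = p k i"
    and nojets': "\<And>k i. k < 3 \<Longrightarrow> \<not> q k i \<Longrightarrow> \<rho>' k * c (\<pi>' k) i = 0"
  shows "\<exists>C. rkhs_growth K H C"
proof -
  have K': "K z w $ i $ j = jet_sum snd fst c q t p s z w i j" if "z \<in> bidisc" "w \<in> bidisc" for z w i j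
    unfolding K[OF that] jet_sum_def by (intro sum.cong refl) (simp add: mult_ac)
  have "\<exists>C\<ge>0. \<forall>m f. f \<in> carr H \<longrightarrow> mult_op (\<lambda>z. fst z ^ m) f \<in> carr H \<and>
    hnorm H (mult_op (\<lambda>z. fst z ^ m) f) \<le> C * (real m + 1) * hnorm H f"
    by (rule jet_sum_growth[where \<xi> = fst and \<eta> = snd, OF _ _ K st \<pi> jets nojets]) auto
  then obtain C1 where C1: "C1 \<ge> 0" "\<And>m f. f \<in> carr H \<Longrightarrow> mult_op (\<lambda>z. fst z ^ m) f \<in> carr H \<and>
    hnorm H (mult_op (\<lambda>z. fst z ^ m) f) \<le> C1 * (real m + 1) * hnorm H f" by blast
  have "\<exists>C\<ge>0. \<forall>m f. f \<in> carr H \<longrightarrow> mult_op (\<lambda>z. snd z ^ m) f \<in> carr H \<and>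
    hnorm H (mult_op (\<lambda>z. snd z ^ m) f) \<le> C * (real m + 1) * hnorm H f"
    by (rule jet_sum_growth[where \<xi> = snd and \<eta> = fst, OF _ _ K' st(2,1) \<pi>' jets' nojets']) auto
  then obtain C2 where C2: "C2 \<ge> 0" "\<And>m f. f \<in> carr H \<Longrightarrow> mult_op (\<lambda>z. snd z ^ m) f \<in> carr H \<and>
    hnorm H (mult_op (\<lambda>z. snd z ^ m) f) \<le> C2 * (real m + 1) * hnorm H f" by blast
  have le: "C1 * (real m + 1) * hnorm H f \<le> (C1 + C2) * (real m + 1) * hnorm H f"
    "C2 * (real m + 1) * hnorm H f \<le> (C1 + C2) * (real m + 1) * hnorm H f" if "f \<in> carr H" for m f
    using C1(1) C2(1) that by (intro mult_right_mono; simp)+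
  have "rkhs_growth K H (C1 + C2)"
  proof
    fix p :: "complex \<times> complex \<Rightarrow> complex" and f m assume p: "p \<in> {fst, snd}" and f: "f \<in> carr H"
    show "mult_op (\<lambda>z. p z ^ m) f \<in> carr H" using p C1(2)[OF f, of m] C2(2)[OF f, of m] by auto
    show "hnorm H (mult_op (\<lambda>z. p z ^ m) f) \<le> (C1 + C2) * (real m + 1) * hnorm H f"
      using p C1(2)[OF f, of m] C2(2)[OF f, of m]
      by (auto intro: order_trans[OF _ le(1)[OF f, of m]] order_trans[OF _ le(2)[OF f, of m]])
  qed (use C1 C2 in simp)
  then show ?thesis by blast
qed

text \<open>As a function of \<open>z\<close>, \<open>pow_ker s z w\<close> is a power series whose radius of convergence exceeds one.\<close>

lemma (in rkhs_growth) pow_ker_multiplier: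
  assumes V: "invariant_space V" and \<xi>: "\<xi> \<in> {fst, snd}" and w: "cmod w < 1"
  shows "(\<lambda>z. pow_ker s (\<xi> z) w) \<in> multipliers V"
proof (rule multipliers_power_series[OF V \<xi>])
  obtain \<rho> where \<rho>: "cmod w < \<rho>" "\<rho> < 1" using dense[OF w] by blast
  have \<rho>0: "\<rho> > 0" using \<rho>(1) norm_ge_zero[of w] by linarith
  define r where "r = (1 + 1 / \<rho>) / 2"
  have r: "r > 1" "\<rho> * r < 1" using \<rho> \<rho>0 by (auto simp: r_def field_simps)
  have "summable (\<lambda>n. complex_of_real (pow_coeff s n) * of_real (\<rho> * r) ^ n)"
    using pow_coeff_sums[of "of_real (\<rho> * r)" s] r \<rho>0 by (auto simp: sums_iff norm_mult simp del: of_real_mult)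
  moreover have "norm (of_real r * cnj w) < norm (complex_of_real (\<rho> * r))"
    using r \<rho> \<rho>0 by (simp add: norm_mult)
  ultimately have "summable (\<lambda>n. norm (complex_of_real (pow_coeff s n) * (of_real r * cnj w) ^ n))"
    by (rule powser_insidea)
  then have "summable (\<lambda>n. cmod (of_real (pow_coeff s n) * cnj w ^ n) * r ^ n)"
    using r by (simp add: norm_mult norm_power power_mult_distrib mult_ac)
  then show "summable (\<lambda>n. cmod (of_real (pow_coeff s n) * cnj w ^ n) * (real n + 1))"
    by (rule summable_linear_weight[OF r(1)])
  fix z :: "complex \<times> complex" assume "z \<in> bidisc"
  then have "cmod (\<xi> z) < 1" using \<xi> by (auto simp: in_bidisc)
  from pow_ker_sums[OF this w, of s]
  show "(\<lambda>n. of_real (pow_coeff s n) * cnj w ^ n * \<xi> z ^ n) sums pow_ker s (\<xi> z) w"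
    by (simp add: power_mult_distrib mult_ac)
qed

lemma (in rkhs_growth) jet_sum_multiplier:
  assumes V: "invariant_space V" and w: "w \<in> bidisc"
  shows "(\<lambda>z. jet_sum fst snd c p s q t z w i j) \<in> multipliers V"
proof -
  note mi = multipliers_intros[OF V]
  have jm: "(\<lambda>z. jetk b b' r (\<xi> z) u) \<in> multipliers V" if \<xi>: "\<xi> \<in> {fst, snd}" and u: "cmod u < 1" for b b' r \<xi> u
  proof -
    have "(\<lambda>z. \<xi> z) \<in> multipliers V" using \<xi> mi(1,2) by auto
    then show ?thesis unfolding jetk_def
      by (cases b; cases b') (simp_all only: if_True if_False, (intro mi pow_ker_multiplier[OF V \<xi> u] | assumption)+)
  qed
  have w': "cmod (fst w) < 1" "cmod (snd w) < 1" using w by (auto simp: in_bidisc)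
  show ?thesis unfolding jet_sum_def numeral_3_eq_3 sum.lessThan_Suc lessThan_0 sum.empty
    by (intro mi jm w') auto
qed

section \<open>The two families of kernels\<close>

lemma mat3_entry: "(mat k ** (diag3 a b c ** M ** diag3 a b c)) $ i $ j =
   k * ((if i = 1 then a else if i = 2 then b else c) * M $ i $ j * (if j = 1 then a else if j = 2 then b else c))"
  using exhaust_3[of i] exhaust_3[of j]
  by (auto simp: matrix_matrix_mult_def mat_def diag3_def sum_3 vector_3)

text \<open>The weights and exponents of the three summands of \<open>K\<close>: the jet in both variables, and the two diagonal terms. The
index \<open>3\<close> of type \<open>3\<close> is the last component.\<close>

definition coeff_K :: "real \<Rightarrow> real \<Rightarrow> nat \<Rightarrow> 3 \<Rightarrow> real" where
  "coeff_K m1 m2 k i = (if k = 0 then 1 else if k = 1 then (if i = 2 then m1 else 0) else if i = 3 then m2 else 0)"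

definition exp1_K :: "real \<Rightarrow> nat \<Rightarrow> real" where "exp1_K l k = (if k = 1 then l + 2 else l)"
definition exp2_K :: "real \<Rightarrow> nat \<Rightarrow> real" where "exp2_K l k = (if k = 2 then l + 2 else l)"

abbreviation jets_K where "jets_K l1 l2 m1 m2 \<equiv>
  jet_sum fst snd (coeff_K m1 m2) (\<lambda>k i. k = 0 \<and> i = (2::3)) (exp1_K l1) (\<lambda>k i. k = 0 \<and> i = 3) (exp2_K l2)"

lemma kernel_factor_pk: "kernel_factor s t z w = pow_ker (s + 2) (fst z) (fst w) * pow_ker (t + 2) (snd z) (snd w)"
proof -
  have "- (x + 2) = - x - (2::real)" for x by simp
  then show ?thesis by (simp only: kernel_factor_def pow_ker_def)
qed

lemma pow_ker_steps:
  assumes "cmod z < 1" "cmod w < 1"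
  shows "pow_ker (s + 1) z w = (1 - z * cnj w) * pow_ker (s + 2) z w"
    "pow_ker s z w = (1 - z * cnj w) * ((1 - z * cnj w) * pow_ker (s + 2) z w)"
proof -
  have eq: "s + 1 + 1 = s + 2" by simp
  show 1: "pow_ker (s + 1) z w = (1 - z * cnj w) * pow_ker (s + 2) z w"
    using pow_ker_step[OF assms, of "s + 1"] unfolding eq .
  show "pow_ker s z w = (1 - z * cnj w) * ((1 - z * cnj w) * pow_ker (s + 2) z w)"
    using pow_ker_step[OF assms, of s] unfolding 1 .
qed

lemma kernel_K_jets:
  assumes z: "z \<in> bidisc" and w: "w \<in> bidisc"
  shows "kernel_K l1 l2 m1 m2 z w $ i $ j = jets_K l1 l2 m1 m2 z w i j"
proof -
  have b: "cmod (fst z) < 1" "cmod (fst w) < 1" "cmod (snd z) < 1" "cmod (snd w) < 1"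
    using z w by (auto simp: in_bidisc)
  define X where "X = 1 - fst z * cnj (fst w)"
  define Y where "Y = 1 - snd z * cnj (snd w)"
  note st = pow_ker_steps[OF b(1,2), of l1, folded X_def] pow_ker_steps[OF b(3,4), of l2, folded Y_def]
  show ?thesis
    unfolding kernel_K_def Let_def mat3_entry kernel_factor_pk X_def[symmetric] Y_def[symmetric]
    using exhaust_3[of i] exhaust_3[of j]
    by (elim disjE; simp add: jet_sum_def coeff_K_def exp1_K_def exp2_K_def jetk_def numeral_3_eq_3 st vector_3
      power2_eq_square distrib_left distrib_right mult_ac)
qed

text \<open>The weights and exponents of the three summands of \<open>L\<close>: the jet in the first variable, the jet in the second
variable, and the last diagonal term.\<close>

definition coeff_L :: "real \<Rightarrow> real \<Rightarrow> nat \<Rightarrow> 3 \<Rightarrow> real" where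
  "coeff_L b1 b2 k i = (if k = 0 then (if i = 2 then 0 else 1) else if k = 1 then (if i = 1 then 0 else b1)
     else if i = 3 then b2 else 0)"

definition exp1_L :: "real \<Rightarrow> nat \<Rightarrow> real" where "exp1_L a k = (if k = 0 then a else a + 2)"
definition exp2_L :: "real \<Rightarrow> nat \<Rightarrow> real" where "exp2_L a k = (if k = 1 then a else a + 2)"

abbreviation jets_L where "jets_L a1 a2 b1 b2 \<equiv>
  jet_sum fst snd (coeff_L b1 b2) (\<lambda>k i. k = 0 \<and> i = (3::3)) (exp1_L a1) (\<lambda>k i. k = 1 \<and> i = 3) (exp2_L a2)"

lemma kernel_L_jets:
  assumes z: "z \<in> bidisc" and w: "w \<in> bidisc"
  shows "kernel_L a1 a2 b1 b2 z w $ i $ j = jets_L a1 a2 b1 b2 z w i j"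
proof -
  have b: "cmod (fst z) < 1" "cmod (fst w) < 1" "cmod (snd z) < 1" "cmod (snd w) < 1"
    using z w by (auto simp: in_bidisc)
  define X where "X = 1 - fst z * cnj (fst w)"
  define Y where "Y = 1 - snd z * cnj (snd w)"
  note st = pow_ker_steps[OF b(1,2), of a1, folded X_def] pow_ker_steps[OF b(3,4), of a2, folded Y_def]
  show ?thesis
    unfolding kernel_L_def Let_def mat3_entry kernel_factor_pk X_def[symmetric] Y_def[symmetric]
    using exhaust_3[of i] exhaust_3[of j]
    by (elim disjE; simp add: jet_sum_def coeff_L_def exp1_L_def exp2_L_def jetk_def numeral_3_eq_3 st vector_3
      power2_eq_square distrib_left distrib_right mult_ac)
qed

text \<open>The jet summand has its errors absorbed by the second summand for the first variable and by the third for the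
second variable. This is where \<open>\<mu>\<^sub>1\<close> and \<open>\<mu>\<^sub>2\<close> must be nonzero.\<close>

lemma kernel_K_growth:
  assumes H: "holomorphic_rkhs (kernel_K l1 l2 m1 m2) H" and pos: "l1 > 0" "l2 > 0" "m1 > 0" "m2 > 0"
  shows "\<exists>C. rkhs_growth (kernel_K l1 l2 m1 m2) H C"
proof -
  interpret rkhs "kernel_K l1 l2 m1 m2" H by unfold_locales (rule H)
  show ?thesis
    by (rule jet_sum_rkhs_growth[OF kernel_K_jets _ _ bij_betw_table(1) _ _ bij_betw_table(2), where
        \<rho> = "\<lambda>k. if k = 0 then 1 / m1 else 0" and \<rho>' = "\<lambda>k. if k = 0 then 1 / m2 else 0"])
      (use pos in \<open>auto simp: coeff_K_def exp1_K_def exp2_K_def\<close>)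
qed

text \<open>Both jet summands have their errors absorbed by the last summand, which requires \<open>\<beta>\<^sub>2\<close> to be nonzero.\<close>

lemma kernel_L_growth:
  assumes H: "holomorphic_rkhs (kernel_L a1 a2 b1 b2) H" and pos: "a1 > 0" "a2 > 0" "b1 > 0" "b2 > 0"
  shows "\<exists>C. rkhs_growth (kernel_L a1 a2 b1 b2) H C"
proof -
  interpret rkhs "kernel_L a1 a2 b1 b2" H by unfold_locales (rule H)
  show ?thesis
    by (rule jet_sum_rkhs_growth[OF kernel_L_jets _ _ bij_betw_table(2) _ _ bij_betw_table(1), where
        \<rho> = "\<lambda>k. if k = 0 then 1 / b2 else 0" and \<rho>' = "\<lambda>k. if k = 1 then b1 / b2 else 0"])
      (use pos in \<open>auto simp: coeff_L_def exp1_L_def exp2_L_def\<close>)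
qed

section \<open>Moebius covariance of the one-variable jets\<close>

lemma Re_one_minus_pos: "cmod t < 1 \<Longrightarrow> Re (1 - t) > 0"
  using complex_Re_le_cmod[of t] by simp

lemma mob_one_minus:
  assumes c: "cmod c = 1" and a: "cmod a < 1" and z: "cmod z < 1" and w: "cmod w < 1"
  shows "(1 - mob c a z * cnj (mob c a w)) * ((1 - cnj a * z) * cnj (1 - cnj a * w))
    = (1 - a * cnj a) * (1 - z * cnj w)"
proof -
  define qz where "qz = 1 - cnj a * z"
  define qw where "qw = 1 - a * cnj w"
  have nz: "qz \<noteq> 0" "qw \<noteq> 0"
    using one_minus_nz[of "cnj a" z] one_minus_nz[of a "cnj w"] a z w by (auto simp: qz_def qw_def)
  have cc: "c * cnj c = 1" using c by (simp add: complex_norm_square[symmetric])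
  have m: "mob c a z = c * (z - a) / qz" "cnj (mob c a w) = cnj c * (cnj w - cnj a) / qw"
    by (simp_all add: mob_def qz_def qw_def)
  have "(1 - mob c a z * cnj (mob c a w)) * (qz * qw) = qz * qw - (c * cnj c) * ((z - a) * (cnj w - cnj a))"
    unfolding m using nz by (simp add: field_simps)
  also have "\<dots> = (1 - a * cnj a) * (1 - z * cnj w)"
    unfolding cc by (simp add: qz_def qw_def algebra_simps)
  finally show ?thesis by (simp add: qz_def qw_def)
qed

text \<open>The identity \<open>mob_one_minus\<close> raised to the power \<open>-s\<close>. For a real exponent the principal branches have to match: all
four factors have positive real part, so their arguments are below \<open>\<pi>/2\<close> and the two logarithms, which can differ only
by a multiple of \<open>2 \<pi> i\<close>, have imaginary parts less than \<open>2 \<pi>\<close> apart.\<close>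

lemma pow_ker_mob:
  fixes s :: real
  assumes c: "cmod c = 1" and a: "cmod a < 1"
  defines "g \<equiv> \<lambda>z. complex_of_real ((1 - (cmod a)\<^sup>2) powr (s / 2)) * (1 - cnj a * z) powr of_real (- s)"
  assumes z: "cmod z < 1" and w: "cmod w < 1"
  shows "pow_ker s z w = g z * cnj (g w) * pow_ker s (mob c a z) (mob c a w)" "g z \<noteq> 0"
proof -
  define n where "n = 1 - (cmod a)\<^sup>2"
  have n: "n > 0" using a by (simp add: n_def abs_square_less_1)
  have nc: "1 - a * cnj a = of_real n" by (simp add: n_def complex_norm_square[symmetric])
  define A where "A = 1 - mob c a z * cnj (mob c a w)"
  define T where "T = 1 - z * cnj w"
  define qz where "qz = 1 - cnj a * z"
  define qw where "qw = 1 - cnj a * w"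
  have re: "Re A > 0" "Re T > 0" "Re qz > 0" "Re qw > 0"
    unfolding A_def T_def qz_def qw_def
    using zw_less[OF mob_norm_less[OF c a z] mob_norm_less[OF c a w]] zw_less[OF z w] zw_less[OF z a] zw_less[OF w a]
    by (intro Re_one_minus_pos; simp add: mult.commute)+
  have nz: "A \<noteq> 0" "T \<noteq> 0" "qz \<noteq> 0" "qw \<noteq> 0" using re by auto
  have nn: "A \<notin> \<real>\<^sub>\<le>\<^sub>0" "T \<notin> \<real>\<^sub>\<le>\<^sub>0" "qz \<notin> \<real>\<^sub>\<le>\<^sub>0" "qw \<notin> \<real>\<^sub>\<le>\<^sub>0"
    using re by (auto simp: complex_nonpos_Reals_iff)
  have im: "\<bar>Im (Ln A)\<bar> < pi / 2" "\<bar>Im (Ln T)\<bar> < pi / 2" "\<bar>Im (Ln qz)\<bar> < pi / 2" "\<bar>Im (Ln qw)\<bar> < pi / 2"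
    using re nz Re_Ln_pos_lt by blast+
  have Aq: "A * (qz * cnj qw) = of_real n * T"
    using mob_one_minus[OF c a z w] by (simp add: A_def T_def qz_def qw_def nc)
  have Ln_eq: "Ln T = Ln A + Ln qz + cnj (Ln qw) - of_real (ln n)"
  proof (rule exp_complex_eqI)
    show "\<bar>Im (Ln T) - Im (Ln A + Ln qz + cnj (Ln qw) - of_real (ln n))\<bar> < 2 * pi"
    proof -
      have "Im (Ln A + Ln qz + cnj (Ln qw) - of_real (ln n)) = Im (Ln A) + Im (Ln qz) - Im (Ln qw)" by simp
      then show ?thesis using im by linarith
    qed
    have "exp (Ln A + Ln qz + cnj (Ln qw) - of_real (ln n)) = A * qz * cnj qw / of_real n"
      using nz n by (simp add: exp_add exp_diff exp_cnj[symmetric] exp_of_real)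
    also have "\<dots> = T" using Aq n by (simp add: mult.assoc)
    finally show "exp (Ln T) = exp (Ln A + Ln qz + cnj (Ln qw) - of_real (ln n))" using nz by simp
  qed
  have g: "g u = exp (of_real (s / 2) * of_real (ln n) - of_real s * Ln (1 - cnj a * u))" if "1 - cnj a * u \<noteq> 0" for u
  proof -
    have "complex_of_real (n powr (s / 2)) = exp (of_real (s / 2) * of_real (ln n))"
      using n by (simp add: powr_def exp_of_real[symmetric])
    moreover have "(1 - cnj a * u) powr of_real (- s) = exp (- of_real s * Ln (1 - cnj a * u))"
      using that by (simp add: powr_def)
    ultimately show ?thesis
      unfolding g_def n_def[symmetric] by (simp only: mult_exp_exp) simp
  qed
  have "pow_ker s z w = exp (- of_real s * Ln T)" using nz by (simp add: pow_ker_def powr_def T_def)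
  also have "\<dots> = exp ((of_real (s / 2) * of_real (ln n) - of_real s * Ln qz)
      + cnj (of_real (s / 2) * of_real (ln n) - of_real s * Ln qw) + - of_real s * Ln A)"
    unfolding Ln_eq by (simp add: algebra_simps)
  also have "\<dots> = g z * cnj (g w) * pow_ker s (mob c a z) (mob c a w)"
  proof -
    have "g z = exp (of_real (s / 2) * of_real (ln n) - of_real s * Ln qz)"
      "cnj (g w) = exp (cnj (of_real (s / 2) * of_real (ln n) - of_real s * Ln qw))"
      "pow_ker s (mob c a z) (mob c a w) = exp (- of_real s * Ln A)"
      using nz g[of z] g[of w] by (simp_all add: qz_def qw_def exp_cnj pow_ker_def powr_def A_def)
    then show ?thesis by (simp only: mult_exp_exp)
  qed
  finally show "pow_ker s z w = g z * cnj (g w) * pow_ker s (mob c a z) (mob c a w)" .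
  show "g z \<noteq> 0" using g nz by (simp add: qz_def)
qed

text \<open>The rule by which the jet of \<open>g \<cdot> (F \<circ> \<phi>)\<close> is computed from the jet of \<open>F\<close>, expressed for kernels. For a Moebius
map \<open>\<phi>\<close> the factor \<open>g\<close> makes \<open>pow_ker s\<close> invariant, \<open>f\<close> is the derivative of \<open>\<phi>\<close>, and \<open>j = g' / (s g)\<close>.\<close>

definition jet_cocycle :: "(complex \<Rightarrow> complex) \<Rightarrow> (complex \<Rightarrow> complex) \<Rightarrow> (complex \<Rightarrow> complex)
    \<Rightarrow> (real \<Rightarrow> complex \<Rightarrow> complex) \<Rightarrow> bool" where
  "jet_cocycle \<phi> j f g \<longleftrightarrow>
    (\<forall>z. cmod z < 1 \<longrightarrow> f z \<noteq> 0 \<and> (\<forall>s. g s z \<noteq> 0)) \<and>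
    (\<forall>s z w. cmod z < 1 \<longrightarrow> cmod w < 1 \<longrightarrow>
      jetk False False s z w = g s z * cnj (g s w) * jetk False False s (\<phi> z) (\<phi> w) \<and>
      pow_ker (s + 2) z w = g s z * cnj (g s w) * (f z * cnj (f w) * pow_ker (s + 2) (\<phi> z) (\<phi> w)) \<and>
      jetk False True s z w = g s z * cnj (g s w) *
        (cnj (j w) * jetk False False s (\<phi> z) (\<phi> w) + cnj (f w) * jetk False True s (\<phi> z) (\<phi> w)) \<and>
      jetk True False s z w = g s z * cnj (g s w) *
        (j z * jetk False False s (\<phi> z) (\<phi> w) + f z * jetk True False s (\<phi> z) (\<phi> w)) \<and>
      jetk True True s z w = g s z * cnj (g s w) *
        (j z * cnj (j w) * jetk False False s (\<phi> z) (\<phi> w)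
        + j z * cnj (f w) * jetk False True s (\<phi> z) (\<phi> w)
        + f z * cnj (j w) * jetk True False s (\<phi> z) (\<phi> w)
        + f z * cnj (f w) * jetk True True s (\<phi> z) (\<phi> w)))"

lemma jet_cocycleD:
  assumes "jet_cocycle \<phi> j f g"
  shows "cmod z < 1 \<Longrightarrow> f z \<noteq> 0" "cmod z < 1 \<Longrightarrow> g s z \<noteq> 0"
  using assms unfolding jet_cocycle_def by blast+

lemma jet_cocycle_eqs:
  assumes "jet_cocycle \<phi> j f g" "cmod z < 1" "cmod w < 1"
  shows "jetk False False s z w = g s z * cnj (g s w) * jetk False False s (\<phi> z) (\<phi> w)"
    "pow_ker (s + 2) z w = g s z * cnj (g s w) * (f z * cnj (f w) * pow_ker (s + 2) (\<phi> z) (\<phi> w))"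
    "jetk False True s z w = g s z * cnj (g s w) *
      (cnj (j w) * jetk False False s (\<phi> z) (\<phi> w) + cnj (f w) * jetk False True s (\<phi> z) (\<phi> w))"
    "jetk True False s z w = g s z * cnj (g s w) *
      (j z * jetk False False s (\<phi> z) (\<phi> w) + f z * jetk True False s (\<phi> z) (\<phi> w))"
    "jetk True True s z w = g s z * cnj (g s w) *
      (j z * cnj (j w) * jetk False False s (\<phi> z) (\<phi> w)
      + j z * cnj (f w) * jetk False True s (\<phi> z) (\<phi> w)
      + f z * cnj (j w) * jetk True False s (\<phi> z) (\<phi> w)
      + f z * cnj (f w) * jetk True True s (\<phi> z) (\<phi> w))"
  using assms unfolding jet_cocycle_def by blast+

text \<open>Writing \<open>A\<close> and \<open>T\<close> for \<open>1 - z \<bar>w\<close> at the transformed and at the original points, all jet kernels are polynomial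
multiples of the kernel with exponent \<open>s + 2\<close>. So the rule reduces to the covariance of that kernel and
to three rational identities, \<open>I1\<close>, \<open>I2\<close> and \<open>I3\<close>, for \<open>E = A / T\<close>.\<close>

lemma jet_mob:
  assumes c: "cmod c = 1" and a: "cmod a < 1"
  shows "\<exists>j f g. jet_cocycle (mob c a) j f g"
proof -
  define n where "n = complex_of_real (1 - (cmod a)\<^sup>2)"
  have "1 - (cmod a)\<^sup>2 > 0" using a by (simp add: abs_square_less_1)
  then have n0: "n \<noteq> 0" unfolding n_def of_real_eq_0_iff by simp
  have nc: "n = 1 - a * cnj a" by (simp add: n_def complex_norm_square[symmetric])
  have cn: "cnj n = n" by (simp add: n_def)
  have cc: "c * cnj c = 1" using c by (simp add: complex_norm_square[symmetric])
  define g where "g = (\<lambda>s z. complex_of_real ((1 - (cmod a)\<^sup>2) powr (s / 2)) * (1 - cnj a * z) powr of_real (- s))"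
  define f where "f = (\<lambda>z. c * n / (1 - cnj a * z)\<^sup>2)"
  define j where "j = (\<lambda>z. cnj a / (1 - cnj a * z))"
  have qn: "1 - cnj a * z \<noteq> 0" if "cmod z < 1" for z
    using one_minus_nz[of "cnj a" z] a that by simp
  have key: "jetk False True s z w = g s z * cnj (g s w) *
      (cnj (j w) * jetk False False s (mob c a z) (mob c a w) + cnj (f w) * jetk False True s (mob c a z) (mob c a w))
    \<and> jetk True False s z w = g s z * cnj (g s w) *
      (j z * jetk False False s (mob c a z) (mob c a w) + f z * jetk True False s (mob c a z) (mob c a w))
    \<and> jetk True True s z w = g s z * cnj (g s w) *
      (j z * cnj (j w) * jetk False False s (mob c a z) (mob c a w)
      + j z * cnj (f w) * jetk False True s (mob c a z) (mob c a w)
      + f z * cnj (j w) * jetk True False s (mob c a z) (mob c a w)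
      + f z * cnj (f w) * jetk True True s (mob c a z) (mob c a w))
    \<and> pow_ker (s + 2) z w = g s z * cnj (g s w) * (f z * cnj (f w) * pow_ker (s + 2) (mob c a z) (mob c a w))"
    if z: "cmod z < 1" and w: "cmod w < 1" for s z w
  proof -
    define \<phi> where "\<phi> = mob c a z"
    define \<psi> where "\<psi> = mob c a w"
    define A where "A = 1 - \<phi> * cnj \<psi>"
    define T where "T = 1 - z * cnj w"
    define u where "u = 1 - cnj a * z"
    define v where "v = 1 - a * cnj w"
    define p where "p = pow_ker (s + 2) \<phi> \<psi>"
    define P where "P = pow_ker (s + 2) z w"
    define G where "G = g s z * cnj (g s w)"
    have \<phi>1: "cmod \<phi> < 1" and \<psi>1: "cmod \<psi> < 1" using mob_norm_less[OF c a] z w by (auto simp: \<phi>_def \<psi>_def)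
    have T0: "T \<noteq> 0" using one_minus_zw_nz[OF z w] by (simp add: T_def)
    have u0: "u \<noteq> 0" using qn[OF z] by (simp add: u_def)
    have v0: "v \<noteq> 0" using one_minus_nz[of a "cnj w"] a w by (simp add: v_def)
    have fz: "f z = c * n / u\<^sup>2" and fw: "cnj (f w) = cnj c * n / v\<^sup>2"
      by (simp_all add: f_def u_def v_def cn)
    have jz: "j z = cnj a / u" and jw: "cnj (j w) = a / v" by (simp_all add: j_def u_def v_def)
    have ph: "\<phi> = c * (z - a) / u" and ps: "cnj \<psi> = cnj c * (cnj w - cnj a) / v"
      by (simp_all add: \<phi>_def \<psi>_def mob_def u_def v_def)
    have A: "A = n * T / (u * v)"
      using mob_one_minus[OF c a z w] u0 v0
      by (simp add: A_def \<phi>_def \<psi>_def u_def v_def nc T_def eq_divide_eq)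
    define E where "E = n / (u * v)"
    have AE: "A = T * E" by (simp add: A E_def)
    have I3: "E\<^sup>2 = f z * cnj (f w)"
    proof -
      have "f z * cnj (f w) = (c * cnj c) * (n * n / (u\<^sup>2 * v\<^sup>2))" unfolding fz fw by simp
      then show ?thesis unfolding cc by (simp add: E_def power2_eq_square)
    qed
    have I1: "z * E = A * cnj (j w) + \<phi> * cnj (f w)"
    proof -
      have "\<phi> * cnj (f w) = (c * cnj c) * (n * (z - a) / (u * v\<^sup>2))" unfolding ph fw by simp
      then have "A * cnj (j w) + \<phi> * cnj (f w) = n * (T * a + (z - a)) / (u * v\<^sup>2)"
        unfolding cc jw A by (simp add: power2_eq_square distrib_left add_divide_distrib mult.assoc)
      also have "T * a + (z - a) = z * v" by (simp add: T_def v_def algebra_simps)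
      finally show ?thesis using v0 by (simp add: E_def power2_eq_square)
    qed
    have I2: "cnj w * E = A * j z + cnj \<psi> * f z"
    proof -
      have "cnj \<psi> * f z = (c * cnj c) * (n * (cnj w - cnj a) / (u\<^sup>2 * v))" unfolding ps fz by (simp add: mult_ac)
      then have "A * j z + cnj \<psi> * f z = n * (T * cnj a + (cnj w - cnj a)) / (u\<^sup>2 * v)"
        unfolding cc jz A by (simp add: power2_eq_square distrib_left add_divide_distrib mult.assoc)
      also have "T * cnj a + (cnj w - cnj a) = cnj w * u" by (simp add: T_def u_def algebra_simps)
      finally show ?thesis using u0 by (simp add: E_def power2_eq_square)
    qed
    have st: "pow_ker (s + 1) z w = T * P" "pow_ker s z w = T * (T * P)"
      "pow_ker (s + 1) \<phi> \<psi> = A * p" "pow_ker s \<phi> \<psi> = A * (A * p)"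
      using pow_ker_steps[OF z w, of s] pow_ker_steps[OF \<phi>1 \<psi>1, of s] by (simp_all add: T_def A_def P_def p_def)
    have "T * (T * P) = G * (A * (A * p))"
      using pow_ker_mob(1)[OF c a z w, of s] unfolding st(2,4)[symmetric] by (simp add: G_def g_def \<phi>_def \<psi>_def)
    then have "T * T * P = T * T * (G * (E\<^sup>2 * p))" unfolding AE by (simp add: power2_eq_square mult_ac)
    then have P: "P = G * (E\<^sup>2 * p)" using T0 by simp
    have TE: "T * (E\<^sup>2) = A * E" by (simp add: AE power2_eq_square)
    have 1: "z * (T * P) = G * (cnj (j w) * (A * (A * p)) + cnj (f w) * (\<phi> * (A * p)))"
    proof -
      have "z * (T * P) = G * (p * (z * (T * E\<^sup>2)))" unfolding P by (simp add: mult_ac)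
      also have "\<dots> = G * (p * (A * (z * E)))" unfolding TE by (simp add: mult_ac)
      finally show ?thesis unfolding I1 by (simp add: algebra_simps)
    qed
    have 2: "cnj w * (T * P) = G * (j z * (A * (A * p)) + f z * (cnj \<psi> * (A * p)))"
    proof -
      have "cnj w * (T * P) = G * (p * (cnj w * (T * E\<^sup>2)))" unfolding P by (simp add: mult_ac)
      also have "\<dots> = G * (p * (A * (cnj w * E)))" unfolding TE by (simp add: mult_ac)
      finally show ?thesis unfolding I2 by (simp add: algebra_simps)
    qed
    have 3: "(of_real (1 / s) + z * cnj w) * P = G * (j z * cnj (j w) * (A * (A * p))
        + j z * cnj (f w) * (\<phi> * (A * p)) + f z * cnj (j w) * (cnj \<psi> * (A * p))
        + f z * cnj (f w) * ((of_real (1 / s) + \<phi> * cnj \<psi>) * p))"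
    proof -
      have "(of_real (1 / s) + z * cnj w) * P = G * p * (of_real (1 / s) * E\<^sup>2 + (z * E) * (cnj w * E))"
        unfolding P by (simp add: power2_eq_square algebra_simps)
      then show ?thesis unfolding I1 I2 I3 by (simp add: algebra_simps)
    qed
    have 4: "P = G * (f z * cnj (f w) * p)" using P unfolding I3 .
    show ?thesis
      unfolding jetk_def if_True if_False \<phi>_def[symmetric] \<psi>_def[symmetric] st
        p_def[symmetric] P_def[symmetric] G_def[symmetric]
      using 1 2 3 4 by blast
  qed
  have "f z \<noteq> 0" if "cmod z < 1" for z
    using qn[OF that] n0 c by (auto simp: f_def)
  moreover have "g s z \<noteq> 0" if "cmod z < 1" for s z
    using pow_ker_mob(2)[OF c a that that, of s] by (simp add: g_def)
  moreover have "jetk False False s z w = g s z * cnj (g s w) * jetk False False s (mob c a z) (mob c a w)"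
    if "cmod z < 1" "cmod w < 1" for s z w
    using pow_ker_mob(1)[OF c a that, of s] by (simp add: g_def jetk_def)
  ultimately have "jet_cocycle (mob c a) j f g"
    unfolding jet_cocycle_def using key by blast
  then show ?thesis by blast
qed

section \<open>Covariance of the two kernels\<close>

lemmas mat3_simps = vec_eq_iff forall_3 matrix_matrix_mult_def sum_3 vector_3

lemma kernel_K_matrix:
  fixes l1 l2 :: real and z w :: "complex \<times> complex"
  assumes z: "z \<in> bidisc" and w: "w \<in> bidisc"
  defines "A \<equiv> \<lambda>b b'. jetk b b' l1 (fst z) (fst w)" and "B \<equiv> \<lambda>b b'. jetk b b' l2 (snd z) (snd w)"
  shows "kernel_K l1 l2 m1 m2 z w = vector
    [vector [A False False * B False False, A False True * B False False, A False False * B False True],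
     vector [A True False * B False False, A True True * B False False
       + (of_real m1)\<^sup>2 * (pow_ker (l1 + 2) (fst z) (fst w) * B False False), A True False * B False True],
     vector [A False False * B True False, A False True * B True False, A False False * B True True
       + (of_real m2)\<^sup>2 * (A False False * pow_ker (l2 + 2) (snd z) (snd w))]]"
  unfolding vec_eq_iff forall_3 kernel_K_jets[OF z w]
  by (simp add: jet_sum_def coeff_K_def exp1_K_def exp2_K_def numeral_3_eq_3 A_def B_def vector_3
      power2_eq_square) (simp add: jetk_def)

lemma kernel_L_matrix:
  fixes a1 a2 :: real and z w :: "complex \<times> complex"
  assumes z: "z \<in> bidisc" and w: "w \<in> bidisc"
  defines "A \<equiv> \<lambda>b b'. jetk b b' a1 (fst z) (fst w)" and "B \<equiv> \<lambda>b b'. jetk b b' a2 (snd z) (snd w)"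
    and "p \<equiv> pow_ker (a1 + 2) (fst z) (fst w)" and "q \<equiv> pow_ker (a2 + 2) (snd z) (snd w)"
  shows "kernel_L a1 a2 b1 b2 z w = vector
    [vector [A False False * q, 0, A False True * q],
     vector [0, (of_real b1)\<^sup>2 * (p * B False False), (of_real b1)\<^sup>2 * (p * B False True)],
     vector [A True False * q, (of_real b1)\<^sup>2 * (p * B True False),
       A True True * q + (of_real b1)\<^sup>2 * (p * B True True) + (of_real b2)\<^sup>2 * (p * q)]]"
  unfolding vec_eq_iff forall_3 kernel_L_jets[OF z w]
  by (simp add: jet_sum_def coeff_L_def exp1_L_def exp2_L_def numeral_3_eq_3 A_def B_def p_def q_def vector_3
      power2_eq_square) (simp add: jetk_def)

text \<open>The matrix \<open>J\<close> is the transformation rule of \<open>(F, \<partial>\<^sub>1 F / \<lambda>\<^sub>1, \<partial>\<^sub>2 F / \<lambda>\<^sub>2)\<close> under \<open>F \<mapsto> G \<cdot> (F \<circ> \<gamma>)\<close>. On the two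
diagonal terms it acts by \<open>G\<close> times the derivative of one Moebius map, which is the factor of the kernel with that exponent
raised by two.\<close>

lemma kernel_K_covariant:
  assumes ca: "cmod c1 = 1" "cmod a1 < 1" "cmod c2 = 1" "cmod a2 < 1"
  shows "\<exists>J. (\<forall>z\<in>bidisc. invertible (J z)) \<and> (\<forall>z\<in>bidisc. \<forall>w\<in>bidisc.
    J z ** kernel_K l1 l2 m1 m2 (bimob False c1 a1 c2 a2 z) (bimob False c1 a1 c2 a2 w) ** adjm (J w)
      = kernel_K l1 l2 m1 m2 z w)"
proof -
  obtain j1 f1 g1 where A: "jet_cocycle (mob c1 a1) j1 f1 g1" using jet_mob[OF ca(1,2)] by blast
  obtain j2 f2 g2 where B: "jet_cocycle (mob c2 a2) j2 f2 g2" using jet_mob[OF ca(3,4)] by blast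
  define G where "G = (\<lambda>z. g1 l1 (fst z) * g2 l2 (snd z))"
  define J :: "complex \<times> complex \<Rightarrow> complex^3^3" where
    "J = (\<lambda>z. vector [vector [G z, 0, 0], vector [G z * j1 (fst z), G z * f1 (fst z), 0],
       vector [G z * j2 (snd z), 0, G z * f2 (snd z)]])"
  have "invertible (J z)" if "z \<in> bidisc" for z
    using that jet_cocycleD[OF A] jet_cocycleD[OF B] unfolding invertible_det_nz
    by (simp add: det_3 J_def vector_3 G_def in_bidisc)
  moreover have "J z ** kernel_K l1 l2 m1 m2 (bimob False c1 a1 c2 a2 z) (bimob False c1 a1 c2 a2 w) ** adjm (J w)
      = kernel_K l1 l2 m1 m2 z w" if z: "z \<in> bidisc" and w: "w \<in> bidisc" for z w
  proof -
    have b: "cmod (fst z) < 1" "cmod (fst w) < 1" "cmod (snd z) < 1" "cmod (snd w) < 1"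
      using z w by (auto simp: in_bidisc)
    define X where "X = (\<lambda>b b'. jetk b b' l1 (mob c1 a1 (fst z)) (mob c1 a1 (fst w)))"
    define x where "x = pow_ker (l1 + 2) (mob c1 a1 (fst z)) (mob c1 a1 (fst w))"
    define Y where "Y = (\<lambda>b b'. jetk b b' l2 (mob c2 a2 (snd z)) (mob c2 a2 (snd w)))"
    define y where "y = pow_ker (l2 + 2) (mob c2 a2 (snd z)) (mob c2 a2 (snd w))"
    note A' = jet_cocycle_eqs[OF A b(1,2), of l1] and B' = jet_cocycle_eqs[OF B b(3,4), of l2]
    have \<gamma>: "fst (bimob False c1 a1 c2 a2 u) = mob c1 a1 (fst u)"
      "snd (bimob False c1 a1 c2 a2 u) = mob c2 a2 (snd u)" for u by (simp_all add: bimob_def)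
    show ?thesis
      unfolding kernel_K_matrix[OF bimob_in[OF ca z] bimob_in[OF ca w]] kernel_K_matrix[OF z w] \<gamma> A' B'
        X_def[symmetric] x_def[symmetric] Y_def[symmetric] y_def[symmetric]
      by (simp add: mat3_simps adjm_def J_def G_def) (simp add: algebra_simps)
  qed
  ultimately show ?thesis by blast
qed

text \<open>The two jets in \<open>L\<close> belong to scalar kernels in which the exponent of the other variable is raised by two; their
factors are therefore \<open>G\<close> times the derivative of the other Moebius map.\<close>

lemma kernel_L_covariant:
  assumes ca: "cmod c1 = 1" "cmod a1 < 1" "cmod c2 = 1" "cmod a2 < 1"
  shows "\<exists>J. (\<forall>z\<in>bidisc. invertible (J z)) \<and> (\<forall>z\<in>bidisc. \<forall>w\<in>bidisc.
    J z ** kernel_L l1 l2 m1 m2 (bimob False c1 a1 c2 a2 z) (bimob False c1 a1 c2 a2 w) ** adjm (J w)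
      = kernel_L l1 l2 m1 m2 z w)"
proof -
  obtain j1 f1 g1 where A: "jet_cocycle (mob c1 a1) j1 f1 g1" using jet_mob[OF ca(1,2)] by blast
  obtain j2 f2 g2 where B: "jet_cocycle (mob c2 a2) j2 f2 g2" using jet_mob[OF ca(3,4)] by blast
  define G where "G = (\<lambda>z. g1 l1 (fst z) * g2 l2 (snd z))"
  define J :: "complex \<times> complex \<Rightarrow> complex^3^3" where
    "J = (\<lambda>z. vector [vector [G z * f2 (snd z), 0, 0], vector [0, G z * f1 (fst z), 0],
       vector [G z * (f2 (snd z) * j1 (fst z)), G z * (f1 (fst z) * j2 (snd z)), G z * (f1 (fst z) * f2 (snd z))]])"
  have "invertible (J z)" if "z \<in> bidisc" for z
    using that jet_cocycleD[OF A] jet_cocycleD[OF B] unfolding invertible_det_nz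
    by (simp add: det_3 J_def vector_3 G_def in_bidisc)
  moreover have "J z ** kernel_L l1 l2 m1 m2 (bimob False c1 a1 c2 a2 z) (bimob False c1 a1 c2 a2 w) ** adjm (J w)
      = kernel_L l1 l2 m1 m2 z w" if z: "z \<in> bidisc" and w: "w \<in> bidisc" for z w
  proof -
    have b: "cmod (fst z) < 1" "cmod (fst w) < 1" "cmod (snd z) < 1" "cmod (snd w) < 1"
      using z w by (auto simp: in_bidisc)
    define X where "X = (\<lambda>b b'. jetk b b' l1 (mob c1 a1 (fst z)) (mob c1 a1 (fst w)))"
    define x where "x = pow_ker (l1 + 2) (mob c1 a1 (fst z)) (mob c1 a1 (fst w))"
    define Y where "Y = (\<lambda>b b'. jetk b b' l2 (mob c2 a2 (snd z)) (mob c2 a2 (snd w)))"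
    define y where "y = pow_ker (l2 + 2) (mob c2 a2 (snd z)) (mob c2 a2 (snd w))"
    note A' = jet_cocycle_eqs[OF A b(1,2), of l1] and B' = jet_cocycle_eqs[OF B b(3,4), of l2]
    have \<gamma>: "fst (bimob False c1 a1 c2 a2 u) = mob c1 a1 (fst u)"
      "snd (bimob False c1 a1 c2 a2 u) = mob c2 a2 (snd u)" for u by (simp_all add: bimob_def)
    show ?thesis
      unfolding kernel_L_matrix[OF bimob_in[OF ca z] bimob_in[OF ca w]] kernel_L_matrix[OF z w] \<gamma> A' B'
        X_def[symmetric] x_def[symmetric] Y_def[symmetric] y_def[symmetric]
      by (simp add: mat3_simps adjm_def J_def G_def) (simp add: algebra_simps)
  qed
  ultimately show ?thesis by blast
qed

text \<open>Covariance under the swap by a permutation matrix \<open>P\<close> extends covariance to all automorphisms.\<close>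

lemma bimob_covariant:
  fixes K :: "complex \<times> complex \<Rightarrow> complex \<times> complex \<Rightarrow> complex^'n^'n"
  assumes cov: "\<And>c1 a1 c2 a2. cmod c1 = 1 \<Longrightarrow> cmod a1 < 1 \<Longrightarrow> cmod c2 = 1 \<Longrightarrow> cmod a2 < 1 \<Longrightarrow>
    \<exists>J. (\<forall>z\<in>bidisc. invertible (J z)) \<and> (\<forall>z\<in>bidisc. \<forall>w\<in>bidisc.
      J z ** K (bimob False c1 a1 c2 a2 z) (bimob False c1 a1 c2 a2 w) ** adjm (J w) = K z w)"
    and P: "P ** P = mat 1" "adjm P = P"
    and swap: "\<And>z w. z \<in> bidisc \<Longrightarrow> w \<in> bidisc \<Longrightarrow> K (prod.swap z) (prod.swap w) = P ** K z w ** P"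
    and ca: "cmod c1 = 1" "cmod a1 < 1" "cmod c2 = 1" "cmod a2 < 1"
  shows "\<exists>J. (\<forall>z\<in>bidisc. invertible (J z)) \<and> (\<forall>z\<in>bidisc. \<forall>w\<in>bidisc.
      J z ** K (bimob s c1 a1 c2 a2 z) (bimob s c1 a1 c2 a2 w) ** adjm (J w) = K z w)"
proof (cases s)
  case False
  then show ?thesis using cov[OF ca] by simp
next
  case True
  obtain J where J: "\<And>z. z \<in> bidisc \<Longrightarrow> invertible (J z)" "\<And>z w. z \<in> bidisc \<Longrightarrow> w \<in> bidisc \<Longrightarrow>
      J z ** K (bimob False c2 a2 c1 a1 z) (bimob False c2 a2 c1 a1 w) ** adjm (J w) = K z w"
    using cov[OF ca(3,4,1,2)] by blast
  have eq: "bimob True c1 a1 c2 a2 z = prod.swap (bimob False c2 a2 c1 a1 z)" for z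
    by (simp add: bimob_def)
  have PP: "X ** P ** P = X" for X :: "complex^'n^'n" by (simp add: matrix_mul_assoc[symmetric] P)
  have "(J z ** P) ** K (bimob True c1 a1 c2 a2 z) (bimob True c1 a1 c2 a2 w) ** adjm (J w ** P) = K z w"
    if "z \<in> bidisc" "w \<in> bidisc" for z w
    unfolding eq swap[OF bimob_in[OF ca(3,4,1,2) that(1)] bimob_in[OF ca(3,4,1,2) that(2)]] adjm_mult P(2)
    using J(2)[OF that] by (simp add: matrix_mul_assoc PP)
  moreover have "invertible P" using P(1) unfolding invertible_def by blast
  ultimately show ?thesis using True J(1)
    by (intro exI[of _ "\<lambda>z. J z ** P"]) (auto intro: invertible_mult)
qed

text \<open>For equal parameters the swap exchanges the last two components of \<open>K\<close>.\<close>

lemma kernel_K_homogeneous: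
  assumes H: "holomorphic_rkhs (kernel_K l l m m) H" and pos: "l > 0" "m > 0"
  shows "homogeneous_pair H coord_mult_pair"
proof -
  obtain C where "rkhs_growth (kernel_K l l m m) H C" using kernel_K_growth[OF H] pos by blast
  then interpret rkhs_growth "kernel_K l l m m" H C .
  define P :: "complex^3^3" where "P = vector [vector [1, 0, 0], vector [0, 0, 1], vector [0, 1, 0]]"
  show ?thesis
  proof (rule homogeneous_if_covariant, rule bimob_covariant[OF kernel_K_covariant])
    show "P ** P = mat 1" "adjm P = P" by (simp_all add: mat3_simps P_def mat_def adjm_def)
    fix z w :: "complex \<times> complex" assume zw: "z \<in> bidisc" "w \<in> bidisc"
    then have "prod.swap z \<in> bidisc" "prod.swap w \<in> bidisc" by (auto simp: in_bidisc)
    then show "kernel_K l l m m (prod.swap z) (prod.swap w) = P ** kernel_K l l m m z w ** P"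
      by (simp add: kernel_K_matrix zw mat3_simps P_def mult.commute)
  qed
qed

text \<open>For \<open>\<alpha>\<^sub>1 = \<alpha>\<^sub>2\<close> and \<open>\<beta>\<^sub>1 = 1\<close> the swap exchanges the first two components of \<open>L\<close>.\<close>

lemma kernel_L_homogeneous:
  assumes H: "holomorphic_rkhs (kernel_L a a 1 b) H" and pos: "a > 0" "b > 0"
  shows "homogeneous_pair H coord_mult_pair"
proof -
  obtain C where "rkhs_growth (kernel_L a a 1 b) H C" using kernel_L_growth[OF H] pos by auto
  then interpret rkhs_growth "kernel_L a a 1 b" H C .
  define P :: "complex^3^3" where "P = vector [vector [0, 1, 0], vector [1, 0, 0], vector [0, 0, 1]]"
  show ?thesis
  proof (rule homogeneous_if_covariant, rule bimob_covariant[OF kernel_L_covariant])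
    show "P ** P = mat 1" "adjm P = P" by (simp_all add: mat3_simps P_def mat_def adjm_def)
    fix z w :: "complex \<times> complex" assume zw: "z \<in> bidisc" "w \<in> bidisc"
    then have "prod.swap z \<in> bidisc" "prod.swap w \<in> bidisc" by (auto simp: in_bidisc)
    then show "kernel_L a a 1 b (prod.swap z) (prod.swap w) = P ** kernel_L a a 1 b z w ** P"
      by (simp add: kernel_L_matrix zw mat3_simps P_def mult.commute)
  qed
qed

section \<open>Invariants of the coordinate swap\<close>

text \<open>The factor \<open>J\<close> is unknown, but it cancels up to conjugation in \<open>K(z, 0)\<^sup>-\<^sup>1 K(z, z) K(0, z)\<^sup>-\<^sup>1 K(0, 0)\<close>: here \<open>M\<close>, \<open>N\<close>,
\<open>N2\<close>, \<open>D\<close> are \<open>K(z, z)\<close>, \<open>K(z, 0)\<close>, \<open>K(0, z)\<close>, \<open>K(0, 0)\<close>, the primed matrices are their values at the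
transformed points, and \<open>R\<close>, \<open>L\<close> are the inverses of \<open>N\<close>, \<open>N2\<close>.\<close>

lemma similar_invariants:
  fixes M N N2 D M' N' N2' D' R L R' L' Jz J0 :: "complex^'n^'n"
  assumes M: "M = Jz ** M' ** adjm Jz" and N: "N = Jz ** N' ** adjm J0"
    and N2: "N2 = J0 ** N2' ** adjm Jz" and D: "D = J0 ** D' ** adjm J0"
    and R: "R ** N = mat 1" and L: "N2 ** L = mat 1"
    and R': "R' ** N' = mat 1" and L': "N2' ** L' = mat 1" and D0: "det D \<noteq> 0"
  shows "trace (R ** M ** L ** D) = trace (R' ** M' ** L' ** D')"
    "det (R ** M ** L ** D) = det (R' ** M' ** L' ** D')"
proof -
  have "det J0 \<noteq> 0" "det (adjm J0) \<noteq> 0" using D0 unfolding D by (auto simp: det_mul)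
  then obtain J B where J: "J ** J0 = mat 1" "J0 ** J = mat 1"
    and B: "B ** adjm J0 = mat 1" "adjm J0 ** B = mat 1"
    unfolding invertible_det_nz[symmetric] invertible_def by metis
  have R'2: "N' ** R' = mat 1" and L'2: "L' ** N2' = mat 1"
    using R' L' matrix_left_right_inverse by blast+
  have RJ: "R ** Jz = B ** R'"
  proof -
    have "R ** Jz ** N' = (R ** N) ** B"
      unfolding N by (simp add: matrix_mul_assoc[symmetric] B)
    then have "R ** Jz ** N' ** R' = B ** R'" unfolding R by simp
    then show ?thesis by (simp add: matrix_mul_assoc[symmetric] R'2)
  qed
  have JL: "adjm Jz ** L = L' ** J"
  proof -
    have "N2' ** adjm Jz ** L = J ** (N2 ** L)"
      unfolding N2 by (simp add: matrix_mul_assoc J)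
    then have "L' ** (N2' ** adjm Jz ** L) = L' ** J" unfolding L by simp
    then show ?thesis by (simp add: matrix_mul_assoc L'2)
  qed
  have "R ** M ** L ** D = (R ** Jz) ** M' ** (adjm Jz ** L) ** D"
    unfolding M by (simp add: matrix_mul_assoc)
  also have "\<dots> = B ** R' ** M' ** L' ** (J ** J0) ** D' ** adjm J0"
    unfolding RJ JL D by (simp add: matrix_mul_assoc)
  finally have eq: "R ** M ** L ** D = B ** (R' ** M' ** L' ** D') ** adjm J0"
    unfolding J by (simp add: matrix_mul_assoc)
  have "trace (R ** M ** L ** D) = trace (adjm J0 ** (B ** (R' ** M' ** L' ** D')))"
    unfolding eq by (rule trace_mul_sym)
  then show "trace (R ** M ** L ** D) = trace (R' ** M' ** L' ** D')"
    by (simp add: matrix_mul_assoc B)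
  have "det B * det (adjm J0) = 1" using arg_cong[OF B(1), of det] by (simp add: det_mul)
  then show "det (R ** M ** L ** D) = det (R' ** M' ** L' ** D')"
    unfolding eq det_mul by (simp add: mult_ac)
qed

lemma swap_invariants:
  fixes K :: "complex \<times> complex \<Rightarrow> complex \<times> complex \<Rightarrow> complex^'n^'n"
  assumes J: "\<And>z w. z \<in> bidisc \<Longrightarrow> w \<in> bidisc \<Longrightarrow>
      K z w = J z ** K (prod.swap z) (prod.swap w) ** adjm (J w)"
    and inv: "R ** K (1/2, 0) (0, 0) = mat 1" "K (0, 0) (1/2, 0) ** L = mat 1"
      "R' ** K (0, 1/2) (0, 0) = mat 1" "K (0, 0) (0, 1/2) ** L' = mat 1"
    and D0: "det (K (0, 0) (0, 0)) \<noteq> 0"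
  shows "trace (R ** K (1/2, 0) (1/2, 0) ** L ** K (0, 0) (0, 0)) =
      trace (R' ** K (0, 1/2) (0, 1/2) ** L' ** K (0, 0) (0, 0))"
    "det (R ** K (1/2, 0) (1/2, 0) ** L ** K (0, 0) (0, 0)) =
      det (R' ** K (0, 1/2) (0, 1/2) ** L' ** K (0, 0) (0, 0))"
proof -
  have b: "(1/2, 0) \<in> bidisc" "(0, 0) \<in> bidisc" by (auto simp: in_bidisc norm_divide)
  have 1: "K (1/2, 0) (1/2, 0) = J (1/2, 0) ** K (0, 1/2) (0, 1/2) ** adjm (J (1/2, 0))"
    "K (1/2, 0) (0, 0) = J (1/2, 0) ** K (0, 1/2) (0, 0) ** adjm (J (0, 0))"
    "K (0, 0) (1/2, 0) = J (0, 0) ** K (0, 0) (0, 1/2) ** adjm (J (1/2, 0))"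
    "K (0, 0) (0, 0) = J (0, 0) ** K (0, 0) (0, 0) ** adjm (J (0, 0))"
    using J[OF b(1,1)] J[OF b(1,2)] J[OF b(2,1)] J[OF b(2,2)] by simp_all
  show "trace (R ** K (1/2, 0) (1/2, 0) ** L ** K (0, 0) (0, 0)) =
      trace (R' ** K (0, 1/2) (0, 1/2) ** L' ** K (0, 0) (0, 0))"
    "det (R ** K (1/2, 0) (1/2, 0) ** L ** K (0, 0) (0, 0)) =
      det (R' ** K (0, 1/2) (0, 1/2) ** L' ** K (0, 0) (0, 0))"
    by (rule similar_invariants[OF 1 inv D0])+
qed

lemma pow_ker_half: "pow_ker s (1/2) (1/2) = of_real ((3/4) powr (- s))"
proof -
  have "1 - (1/2) * cnj (1/2) = complex_of_real (3/4)" by (simp add: complex_eq_iff)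
  then show ?thesis by (simp only: pow_ker_def powr_of_real[of "3/4"])
qed

lemma pow_ker_0 [simp]: "pow_ker s z 0 = 1" "pow_ker s 0 w = 1"
  by (simp_all add: pow_ker_def)

lemma kernel_K_origin:
  fixes l1 l2 m1 m2 :: real
  defines "k1 \<equiv> complex_of_real (1 / l1 + m1\<^sup>2)" and "k2 \<equiv> complex_of_real (1 / l2 + m2\<^sup>2)"
  shows "kernel_K l1 l2 m1 m2 z (0, 0) =
      vector [vector [1, fst z, snd z], vector [0, k1, 0], vector [0, 0, k2]]"
    "kernel_K l1 l2 m1 m2 (0, 0) w =
      vector [vector [1, 0, 0], vector [cnj (fst w), k1, 0], vector [cnj (snd w), 0, k2]]"
  unfolding vec_eq_iff forall_3 kernel_K_def Let_def mat3_entry kernel_factor_pk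
  by (simp_all add: vector_3 k1_def k2_def)

lemma kernel_K_half:
  fixes l1 l2 m1 m2 :: real
  defines "k1 \<equiv> complex_of_real (1 / l1 + m1\<^sup>2)" and "k2 \<equiv> complex_of_real (1 / l2 + m2\<^sup>2)"
    and "P \<equiv> pow_ker (l1 + 2) (1/2) (1/2)" and "Q \<equiv> pow_ker (l2 + 2) (1/2) (1/2)"
  shows "kernel_K l1 l2 m1 m2 (1/2, 0) (1/2, 0) = vector [vector [9/16 * P, 3/8 * P, 0],
      vector [3/8 * P, (k1 + 1/4) * P, 0], vector [0, 0, 9/16 * k2 * P]]"
    "kernel_K l1 l2 m1 m2 (0, 1/2) (0, 1/2) = vector [vector [9/16 * Q, 0, 3/8 * Q],
      vector [0, 9/16 * k1 * Q, 0], vector [3/8 * Q, 0, (k2 + 1/4) * Q]]"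
  unfolding vec_eq_iff forall_3 kernel_K_def Let_def mat3_entry kernel_factor_pk
  by (simp_all add: vector_3
      k1_def k2_def P_def[symmetric] Q_def[symmetric])

lemma kernel_L_origin:
  fixes a1 a2 b1 b2 :: real
  defines "b \<equiv> complex_of_real (b1\<^sup>2)" and "c \<equiv> complex_of_real (1 / a1 + b1\<^sup>2 / a2 + b2\<^sup>2)"
  shows "kernel_L a1 a2 b1 b2 z (0, 0) =
      vector [vector [1, 0, fst z], vector [0, b, b * snd z], vector [0, 0, c]]"
    "kernel_L a1 a2 b1 b2 (0, 0) w =
      vector [vector [1, 0, 0], vector [0, b, 0], vector [cnj (fst w), b * cnj (snd w), c]]"
  unfolding vec_eq_iff forall_3 kernel_L_def Let_def mat3_entry kernel_factor_pk
  by (simp_all add: vector_3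
      b_def c_def)

lemma kernel_L_half:
  fixes a1 a2 b1 b2 :: real
  defines "b \<equiv> complex_of_real (b1\<^sup>2)" and "c \<equiv> complex_of_real (1 / a1 + b1\<^sup>2 / a2 + b2\<^sup>2)"
    and "P \<equiv> pow_ker (a1 + 2) (1/2) (1/2)" and "Q \<equiv> pow_ker (a2 + 2) (1/2) (1/2)"
  shows "kernel_L a1 a2 b1 b2 (1/2, 0) (1/2, 0) = vector [vector [9/16 * P, 0, 3/8 * P],
      vector [0, b * P, 0], vector [3/8 * P, 0, (1/4 + c) * P]]"
    "kernel_L a1 a2 b1 b2 (0, 1/2) (0, 1/2) = vector [vector [Q, 0, 0],
      vector [0, 9/16 * b * Q, 3/8 * b * Q], vector [0, 3/8 * b * Q, (b/4 + c) * Q]]"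
  unfolding vec_eq_iff forall_3 kernel_L_def Let_def mat3_entry kernel_factor_pk
  by (simp_all add: vector_3
      b_def c_def P_def[symmetric] Q_def[symmetric])

lemma cube_powr_eq:
  assumes "(complex_of_real ((3/4) powr (- (s + 2))))^3 = (of_real ((3/4) powr (- (t + 2))))^3"
  shows "s = t"
proof -
  have "((3/4::real) powr (- (s + 2)))^3 = ((3/4) powr (- (t + 2)))^3"
    using assms by (simp only: of_real_power[symmetric] of_real_eq_iff)
  then have "(3/4::real) powr (- (s + 2)) = (3/4) powr (- (t + 2))"
    by (rule power_eq_imp_eq_base) auto
  then have "- (s + 2) = - (t + 2)" by (subst (asm) powr_inj) auto
  then show ?thesis by simp
qed

lemma quadratic_eq:
  fixes x y :: real
  assumes "x > 0" "y > 0" "x / 8 + x\<^sup>2 / 16 = y / 8 + y\<^sup>2 / 16"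
  shows "x = y"
proof -
  have "(x - y) * (2 + x + y) = 0" using assms(3) by (simp add: power2_eq_square algebra_simps)
  then show ?thesis using assms(1,2) by auto
qed

text \<open>At \<open>(1/2, 0)\<close> the determinant of the invariant matrix is a constant times the cube of \<open>(3/4)\<^sup>-\<^sup>\<lambda>\<^sup>-\<^sup>2\<close> with
\<open>\<lambda> = \<lambda>\<^sub>1\<close>, and at \<open>(0, 1/2)\<close> it has \<open>\<lambda> = \<lambda>\<^sub>2\<close>. Once the exponents agree, the traces compare
\<open>2 x + x\<^sup>2\<close> for \<open>x\<close> the inverses of \<open>1/\<lambda>\<^sub>1 + \<mu>\<^sub>1\<^sup>2\<close> and \<open>1/\<lambda>\<^sub>2 + \<mu>\<^sub>2\<^sup>2\<close>.\<close>

lemma kernel_K_swap_eq: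
  assumes pos: "l1 > 0" "l2 > 0" "m1 > 0" "m2 > 0"
    and J: "\<And>z w. z \<in> bidisc \<Longrightarrow> w \<in> bidisc \<Longrightarrow> kernel_K l1 l2 m1 m2 z w =
      J z ** kernel_K l1 l2 m1 m2 (prod.swap z) (prod.swap w) ** adjm (J w)"
  shows "l1 = l2 \<and> m1 = m2"
proof -
  define r1 where "r1 = 1 / l1 + m1\<^sup>2"
  define r2 where "r2 = 1 / l2 + m2\<^sup>2"
  have r: "r1 > 0" "r2 > 0" using pos by (auto simp: r1_def r2_def add_pos_pos)
  define k1 where "k1 = complex_of_real r1"
  define k2 where "k2 = complex_of_real r2"
  have k: "k1 \<noteq> 0" "k2 \<noteq> 0" using r by (auto simp: k1_def k2_def)
  define P where "P = pow_ker (l1 + 2) (1/2) (1/2)"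
  \<comment> \<open>At \<open>(0, 1/2)\<close> the roles of the two exponents are exchanged.\<close>
  define Q where "Q = pow_ker (l2 + 2) (1/2) (1/2)"
  have PQ: "P = of_real ((3/4) powr (- (l1 + 2)))" "Q = of_real ((3/4) powr (- (l2 + 2)))"
    by (simp_all only: P_def Q_def pow_ker_half)
  note orig = kernel_K_origin[of l1 l2 m1 m2, folded r1_def r2_def, folded k1_def k2_def]
  note half = kernel_K_half[of l1 l2 m1 m2, folded r1_def r2_def, folded k1_def k2_def P_def Q_def]
  define R where "R = (vector [vector [1, - 1 / (2 * k1), 0], vector [0, 1 / k1, 0], vector [0, 0, 1 / k2]] :: complex^3^3)"
  define L where "L = (vector [vector [1, 0, 0], vector [- 1 / (2 * k1), 1 / k1, 0], vector [0, 0, 1 / k2]] :: complex^3^3)"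
  define R' where "R' = (vector [vector [1, 0, - 1 / (2 * k2)], vector [0, 1 / k1, 0], vector [0, 0, 1 / k2]] :: complex^3^3)"
  define L' where "L' = (vector [vector [1, 0, 0], vector [0, 1 / k1, 0], vector [- 1 / (2 * k2), 0, 1 / k2]] :: complex^3^3)"
  define M where "M = kernel_K l1 l2 m1 m2 (1/2, 0) (1/2, 0)"
  define M' where "M' = kernel_K l1 l2 m1 m2 (0, 1/2) (0, 1/2)"
  define D where "D = kernel_K l1 l2 m1 m2 (0, 0) (0, 0)"
  have inv: "trace (R ** M ** L ** D) = trace (R' ** M' ** L' ** D)"
    "det (R ** M ** L ** D) = det (R' ** M' ** L' ** D)"
  proof -
    have "R ** kernel_K l1 l2 m1 m2 (1/2, 0) (0, 0) = mat 1" "kernel_K l1 l2 m1 m2 (0, 0) (1/2, 0) ** L = mat 1"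
      "R' ** kernel_K l1 l2 m1 m2 (0, 1/2) (0, 0) = mat 1" "kernel_K l1 l2 m1 m2 (0, 0) (0, 1/2) ** L' = mat 1"
      unfolding orig using k by (simp_all add: mat3_simps R_def L_def R'_def L'_def mat_def)
    moreover have "det (kernel_K l1 l2 m1 m2 (0, 0) (0, 0)) \<noteq> 0" unfolding orig using k by (simp add: det_3 vector_3)
    ultimately show "trace (R ** M ** L ** D) = trace (R' ** M' ** L' ** D)"
      "det (R ** M ** L ** D) = det (R' ** M' ** L' ** D)"
      unfolding M_def M'_def D_def using swap_invariants[of "kernel_K l1 l2 m1 m2" J R L R' L'] J by blast+
  qed
  have tr: "trace (R ** M ** L ** D) = P * (17/8 + (1 / k1 / 8 + (1 / k1)\<^sup>2 / 16))"
    "trace (R' ** M' ** L' ** D) = Q * (17/8 + (1 / k2 / 8 + (1 / k2)\<^sup>2 / 16))"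
    unfolding trace_def M_def M'_def D_def half orig using k
    by (simp_all add: mat3_simps R_def L_def R'_def L'_def field_simps power2_eq_square)
  have det: "det (R ** M ** L ** D) = 81/256 * P^3" "det (R' ** M' ** L' ** D) = 81/256 * Q^3"
    unfolding det_mul M_def M'_def D_def half orig using k
    by (simp_all add: det_3 vector_3 R_def L_def R'_def L'_def field_simps power3_eq_cube)
  have "P^3 = Q^3" using inv(2) unfolding det by simp
  then have l: "l1 = l2" unfolding PQ by (rule cube_powr_eq)
  have "P = Q" "P \<noteq> 0" using l by (simp_all add: PQ)
  then have "1 / k1 / 8 + (1 / k1)\<^sup>2 / 16 = 1 / k2 / 8 + (1 / k2)\<^sup>2 / 16"
    using inv(1) unfolding tr by simp
  then have "complex_of_real (1 / r1 / 8 + (1 / r1)\<^sup>2 / 16) = of_real (1 / r2 / 8 + (1 / r2)\<^sup>2 / 16)"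
    by (simp add: k1_def k2_def)
  then have "1 / r1 / 8 + (1 / r1)\<^sup>2 / 16 = 1 / r2 / 8 + (1 / r2)\<^sup>2 / 16" by (simp only: of_real_eq_iff)
  then have "1 / r1 = 1 / r2" by (rule quadratic_eq[rotated 2]) (use r in auto)
  then have "r1 = r2" by simp
  then have "m1\<^sup>2 = m2\<^sup>2" using l by (simp add: r1_def r2_def)
  then show ?thesis using l pos by (simp add: power2_eq_iff_nonneg)
qed

text \<open>As for \<open>K\<close>, with the last diagonal entry \<open>c\<close> of \<open>L(0, 0)\<close>: on the second axis the jet summand has weight \<open>\<beta>\<^sub>1\<^sup>2\<close>, so that
\<open>c\<close> is replaced by \<open>c / \<beta>\<^sub>1\<^sup>2\<close> in the trace.\<close>

lemma kernel_L_swap_eq: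
  assumes pos: "a1 > 0" "a2 > 0" "b1 > 0" "b2 > 0"
    and J: "\<And>z w. z \<in> bidisc \<Longrightarrow> w \<in> bidisc \<Longrightarrow> kernel_L a1 a2 b1 b2 z w =
      J z ** kernel_L a1 a2 b1 b2 (prod.swap z) (prod.swap w) ** adjm (J w)"
  shows "a1 = a2 \<and> b1 = 1"
proof -
  define r where "r = b1\<^sup>2"
  define s where "s = 1 / a1 + b1\<^sup>2 / a2 + b2\<^sup>2"
  have rs: "r > 0" "s > 0" using pos by (auto simp: r_def s_def add_pos_pos)
  define b where "b = complex_of_real r"
  define c where "c = complex_of_real s"
  have k: "b \<noteq> 0" "c \<noteq> 0" using rs by (auto simp: b_def c_def)
  define P where "P = pow_ker (a1 + 2) (1/2) (1/2)"
  define Q where "Q = pow_ker (a2 + 2) (1/2) (1/2)"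
  have PQ: "P = of_real ((3/4) powr (- (a1 + 2)))" "Q = of_real ((3/4) powr (- (a2 + 2)))"
    by (simp_all only: P_def Q_def pow_ker_half)
  note orig = kernel_L_origin[of a1 a2 b1 b2, folded s_def, folded r_def, folded b_def c_def]
  note half = kernel_L_half[of a1 a2 b1 b2, folded s_def, folded r_def, folded b_def c_def P_def Q_def]
  define R where "R = (vector [vector [1, 0, - 1 / (2 * c)], vector [0, 1 / b, 0], vector [0, 0, 1 / c]] :: complex^3^3)"
  define L where "L = (vector [vector [1, 0, 0], vector [0, 1 / b, 0], vector [- 1 / (2 * c), 0, 1 / c]] :: complex^3^3)"
  define R' where "R' = (vector [vector [1, 0, 0], vector [0, 1 / b, - 1 / (2 * c)], vector [0, 0, 1 / c]] :: complex^3^3)"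
  define L' where "L' = (vector [vector [1, 0, 0], vector [0, 1 / b, 0], vector [0, - 1 / (2 * c), 1 / c]] :: complex^3^3)"
  define M where "M = kernel_L a1 a2 b1 b2 (1/2, 0) (1/2, 0)"
  define M' where "M' = kernel_L a1 a2 b1 b2 (0, 1/2) (0, 1/2)"
  define D where "D = kernel_L a1 a2 b1 b2 (0, 0) (0, 0)"
  have inv: "trace (R ** M ** L ** D) = trace (R' ** M' ** L' ** D)"
    "det (R ** M ** L ** D) = det (R' ** M' ** L' ** D)"
  proof -
    have "R ** kernel_L a1 a2 b1 b2 (1/2, 0) (0, 0) = mat 1" "kernel_L a1 a2 b1 b2 (0, 0) (1/2, 0) ** L = mat 1"
      "R' ** kernel_L a1 a2 b1 b2 (0, 1/2) (0, 0) = mat 1" "kernel_L a1 a2 b1 b2 (0, 0) (0, 1/2) ** L' = mat 1"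
      unfolding orig using k by (simp_all add: mat3_simps R_def L_def R'_def L'_def mat_def)
    moreover have "det (kernel_L a1 a2 b1 b2 (0, 0) (0, 0)) \<noteq> 0" unfolding orig using k by (simp add: det_3 vector_3)
    ultimately show "trace (R ** M ** L ** D) = trace (R' ** M' ** L' ** D)"
      "det (R ** M ** L ** D) = det (R' ** M' ** L' ** D)"
      unfolding M_def M'_def D_def using swap_invariants[of "kernel_L a1 a2 b1 b2" J R L R' L'] J by blast+
  qed
  have tr: "trace (R ** M ** L ** D) = P * (41/16 + (1 / c / 8 + (1 / c)\<^sup>2 / 16))"
    "trace (R' ** M' ** L' ** D) = Q * (41/16 + (b / c / 8 + (b / c)\<^sup>2 / 16))"
    unfolding trace_def M_def M'_def D_def half orig using k
    by (simp_all add: mat3_simps R_def L_def R'_def L'_def field_simps power2_eq_square)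
  have det: "det (R ** M ** L ** D) = 9/16 * P^3" "det (R' ** M' ** L' ** D) = 9/16 * Q^3"
    unfolding det_mul M_def M'_def D_def half orig using k
    by (simp_all add: det_3 vector_3 R_def L_def R'_def L'_def field_simps power3_eq_cube)
  have "P^3 = Q^3" using inv(2) unfolding det by simp
  then have l: "a1 = a2" unfolding PQ by (rule cube_powr_eq)
  have "P = Q" "P \<noteq> 0" using l by (simp_all add: PQ)
  then have "1 / c / 8 + (1 / c)\<^sup>2 / 16 = b / c / 8 + (b / c)\<^sup>2 / 16"
    using inv(1) unfolding tr by simp
  then have "complex_of_real (1 / s / 8 + (1 / s)\<^sup>2 / 16) = of_real (r / s / 8 + (r / s)\<^sup>2 / 16)"
    by (simp add: b_def c_def)
  then have "1 / s / 8 + (1 / s)\<^sup>2 / 16 = r / s / 8 + (r / s)\<^sup>2 / 16" by (simp only: of_real_eq_iff)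
  then have "1 / s = r / s" by (rule quadratic_eq[rotated 2]) (use rs in auto)
  then have "r = 1" using rs by simp
  then show ?thesis using l pos by (simp add: r_def power2_eq_1_iff)
qed

section \<open>The characterisation of homogeneity\<close>

text \<open>The kernel functions at the origin are polynomials whose terms of degree zero span the constants; the terms of
degree one are coordinate multiples of the first constant vector.\<close>

lemma kernel_K_const:
  assumes g: "rkhs_growth (kernel_K l1 l2 m1 m2) H C" and pos: "l1 > 0" "l2 > 0" "m1 > 0" "m2 > 0"
  shows "const (axis i 1) \<in> carr H"
proof -
  interpret rkhs_growth "kernel_K l1 l2 m1 m2" H C by (rule g)
  have z0: "(0, 0) \<in> bidisc" by (simp add: in_bidisc)
  define k1 where "k1 = complex_of_real (1 / l1 + m1\<^sup>2)"
  define k2 where "k2 = complex_of_real (1 / l2 + m2\<^sup>2)"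
  have k: "k1 \<noteq> 0" "k2 \<noteq> 0" using pos unfolding k1_def k2_def of_real_eq_0_iff
    by (smt (verit) divide_pos_pos zero_less_power2)+
  note orig = kernel_K_origin(1)[of l1 l2 m1 m2, folded k1_def k2_def]
  have e1: "const (axis 1 1) = kfun (0, 0) (axis 1 1)"
    by (simp add: fun_eq_iff const_def kfun_def vec_eq_iff forall_3 mult_axis orig vector_3) (simp add: axis_def)
  then have c1: "const (axis 1 1) \<in> carr H" using z0 by simp
  have e2: "const (axis 2 1) = scl H (1 / k1) (kfun (0, 0) (axis 2 1) - mult_op fst (const (axis 1 1)))"
    using k by (simp add: fun_eq_iff const_def kfun_def vec_eq_iff forall_3 mult_axis orig vector_3 scl_eq mult_op_def)
      (simp add: axis_def)
  have e3: "const (axis 3 1) = scl H (1 / k2) (kfun (0, 0) (axis 3 1) - mult_op snd (const (axis 1 1)))"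
    using k by (simp add: fun_eq_iff const_def kfun_def vec_eq_iff forall_3 mult_axis orig vector_3 scl_eq mult_op_def)
      (simp add: axis_def)
  have "const (axis 2 1) \<in> carr H" "const (axis 3 1) \<in> carr H"
    unfolding e2 e3 by (intro carr_scl carr_diff kfun_carr z0 mult_coord c1; simp)+
  then show ?thesis using c1 exhaust_3[of i] by auto
qed

lemma kernel_L_const:
  assumes g: "rkhs_growth (kernel_L a1 a2 b1 b2) H C" and pos: "a1 > 0" "a2 > 0" "b1 > 0" "b2 > 0"
  shows "const (axis i 1) \<in> carr H"
proof -
  interpret rkhs_growth "kernel_L a1 a2 b1 b2" H C by (rule g)
  have z0: "(0, 0) \<in> bidisc" by (simp add: in_bidisc)
  define b where "b = complex_of_real (b1\<^sup>2)"
  define c where "c = complex_of_real (1 / a1 + b1\<^sup>2 / a2 + b2\<^sup>2)"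
  have "1 / a1 + b1\<^sup>2 / a2 + b2\<^sup>2 > 0" using pos by (intro add_pos_pos) auto
  then have k: "b \<noteq> 0" "c \<noteq> 0" using pos unfolding b_def c_def of_real_eq_0_iff by auto
  note orig = kernel_L_origin(1)[of a1 a2 b1 b2, folded c_def, folded b_def]
  have e1: "const (axis 1 1) = kfun (0, 0) (axis 1 1)"
    by (simp add: fun_eq_iff const_def kfun_def vec_eq_iff forall_3 mult_axis orig vector_3) (simp add: axis_def)
  have e2: "const (axis 2 1) = scl H (1 / b) (kfun (0, 0) (axis 2 1))"
    using k by (simp add: fun_eq_iff const_def kfun_def vec_eq_iff forall_3 mult_axis orig vector_3 scl_eq)
      (simp add: axis_def)
  have c12: "const (axis 1 1) \<in> carr H" "const (axis 2 1) \<in> carr H"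
    unfolding e1 e2 using z0 by simp_all
  have e3: "const (axis 3 1) = scl H (1 / c) (kfun (0, 0) (axis 3 1) - mult_op fst (const (axis 1 1))
      - scl H b (mult_op snd (const (axis 2 1))))"
    using k by (simp add: fun_eq_iff const_def kfun_def vec_eq_iff forall_3 mult_axis orig vector_3 scl_eq mult_op_def)
      (simp add: axis_def)
  have "const (axis 3 1) \<in> carr H"
    unfolding e3 by (intro carr_scl carr_diff kfun_carr z0 mult_coord c12; simp)
  then show ?thesis using c12 exhaust_3[of i] by auto
qed

theorem kernel_K_homogeneous_iff:
  assumes pos: "l1 > 0" "l2 > 0" "m1 > 0" "m2 > 0" and H: "holomorphic_rkhs (kernel_K l1 l2 m1 m2) H"
  shows "homogeneous_pair H coord_mult_pair \<longleftrightarrow> l1 = l2 \<and> m1 = m2"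
proof
  assume "l1 = l2 \<and> m1 = m2"
  then show "homogeneous_pair H coord_mult_pair" using kernel_K_homogeneous[of l1 m1 H] H pos by simp
next
  assume hom: "homogeneous_pair H coord_mult_pair"
  obtain C where g: "rkhs_growth (kernel_K l1 l2 m1 m2) H C" using kernel_K_growth[OF H pos] by blast
  interpret rkhs_growth "kernel_K l1 l2 m1 m2" H C by (rule g)
  have entries: "(\<lambda>z. kernel_K l1 l2 m1 m2 z w $ i $ j) \<in> multipliers V"
    if V: "invariant_space V" and w: "w \<in> bidisc" for V w i j
    by (rule multipliers_cong[OF V jet_sum_multiplier[OF V w]]) (rule kernel_K_jets[OF _ w])
  obtain J where J: "\<And>z w. z \<in> bidisc \<Longrightarrow> w \<in> bidisc \<Longrightarrow> kernel_K l1 l2 m1 m2 z w =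
      J z ** kernel_K l1 l2 m1 m2 (prod.swap z) (prod.swap w) ** adjm (J w)"
    by (rule homogeneous_imp_swap_covariant[OF hom kernel_K_const[OF g pos]]) (erule (1) entries, rule that)
  show "l1 = l2 \<and> m1 = m2" by (rule kernel_K_swap_eq[OF pos J])
qed

theorem kernel_L_homogeneous_iff:
  assumes pos: "a1 > 0" "a2 > 0" "b1 > 0" "b2 > 0" and H: "holomorphic_rkhs (kernel_L a1 a2 b1 b2) H"
  shows "homogeneous_pair H coord_mult_pair \<longleftrightarrow> a1 = a2 \<and> b1 = 1"
proof
  assume "a1 = a2 \<and> b1 = 1"
  then show "homogeneous_pair H coord_mult_pair" using kernel_L_homogeneous[of a1 b2 H] H pos by simp
next
  assume hom: "homogeneous_pair H coord_mult_pair"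
  obtain C where g: "rkhs_growth (kernel_L a1 a2 b1 b2) H C" using kernel_L_growth[OF H pos] by blast
  interpret rkhs_growth "kernel_L a1 a2 b1 b2" H C by (rule g)
  have entries: "(\<lambda>z. kernel_L a1 a2 b1 b2 z w $ i $ j) \<in> multipliers V"
    if V: "invariant_space V" and w: "w \<in> bidisc" for V w i j
    by (rule multipliers_cong[OF V jet_sum_multiplier[OF V w]]) (rule kernel_L_jets[OF _ w])
  obtain J where J: "\<And>z w. z \<in> bidisc \<Longrightarrow> w \<in> bidisc \<Longrightarrow> kernel_L a1 a2 b1 b2 z w =
      J z ** kernel_L a1 a2 b1 b2 (prod.swap z) (prod.swap w) ** adjm (J w)"
    by (rule homogeneous_imp_swap_covariant[OF hom kernel_L_const[OF g pos]]) (erule (1) entries, rule that)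
  show "a1 = a2 \<and> b1 = 1" by (rule kernel_L_swap_eq[OF pos J])
qed

theorem theorem8p9:
  shows "(\<forall>(lam1::real) (lam2::real) (mu1::real) (mu2::real)
            (A :: (complex \<times> complex \<Rightarrow> complex^3) hspace).
            lam1 > 0 \<and> lam2 > 0 \<and> mu1 > 0 \<and> mu2 > 0 \<and>
            holomorphic_rkhs (kernel_K lam1 lam2 mu1 mu2) A \<longrightarrow>
            (homogeneous_pair A coord_mult_pair \<longleftrightarrow> lam1 = lam2 \<and> mu1 = mu2)) \<and>
         (\<forall>(al1::real) (al2::real) (be1::real) (be2::real)
            (H :: (complex \<times> complex \<Rightarrow> complex^3) hspace).
            al1 > 0 \<and> al2 > 0 \<and> be1 > 0 \<and> be2 > 0 \<and>
            holomorphic_rkhs (kernel_L al1 al2 be1 be2) H \<longrightarrow>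
            (homogeneous_pair H coord_mult_pair \<longleftrightarrow> al1 = al2 \<and> be1 = 1))"
proof (intro conjI allI impI; elim conjE)
  fix lam1 lam2 mu1 mu2 :: real and A :: "(complex \<times> complex \<Rightarrow> complex^3) hspace"
  assume "lam1 > 0" "lam2 > 0" "mu1 > 0" "mu2 > 0" "holomorphic_rkhs (kernel_K lam1 lam2 mu1 mu2) A"
  then show "homogeneous_pair A coord_mult_pair \<longleftrightarrow> lam1 = lam2 \<and> mu1 = mu2"
    by (rule kernel_K_homogeneous_iff)
next
  fix al1 al2 be1 be2 :: real and H :: "(complex \<times> complex \<Rightarrow> complex^3) hspace"
  assume "al1 > 0" "al2 > 0" "be1 > 0" "be2 > 0" "holomorphic_rkhs (kernel_L al1 al2 be1 be2) H"
  then show "homogeneous_pair H coord_mult_pair \<longleftrightarrow> al1 = al2 \<and> be1 = 1"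
    by (rule kernel_L_homogeneous_iff)
qed

end
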